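(* Let $k$ be a field, $C$ a coalgebra over $k$, $\ell:C\to P\otimes P$ a strong connection on a principal $C$-extension $B\subseteq P$, and $\varphi:V_\varphi\to V_\varphi\otimes C$ a finite-dimensional corepresentation (right $C$-comodule). Let $\{p_\mu\}_\mu$ be a $k$-basis of $P$, $\{p^\mu\}_\mu$ its dual family of coordinate functionals, $r_\mu:=(p^\mu\otimes\mathrm{id})\circ\ell:C\to P$, let $\{e_i\}_i$ be a basis of $V_\varphi$, and define $e_{ij}\in C$ by $\varphi(e_j)=\sum_{i=1}^{\dim V_\varphi}e_i\otimes e_{ij}$. Take any left $B$-linear map $\sigma_L:P\to B$ such that $\sigma_L(1)=1$, and set $$E_{(\mu,i)(\nu,j)}:=\sigma_L\bigl(r_\mu(e_{ij})\,p_\nu\bigr)\in B .$$ The set $M$ of indices $\mu$ such that $r_\mu(e_{ij})\neq 0$ for some $i,j$ is finite; let $E:=(E_{(\mu,i)(\nu,j)})$ with $\mu,\nu\in M$ and $i,j\in\{1,\dots,\dim V_\varphi\}$, a square matrix of finite size $N=|M|\cdot\dim V_\varphi$. Then $E^2=E$, and $B^NE\cong\mathrm{Hom}^C(V_\varphi,P)$ as left $B$-modules.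
   Context: Algebras are associative and unital, coalgebras coassociative and counital, all over a field $k$; $\otimes=\otimes_k$. $\Delta$ is the coproduct of $C$. $C$-extension: let $C$ be a coalgebra and let $P$ be an algebra that is also a right $C$-comodule via $\Delta_P:P\to P\otimes C$. Put $B=P^{co\,C}:=\{b\in P \mid \Delta_P(bp)=b\,\Delta_P(p)\ \text{for all } p\in P\}$. The inclusion $B\subseteq P$ is called a $C$-extension. A $C$-extension $B\subseteq P$ is principal if: (1) $can_R: P\otimes_B P\to P\otimes C$, $p\otimes_B p'\mapsto p\,\Delta_P(p')$, is bijective; (2) $\psi:C\otimes P\to P\otimes C$, $c\otimes p\mapsto can_R(can_R^{-1}(1\otimes c)\,p)$, is bijective; (3) there is a group-like element $e\in C$ such that $\Delta_P(p)=\psi(e\otimes p)$ for all $p\in P$; (4) $P$ is $C$-equivariantly projective as a left $B$-module: for all left $B$-modules $M',N'$ that are right $C$-comodules with $B$-linear coactions, every $B$-linear $C$-colinear epimorphism $\pi:M'\to N'$ split as a $C$-comodule map, and every $B$-linear $C$-colinear $f:P\to N'$, there is a $B$-linear $C$-colinear $g:P\to M'$ with $\pi\circ g=f$. Left coaction: ${}_P\Delta:P\to C\otimes P$, ${}_P\Delta(p)=\psi^{-1}(p\otimes e)$. Translation map: $\tau:C\to P\otimes_B P$, $\tau(c)=can_R^{-1}(1\otimes c)$. Let $\pi_B:P\otimes P\to P\otimes_B P$ be the canonical surjection. Strong connection (in the form used here): a linear map $\ell:C\to P\otimes P$ such that $\pi_B\circ\ell=\tau$, $(\mathrm{id}\otimes\Delta_P)\circ\ell=(\ell\otimes\mathrm{id})\circ\Delta$,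 $({}_P\Delta\otimes\mathrm{id})\circ\ell=(\mathrm{id}\otimes\ell)\circ\Delta$, and $\ell(e)=1\otimes 1$. $\mathrm{Hom}^C(V_\varphi,P)$ is the space of right $C$-colinear maps $V_\varphi\to P$, a left $B$-module via $(bf)(v)=b\,f(v)$. $B^NE$ is the left $B$-submodule of row vectors $\{xE\mid x\in B^N\}$ of $B^N$. *)

theory Defs
  imports "HOL-Algebra.Module" "HOL-Algebra.AbelCoset"
begin

section \<open>Linear algebra over a ring\<close>

text \<open>
  All structures are carrier based.  Modules and algebras are records of type
  \<^typ>\<open>('a, 'b) module\<close>; the \<open>mult\<close> and \<open>one\<close> fields are meaningful only for algebras
  and are otherwise left unspecified.  Maps are only ever considered on carriers.
  The library's \<^locale>\<open>module\<close> requires a commutative ring of scalars, hence the following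
  notion of a left module over an arbitrary unital ring.
\<close>

definition left_module :: "('r, 'x) ring_scheme \<Rightarrow> ('r, 'm) module \<Rightarrow> bool" where
  "left_module R M \<longleftrightarrow> ring R \<and> abelian_group M \<and>
     (\<forall>a\<in>carrier R. \<forall>x\<in>carrier M. a \<odot>\<^bsub>M\<^esub> x \<in> carrier M) \<and>
     (\<forall>a\<in>carrier R. \<forall>b\<in>carrier R. \<forall>x\<in>carrier M.
        (a \<oplus>\<^bsub>R\<^esub> b) \<odot>\<^bsub>M\<^esub> x = a \<odot>\<^bsub>M\<^esub> x \<oplus>\<^bsub>M\<^esub> b \<odot>\<^bsub>M\<^esub> x) \<and>
     (\<forall>a\<in>carrier R. \<forall>x\<in>carrier M. \<forall>y\<in>carrier M.
        a \<odot>\<^bsub>M\<^esub> (x \<oplus>\<^bsub>M\<^esub> y) = a \<odot>\<^bsub>M\<^esub> x \<oplus>\<^bsub>M\<^esub> a \<odot>\<^bsub>M\<^esub> y) \<and>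
     (\<forall>a\<in>carrier R. \<forall>b\<in>carrier R. \<forall>x\<in>carrier M.
        (a \<otimes>\<^bsub>R\<^esub> b) \<odot>\<^bsub>M\<^esub> x = a \<odot>\<^bsub>M\<^esub> (b \<odot>\<^bsub>M\<^esub> x)) \<and>
     (\<forall>x\<in>carrier M. \<one>\<^bsub>R\<^esub> \<odot>\<^bsub>M\<^esub> x = x)"

definition linear_maps ::
  "('r, 'x) ring_scheme \<Rightarrow> ('r, 'm) module \<Rightarrow> ('r, 'n) module \<Rightarrow> ('m \<Rightarrow> 'n) set" where
  "linear_maps R M N = {f \<in> carrier M \<rightarrow> carrier N.
     (\<forall>x\<in>carrier M. \<forall>y\<in>carrier M. f (x \<oplus>\<^bsub>M\<^esub> y) = f x \<oplus>\<^bsub>N\<^esub> f y) \<and>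
     (\<forall>a\<in>carrier R. \<forall>x\<in>carrier M. f (a \<odot>\<^bsub>M\<^esub> x) = a \<odot>\<^bsub>N\<^esub> f x)}"

definition left_module_isomorphic ::
  "('r, 'x) ring_scheme \<Rightarrow> ('r, 'm) module \<Rightarrow> ('r, 'n) module \<Rightarrow> bool" where
  "left_module_isomorphic R M N \<longleftrightarrow> left_module R M \<and> left_module R N \<and>
     (\<exists>f \<in> linear_maps R M N. bij_betw f (carrier M) (carrier N))"

text \<open>A left ideal, or more generally a subset \<open>X\<close> stable under left multiplication by the scalars
  in question, as a module under left multiplication.\<close>

definition regular_module :: "('r, 'x) ring_scheme \<Rightarrow> 'r set \<Rightarrow> ('r, 'r) module" where
  "regular_module R X = \<lparr>carrier = X, monoid.mult = mult R, one = one R,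
     zero = \<zero>\<^bsub>R\<^esub>, add = add R, smult = mult R\<rparr>"

definition module_span :: "('k, 'x) ring_scheme \<Rightarrow> ('k, 'm, 'y) module_scheme \<Rightarrow> 'm set \<Rightarrow> 'm set" where
  "module_span K M S = \<Inter>{H. submodule H K M \<and> S \<subseteq> H}"

definition quotient_module :: "('k, 'm, 'y) module_scheme \<Rightarrow> 'm set \<Rightarrow> ('k, 'm set) module" where
  "quotient_module M H = \<lparr>carrier = a_rcosets\<^bsub>M\<^esub> H, monoid.mult = undefined, one = undefined,
     zero = H, add = set_add M, smult = (\<lambda>a X. \<Union>x\<in>X. H +>\<^bsub>M\<^esub> (a \<odot>\<^bsub>M\<^esub> x))\<rparr>"

definition basis :: "('k, 'x) ring_scheme \<Rightarrow> ('k, 'm) module \<Rightarrow> 'i set \<Rightarrow> ('i \<Rightarrow> 'm) \<Rightarrow> bool" where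
  "basis K M I b \<longleftrightarrow> b \<in> I \<rightarrow> carrier M \<and>
     (\<forall>F a. finite F \<and> F \<subseteq> I \<and> a \<in> F \<rightarrow> carrier K \<and> (\<Oplus>\<^bsub>M\<^esub>i\<in>F. a i \<odot>\<^bsub>M\<^esub> b i) = \<zero>\<^bsub>M\<^esub> \<longrightarrow>
        (\<forall>i\<in>F. a i = \<zero>\<^bsub>K\<^esub>)) \<and>
     (\<forall>x\<in>carrier M. \<exists>F a. finite F \<and> F \<subseteq> I \<and> a \<in> F \<rightarrow> carrier K \<and>
        x = (\<Oplus>\<^bsub>M\<^esub>i\<in>F. a i \<odot>\<^bsub>M\<^esub> b i))"

definition dual_family ::
  "('k, 'x) ring_scheme \<Rightarrow> ('k, 'm) module \<Rightarrow> 'i set \<Rightarrow> ('i \<Rightarrow> 'm) \<Rightarrow> ('i \<Rightarrow> 'm \<Rightarrow> 'k) \<Rightarrow> bool" where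
  "dual_family K M I b d \<longleftrightarrow>
     (\<forall>i\<in>I. d i \<in> linear_maps K M (regular_module K (carrier K)) \<and>
        (\<forall>j\<in>I. d i (b j) = (if i = j then \<one>\<^bsub>K\<^esub> else \<zero>\<^bsub>K\<^esub>)))"

section \<open>Tensor products of vector spaces\<close>

definition free_module :: "('k, 'x) ring_scheme \<Rightarrow> 'z set \<Rightarrow> ('k, 'z \<Rightarrow> 'k) module" where
  "free_module K Z = \<lparr>carrier = {f. (\<forall>z\<in>Z. f z \<in> carrier K) \<and> (\<forall>z. z \<notin> Z \<longrightarrow> f z = \<zero>\<^bsub>K\<^esub>) \<and>
                                 finite {z. f z \<noteq> \<zero>\<^bsub>K\<^esub>}},
     monoid.mult = undefined, one = undefined,
     zero = (\<lambda>z. \<zero>\<^bsub>K\<^esub>), add = (\<lambda>f g z. f z \<oplus>\<^bsub>K\<^esub> g z), smult = (\<lambda>a f z. a \<otimes>\<^bsub>K\<^esub> f z)\<rparr>"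

definition free_gen :: "('k, 'x) ring_scheme \<Rightarrow> 'z \<Rightarrow> 'z \<Rightarrow> 'k" where
  "free_gen K z = (\<lambda>y. if y = z then \<one>\<^bsub>K\<^esub> else \<zero>\<^bsub>K\<^esub>)"

definition tensor_relators ::
  "('k, 'x) ring_scheme \<Rightarrow> ('k, 'm) module \<Rightarrow> ('k, 'n) module \<Rightarrow> ('m \<times> 'n \<Rightarrow> 'k) set" where
  "tensor_relators K M N = (let F = free_module K (carrier M \<times> carrier N); g = (\<lambda>m n. free_gen K (m, n)) in
     {g (m \<oplus>\<^bsub>M\<^esub> m') n \<ominus>\<^bsub>F\<^esub> (g m n \<oplus>\<^bsub>F\<^esub> g m' n) |m m' n.
        m \<in> carrier M \<and> m' \<in> carrier M \<and> n \<in> carrier N} \<union>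
     {g m (n \<oplus>\<^bsub>N\<^esub> n') \<ominus>\<^bsub>F\<^esub> (g m n \<oplus>\<^bsub>F\<^esub> g m n') |m n n'.
        m \<in> carrier M \<and> n \<in> carrier N \<and> n' \<in> carrier N} \<union>
     {g (a \<odot>\<^bsub>M\<^esub> m) n \<ominus>\<^bsub>F\<^esub> a \<odot>\<^bsub>F\<^esub> g m n |a m n.
        a \<in> carrier K \<and> m \<in> carrier M \<and> n \<in> carrier N} \<union>
     {g m (a \<odot>\<^bsub>N\<^esub> n) \<ominus>\<^bsub>F\<^esub> a \<odot>\<^bsub>F\<^esub> g m n |a m n.
        a \<in> carrier K \<and> m \<in> carrier M \<and> n \<in> carrier N})"

definition tensor_null ::
  "('k, 'x) ring_scheme \<Rightarrow> ('k, 'm) module \<Rightarrow> ('k, 'n) module \<Rightarrow> ('m \<times> 'n \<Rightarrow> 'k) set" where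
  "tensor_null K M N =
     module_span K (free_module K (carrier M \<times> carrier N)) (tensor_relators K M N)"

definition tensor ::
  "('k, 'x) ring_scheme \<Rightarrow> ('k, 'm) module \<Rightarrow> ('k, 'n) module \<Rightarrow> ('k, ('m \<times> 'n \<Rightarrow> 'k) set) module"
  (infixl \<open>\<boxtimes>\<index>\<close> 72) where
  "M \<boxtimes>\<^bsub>K\<^esub> N = quotient_module (free_module K (carrier M \<times> carrier N)) (tensor_null K M N)"

definition pure ::
  "('k, 'x) ring_scheme \<Rightarrow> ('k, 'm) module \<Rightarrow> ('k, 'n) module \<Rightarrow> 'm \<Rightarrow> 'n \<Rightarrow> ('m \<times> 'n \<Rightarrow> 'k) set" where
  "pure K M N m n =
     tensor_null K M N +>\<^bsub>free_module K (carrier M \<times> carrier N)\<^esub> free_gen K (m, n)"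

text \<open>The linear map \<open>M \<otimes> N \<rightarrow> W\<close> determined by a bilinear \<open>\<beta>\<close>, computed on some
  representative in the free module; for bilinear \<open>\<beta>\<close> the choice is irrelevant.\<close>

definition tensor_lift ::
  "('k, 'x) ring_scheme \<Rightarrow> ('k, 'w) module \<Rightarrow> ('m \<Rightarrow> 'n \<Rightarrow> 'w) \<Rightarrow> ('m \<times> 'n \<Rightarrow> 'k) set \<Rightarrow> 'w" where
  "tensor_lift K W \<beta> X = (let f = (SOME f. f \<in> X) in
     \<Oplus>\<^bsub>W\<^esub>z\<in>{z. f z \<noteq> \<zero>\<^bsub>K\<^esub>}. f z \<odot>\<^bsub>W\<^esub> \<beta> (fst z) (snd z))"

definition tensor_map ::
  "('k, 'x) ring_scheme \<Rightarrow> ('k, 'a) module \<Rightarrow> ('k, 'b) module \<Rightarrow> ('m \<Rightarrow> 'a) \<Rightarrow> ('n \<Rightarrow> 'b) \<Rightarrow>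
   ('m \<times> 'n \<Rightarrow> 'k) set \<Rightarrow> ('a \<times> 'b \<Rightarrow> 'k) set" where
  "tensor_map K A B f g = tensor_lift K (A \<boxtimes>\<^bsub>K\<^esub> B) (\<lambda>m n. pure K A B (f m) (g n))"

definition tensor_assoc ::
  "('k, 'x) ring_scheme \<Rightarrow> ('k, 'l) module \<Rightarrow> ('k, 'm) module \<Rightarrow> ('k, 'n) module \<Rightarrow>
   (('l \<times> 'm \<Rightarrow> 'k) set \<times> 'n \<Rightarrow> 'k) set \<Rightarrow> ('l \<times> ('m \<times> 'n \<Rightarrow> 'k) set \<Rightarrow> 'k) set" where
  "tensor_assoc K L M N =
     tensor_lift K (L \<boxtimes>\<^bsub>K\<^esub> (M \<boxtimes>\<^bsub>K\<^esub> N))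
       (\<lambda>t n. tensor_lift K (L \<boxtimes>\<^bsub>K\<^esub> (M \<boxtimes>\<^bsub>K\<^esub> N))
                (\<lambda>l m. pure K L (M \<boxtimes>\<^bsub>K\<^esub> N) l (pure K M N m n)) t)"

section \<open>Algebras, coalgebras and comodules\<close>

locale unital_algebra = P?: ring P + module K P for K (structure) and P (structure) +
  assumes smult_mult_left: "\<lbrakk>a \<in> carrier K; x \<in> carrier P; y \<in> carrier P\<rbrakk> \<Longrightarrow>
      (a \<odot>\<^bsub>P\<^esub> x) \<otimes>\<^bsub>P\<^esub> y = a \<odot>\<^bsub>P\<^esub> (x \<otimes>\<^bsub>P\<^esub> y)"
    and smult_mult_right: "\<lbrakk>a \<in> carrier K; x \<in> carrier P; y \<in> carrier P\<rbrakk> \<Longrightarrow>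
      x \<otimes>\<^bsub>P\<^esub> (a \<odot>\<^bsub>P\<^esub> y) = a \<odot>\<^bsub>P\<^esub> (x \<otimes>\<^bsub>P\<^esub> y)"

definition coalgebra ::
  "('k, 'x) ring_scheme \<Rightarrow> ('k, 'c) module \<Rightarrow> ('c \<Rightarrow> ('c \<times> 'c \<Rightarrow> 'k) set) \<Rightarrow> ('c \<Rightarrow> 'k) \<Rightarrow> bool" where
  "coalgebra K C \<Delta> \<epsilon> \<longleftrightarrow> module K C \<and>
     \<Delta> \<in> linear_maps K C (C \<boxtimes>\<^bsub>K\<^esub> C) \<and>
     \<epsilon> \<in> linear_maps K C (regular_module K (carrier K)) \<and>
     (\<forall>c\<in>carrier C.
        tensor_assoc K C C C (tensor_map K (C \<boxtimes>\<^bsub>K\<^esub> C) C \<Delta> id (\<Delta> c)) =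
          tensor_map K C (C \<boxtimes>\<^bsub>K\<^esub> C) id \<Delta> (\<Delta> c) \<and>
        tensor_lift K C (\<lambda>c d. \<epsilon> c \<odot>\<^bsub>C\<^esub> d) (\<Delta> c) = c \<and>
        tensor_lift K C (\<lambda>c d. \<epsilon> d \<odot>\<^bsub>C\<^esub> c) (\<Delta> c) = c)"

definition right_comodule ::
  "('k, 'x) ring_scheme \<Rightarrow> ('k, 'c) module \<Rightarrow> ('c \<Rightarrow> ('c \<times> 'c \<Rightarrow> 'k) set) \<Rightarrow> ('c \<Rightarrow> 'k) \<Rightarrow>
   ('k, 'm) module \<Rightarrow> ('m \<Rightarrow> ('m \<times> 'c \<Rightarrow> 'k) set) \<Rightarrow> bool" where
  "right_comodule K C \<Delta> \<epsilon> M \<rho> \<longleftrightarrow> module K M \<and>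
     \<rho> \<in> linear_maps K M (M \<boxtimes>\<^bsub>K\<^esub> C) \<and>
     (\<forall>m\<in>carrier M.
        tensor_assoc K M C C (tensor_map K (M \<boxtimes>\<^bsub>K\<^esub> C) C \<rho> id (\<rho> m)) =
          tensor_map K M (C \<boxtimes>\<^bsub>K\<^esub> C) id \<Delta> (\<rho> m) \<and>
        tensor_lift K M (\<lambda>m c. \<epsilon> c \<odot>\<^bsub>M\<^esub> m) (\<rho> m) = m)"

definition colinear_maps ::
  "('k, 'x) ring_scheme \<Rightarrow> ('k, 'c) module \<Rightarrow>
   ('k, 'm) module \<Rightarrow> ('m \<Rightarrow> ('m \<times> 'c \<Rightarrow> 'k) set) \<Rightarrow>
   ('k, 'n) module \<Rightarrow> ('n \<Rightarrow> ('n \<times> 'c \<Rightarrow> 'k) set) \<Rightarrow> ('m \<Rightarrow> 'n) set" where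
  "colinear_maps K C M \<rho> N \<rho>' = {f \<in> linear_maps K M N.
     \<forall>m\<in>carrier M. \<rho>' (f m) = tensor_map K N C f id (\<rho> m)}"

definition group_like ::
  "('k, 'x) ring_scheme \<Rightarrow> ('k, 'c) module \<Rightarrow> ('c \<Rightarrow> ('c \<times> 'c \<Rightarrow> 'k) set) \<Rightarrow> ('c \<Rightarrow> 'k) \<Rightarrow> 'c \<Rightarrow> bool" where
  "group_like K C \<Delta> \<epsilon> e \<longleftrightarrow> e \<in> carrier C \<and> \<Delta> e = pure K C C e e \<and> \<epsilon> e = \<one>\<^bsub>K\<^esub>"

section \<open>C-extensions\<close>

text \<open>The left action of \<open>P\<close> on \<open>P \<otimes> C\<close>.\<close>

definition left_act ::
  "('k, 'x) ring_scheme \<Rightarrow> ('k, 'p) module \<Rightarrow> ('k, 'c) module \<Rightarrow> 'p \<Rightarrow>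
   ('p \<times> 'c \<Rightarrow> 'k) set \<Rightarrow> ('p \<times> 'c \<Rightarrow> 'k) set" where
  "left_act K P C p = tensor_map K P C (\<lambda>x. p \<otimes>\<^bsub>P\<^esub> x) id"

definition coinvariants ::
  "('k, 'x) ring_scheme \<Rightarrow> ('k, 'c) module \<Rightarrow> ('k, 'p) module \<Rightarrow> ('p \<Rightarrow> ('p \<times> 'c \<Rightarrow> 'k) set) \<Rightarrow> 'p set" where
  "coinvariants K C P \<rho> =
     {b \<in> carrier P. \<forall>p\<in>carrier P. \<rho> (b \<otimes>\<^bsub>P\<^esub> p) = left_act K P C b (\<rho> p)}"

abbreviation coinvariant_ring ::
  "('k, 'x) ring_scheme \<Rightarrow> ('k, 'c) module \<Rightarrow> ('k, 'p) module \<Rightarrow> ('p \<Rightarrow> ('p \<times> 'c \<Rightarrow> 'k) set) \<Rightarrow>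
   ('k, 'p) module" where
  "coinvariant_ring K C P \<rho> \<equiv> P\<lparr>carrier := coinvariants K C P \<rho>\<rparr>"

definition c_extension ::
  "('k, 'x) ring_scheme \<Rightarrow> ('k, 'c) module \<Rightarrow> ('c \<Rightarrow> ('c \<times> 'c \<Rightarrow> 'k) set) \<Rightarrow> ('c \<Rightarrow> 'k) \<Rightarrow>
   ('k, 'p) module \<Rightarrow> ('p \<Rightarrow> ('p \<times> 'c \<Rightarrow> 'k) set) \<Rightarrow> bool" where
  "c_extension K C \<Delta> \<epsilon> P \<rho> \<longleftrightarrow>
     coalgebra K C \<Delta> \<epsilon> \<and> unital_algebra K P \<and> right_comodule K C \<Delta> \<epsilon> P \<rho>"

text \<open>For a subalgebra \<open>B\<close> of \<open>P\<close> (given by its carrier), \<open>P \<otimes>\<^sub>B P\<close> is the quotient of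
  \<open>P \<otimes> P\<close> by the span of the \<open>pb \<otimes> q - p \<otimes> bq\<close>.\<close>

definition balanced_null ::
  "('k, 'x) ring_scheme \<Rightarrow> ('k, 'p) module \<Rightarrow> 'p set \<Rightarrow> ('p \<times> 'p \<Rightarrow> 'k) set set" where
  "balanced_null K P B = module_span K (P \<boxtimes>\<^bsub>K\<^esub> P)
     {pure K P P (p \<otimes>\<^bsub>P\<^esub> b) q \<ominus>\<^bsub>P \<boxtimes>\<^bsub>K\<^esub> P\<^esub> pure K P P p (b \<otimes>\<^bsub>P\<^esub> q) |p b q.
        p \<in> carrier P \<and> b \<in> B \<and> q \<in> carrier P}"

definition balanced_tensor ::
  "('k, 'x) ring_scheme \<Rightarrow> ('k, 'p) module \<Rightarrow> 'p set \<Rightarrow> ('k, ('p \<times> 'p \<Rightarrow> 'k) set set) module" where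
  "balanced_tensor K P B = quotient_module (P \<boxtimes>\<^bsub>K\<^esub> P) (balanced_null K P B)"

definition balanced_proj ::
  "('k, 'x) ring_scheme \<Rightarrow> ('k, 'p) module \<Rightarrow> 'p set \<Rightarrow>
   ('p \<times> 'p \<Rightarrow> 'k) set \<Rightarrow> ('p \<times> 'p \<Rightarrow> 'k) set set" where
  "balanced_proj K P B t = balanced_null K P B +>\<^bsub>P \<boxtimes>\<^bsub>K\<^esub> P\<^esub> t"

definition can_R ::
  "('k, 'x) ring_scheme \<Rightarrow> ('k, 'c) module \<Rightarrow> ('k, 'p) module \<Rightarrow> ('p \<Rightarrow> ('p \<times> 'c \<Rightarrow> 'k) set) \<Rightarrow>
   ('p \<times> 'p \<Rightarrow> 'k) set set \<Rightarrow> ('p \<times> 'c \<Rightarrow> 'k) set" where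
  "can_R K C P \<rho> X =
     tensor_lift K (P \<boxtimes>\<^bsub>K\<^esub> C) (\<lambda>p q. left_act K P C p (\<rho> q)) (SOME t. t \<in> X)"

definition translation ::
  "('k, 'x) ring_scheme \<Rightarrow> ('k, 'c) module \<Rightarrow> ('k, 'p) module \<Rightarrow> ('p \<Rightarrow> ('p \<times> 'c \<Rightarrow> 'k) set) \<Rightarrow>
   'c \<Rightarrow> ('p \<times> 'p \<Rightarrow> 'k) set set" where
  "translation K C P \<rho> c =
     inv_into (carrier (balanced_tensor K P (coinvariants K C P \<rho>))) (can_R K C P \<rho>)
       (pure K P C \<one>\<^bsub>P\<^esub> c)"

text \<open>The right action of \<open>P\<close> on \<open>P \<otimes>\<^sub>B P\<close>, through the second factor.\<close>

definition right_act ::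
  "('k, 'x) ring_scheme \<Rightarrow> ('k, 'p) module \<Rightarrow> 'p set \<Rightarrow>
   ('p \<times> 'p \<Rightarrow> 'k) set set \<Rightarrow> 'p \<Rightarrow> ('p \<times> 'p \<Rightarrow> 'k) set set" where
  "right_act K P B X p =
     balanced_proj K P B (tensor_map K P P id (\<lambda>x. x \<otimes>\<^bsub>P\<^esub> p) (SOME t. t \<in> X))"

definition entwining ::
  "('k, 'x) ring_scheme \<Rightarrow> ('k, 'c) module \<Rightarrow> ('k, 'p) module \<Rightarrow> ('p \<Rightarrow> ('p \<times> 'c \<Rightarrow> 'k) set) \<Rightarrow>
   ('c \<times> 'p \<Rightarrow> 'k) set \<Rightarrow> ('p \<times> 'c \<Rightarrow> 'k) set" where
  "entwining K C P \<rho> = tensor_lift K (P \<boxtimes>\<^bsub>K\<^esub> C)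
     (\<lambda>c p. can_R K C P \<rho> (right_act K P (coinvariants K C P \<rho>) (translation K C P \<rho> c) p))"

section \<open>Principal extensions and strong connections\<close>

text \<open>The vector space underlying a module over a subring of the \<open>K\<close>-algebra \<open>P\<close> containing
  \<open>K \<cdot> 1\<close>.\<close>

definition restrict_scalars ::
  "('k, 'p) module \<Rightarrow> ('p, 'm) module \<Rightarrow> ('k, 'm) module" where
  "restrict_scalars P M = \<lparr>carrier = carrier M, monoid.mult = mult M, one = one M, zero = \<zero>\<^bsub>M\<^esub>,
     add = add M, smult = (\<lambda>a x. (a \<odot>\<^bsub>P\<^esub> \<one>\<^bsub>P\<^esub>) \<odot>\<^bsub>M\<^esub> x)\<rparr>"

text \<open>A left module over \<open>B = P\<^sup>c\<^sup>o\<^sup>C\<close> with a \<open>B\<close>-linear right \<open>C\<close>-coaction, where \<open>B\<close> acts on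
  \<open>M \<otimes> C\<close> through the first factor.\<close>

definition equivariant_module ::
  "('k, 'x) ring_scheme \<Rightarrow> ('k, 'c) module \<Rightarrow> ('c \<Rightarrow> ('c \<times> 'c \<Rightarrow> 'k) set) \<Rightarrow> ('c \<Rightarrow> 'k) \<Rightarrow>
   ('k, 'p) module \<Rightarrow> ('p \<Rightarrow> ('p \<times> 'c \<Rightarrow> 'k) set) \<Rightarrow>
   ('p, 'm) module \<Rightarrow> ('m \<Rightarrow> ('m \<times> 'c \<Rightarrow> 'k) set) \<Rightarrow> bool" where
  "equivariant_module K C \<Delta> \<epsilon> P \<rho> M \<rho>M \<longleftrightarrow>
     left_module (coinvariant_ring K C P \<rho>) M \<and>
     right_comodule K C \<Delta> \<epsilon> (restrict_scalars P M) \<rho>M \<and>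
     (\<forall>b\<in>coinvariants K C P \<rho>. \<forall>m\<in>carrier M.
        \<rho>M (b \<odot>\<^bsub>M\<^esub> m) = tensor_map K (restrict_scalars P M) C (\<lambda>x. b \<odot>\<^bsub>M\<^esub> x) id (\<rho>M m))"

text \<open>
  The quantification over all test modules \<open>M\<close>, \<open>N\<close> is rendered by quantification over all those
  whose carrier lies in \<^typ>\<open>'p list\<close>, a type of cardinality at least \<open>max |P| \<aleph>\<^sub>0\<close>.
  This loses nothing: for a lifting problem \<open>\<pi> : M \<rightarrow> N\<close>, \<open>f : P \<rightarrow> N\<close> with arbitrary \<open>M\<close>, \<open>N\<close> and a
  colinear splitting \<open>s\<close>, replace \<open>N\<close> by \<open>f(P)\<close> and \<open>M\<close> by \<open>B \<cdot> s(f(P))\<close>.  These are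
  \<open>B\<close>-submodules and subcomodules of cardinality at most \<open>max |P| \<aleph>\<^sub>0\<close>, so they have isomorphic
  copies in \<^typ>\<open>'p list\<close>; \<open>\<pi>\<close> and \<open>s\<close> restrict to them, and a solution of the restricted problem
  solves the original one.
\<close>

definition equivariantly_projective ::
  "('k, 'x) ring_scheme \<Rightarrow> ('k, 'c) module \<Rightarrow> ('c \<Rightarrow> ('c \<times> 'c \<Rightarrow> 'k) set) \<Rightarrow> ('c \<Rightarrow> 'k) \<Rightarrow>
   ('k, 'p) module \<Rightarrow> ('p \<Rightarrow> ('p \<times> 'c \<Rightarrow> 'k) set) \<Rightarrow> bool" where
  "equivariantly_projective K C \<Delta> \<epsilon> P \<rho> \<longleftrightarrow>
     (let B = coinvariant_ring K C P \<rho>; PB = regular_module P (carrier P) in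
      \<forall>(M :: ('p, 'p list) module) \<rho>M (N :: ('p, 'p list) module) \<rho>N \<pi> f.
        equivariant_module K C \<Delta> \<epsilon> P \<rho> M \<rho>M \<and>
        equivariant_module K C \<Delta> \<epsilon> P \<rho> N \<rho>N \<and>
        \<pi> \<in> linear_maps B M N \<and>
        \<pi> \<in> colinear_maps K C (restrict_scalars P M) \<rho>M (restrict_scalars P N) \<rho>N \<and>
        \<pi> ` carrier M = carrier N \<and>
        (\<exists>s \<in> colinear_maps K C (restrict_scalars P N) \<rho>N (restrict_scalars P M) \<rho>M.
           \<forall>n\<in>carrier N. \<pi> (s n) = n) \<and>
        f \<in> linear_maps B PB N \<and>
        f \<in> colinear_maps K C P \<rho> (restrict_scalars P N) \<rho>N \<longrightarrow>
        (\<exists>g. g \<in> linear_maps B PB M \<and>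
           g \<in> colinear_maps K C P \<rho> (restrict_scalars P M) \<rho>M \<and>
           (\<forall>p\<in>carrier P. \<pi> (g p) = f p)))"

text \<open>The group-like element \<open>e\<close> is part of the data, since the left coaction and the
  normalisation of strong connections refer to it.\<close>

definition principal_extension ::
  "('k, 'x) ring_scheme \<Rightarrow> ('k, 'c) module \<Rightarrow> ('c \<Rightarrow> ('c \<times> 'c \<Rightarrow> 'k) set) \<Rightarrow> ('c \<Rightarrow> 'k) \<Rightarrow>
   ('k, 'p) module \<Rightarrow> ('p \<Rightarrow> ('p \<times> 'c \<Rightarrow> 'k) set) \<Rightarrow> 'c \<Rightarrow> bool" where
  "principal_extension K C \<Delta> \<epsilon> P \<rho> e \<longleftrightarrow>
     c_extension K C \<Delta> \<epsilon> P \<rho> \<and>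
     bij_betw (can_R K C P \<rho>)
       (carrier (balanced_tensor K P (coinvariants K C P \<rho>))) (carrier (P \<boxtimes>\<^bsub>K\<^esub> C)) \<and>
     bij_betw (entwining K C P \<rho>) (carrier (C \<boxtimes>\<^bsub>K\<^esub> P)) (carrier (P \<boxtimes>\<^bsub>K\<^esub> C)) \<and>
     group_like K C \<Delta> \<epsilon> e \<and>
     (\<forall>p\<in>carrier P. \<rho> p = entwining K C P \<rho> (pure K C P e p)) \<and>
     equivariantly_projective K C \<Delta> \<epsilon> P \<rho>"

definition left_coaction ::
  "('k, 'x) ring_scheme \<Rightarrow> ('k, 'c) module \<Rightarrow> ('k, 'p) module \<Rightarrow> ('p \<Rightarrow> ('p \<times> 'c \<Rightarrow> 'k) set) \<Rightarrow> 'c \<Rightarrow>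
   'p \<Rightarrow> ('c \<times> 'p \<Rightarrow> 'k) set" where
  "left_coaction K C P \<rho> e p =
     inv_into (carrier (C \<boxtimes>\<^bsub>K\<^esub> P)) (entwining K C P \<rho>) (pure K P C p e)"

definition strong_connection ::
  "('k, 'x) ring_scheme \<Rightarrow> ('k, 'c) module \<Rightarrow> ('c \<Rightarrow> ('c \<times> 'c \<Rightarrow> 'k) set) \<Rightarrow>
   ('k, 'p) module \<Rightarrow> ('p \<Rightarrow> ('p \<times> 'c \<Rightarrow> 'k) set) \<Rightarrow> 'c \<Rightarrow> ('c \<Rightarrow> ('p \<times> 'p \<Rightarrow> 'k) set) \<Rightarrow> bool" where
  "strong_connection K C \<Delta> P \<rho> e l \<longleftrightarrow>
     l \<in> linear_maps K C (P \<boxtimes>\<^bsub>K\<^esub> P) \<and>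
     (\<forall>c\<in>carrier C.
        balanced_proj K P (coinvariants K C P \<rho>) (l c) = translation K C P \<rho> c \<and>
        tensor_map K P (P \<boxtimes>\<^bsub>K\<^esub> C) id \<rho> (l c) =
          tensor_assoc K P P C (tensor_map K (P \<boxtimes>\<^bsub>K\<^esub> P) C l id (\<Delta> c)) \<and>
        tensor_assoc K C P P (tensor_map K (C \<boxtimes>\<^bsub>K\<^esub> P) P (left_coaction K C P \<rho> e) id (l c)) =
          tensor_map K C (P \<boxtimes>\<^bsub>K\<^esub> P) id l (\<Delta> c)) \<and>
     l e = pure K P P \<one>\<^bsub>P\<^esub> \<one>\<^bsub>P\<^esub>"

section \<open>Row vectors and spaces of colinear maps\<close>

definition row_module :: "('r, 'x) ring_scheme \<Rightarrow> 'j set \<Rightarrow> ('r, 'j \<Rightarrow> 'r) module" where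
  "row_module R J = \<lparr>carrier = J \<rightarrow>\<^sub>E carrier R, monoid.mult = undefined, one = undefined,
     zero = (\<lambda>j\<in>J. \<zero>\<^bsub>R\<^esub>), add = (\<lambda>x y. \<lambda>j\<in>J. x j \<oplus>\<^bsub>R\<^esub> y j), smult = (\<lambda>b x. \<lambda>j\<in>J. b \<otimes>\<^bsub>R\<^esub> x j)\<rparr>"

definition row_times :: "('r, 'x) ring_scheme \<Rightarrow> 'j set \<Rightarrow> ('j \<Rightarrow> 'r) \<Rightarrow> ('j \<Rightarrow> 'j \<Rightarrow> 'r) \<Rightarrow> 'j \<Rightarrow> 'r" where
  "row_times R J x E = (\<lambda>j\<in>J. \<Oplus>\<^bsub>R\<^esub>i\<in>J. x i \<otimes>\<^bsub>R\<^esub> E i j)"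

definition row_image :: "('r, 'x) ring_scheme \<Rightarrow> 'j set \<Rightarrow> ('j \<Rightarrow> 'j \<Rightarrow> 'r) \<Rightarrow> ('r, 'j \<Rightarrow> 'r) module" where
  "row_image R J E =
     (row_module R J)\<lparr>carrier := {row_times R J x E |x. x \<in> carrier (row_module R J)}\<rparr>"

definition colinear_module ::
  "('k, 'x) ring_scheme \<Rightarrow> ('k, 'c) module \<Rightarrow> ('k, 'v) module \<Rightarrow> ('v \<Rightarrow> ('v \<times> 'c \<Rightarrow> 'k) set) \<Rightarrow>
   ('k, 'p) module \<Rightarrow> ('p \<Rightarrow> ('p \<times> 'c \<Rightarrow> 'k) set) \<Rightarrow> ('p, 'v \<Rightarrow> 'p) module" where
  "colinear_module K C V \<phi> P \<rho> =
     \<lparr>carrier = colinear_maps K C V \<phi> P \<rho> \<inter> extensional (carrier V),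
      monoid.mult = undefined, one = undefined,
      zero = (\<lambda>v\<in>carrier V. \<zero>\<^bsub>P\<^esub>), add = (\<lambda>f g. \<lambda>v\<in>carrier V. f v \<oplus>\<^bsub>P\<^esub> g v),
      smult = (\<lambda>b f. \<lambda>v\<in>carrier V. b \<otimes>\<^bsub>P\<^esub> f v)\<rparr>"

end

theory Submission
  imports "HOL-Algebra.Subrings" Defs
begin

text \<open>
  Write \<open>\<Delta>\<^sub>P(q) = q\<^sub>0 \<otimes> q\<^sub>1\<close>.  The point of a strong connection is that \<open>s(q) = q\<^sub>0 l(q\<^sub>1)\<close> is a section
  of the multiplication \<open>B \<otimes> P \<rightarrow> P\<close>.  That its product is \<open>q\<close> follows by applying \<open>id \<otimes> \<epsilon>\<close> to the
  canonical map (\<open>mult_split\<close>).  That it lies in \<open>B \<otimes> P\<close> is the heart of the matter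
  (\<open>right_slice_split_coinvariant\<close>).  It uses the product formula \<open>\<Delta>\<^sub>P(q x) = q\<^sub>0 \<psi>(q\<^sub>1 \<otimes> x)\<close>
  (\<open>coaction_mult\<close>), which holds because the canonical map is injective.  Left colinearity of \<open>l\<close> reads
  \<open>\<psi>(c\<^sub>1 \<otimes> l(c\<^sub>2)\<^sup>1) \<otimes> l(c\<^sub>2)\<^sup>2 = l(c)\<^sup>1 \<otimes> e \<otimes> l(c)\<^sup>2\<close> after an application of \<open>\<psi>\<close>, where
  \<open>l(c) = l(c)\<^sup>1 \<otimes> l(c)\<^sup>2\<close>.  Hence the first factors \<open>b\<close> of \<open>s(q)\<close> satisfy \<open>\<Delta>\<^sub>P(b) = b \<otimes> e\<close>, and
  such \<open>b\<close> are coinvariant since \<open>\<Delta>\<^sub>P(x) = \<psi>(e \<otimes> x)\<close>.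

  A left \<open>B\<close>-linear \<open>\<sigma>\<close> with \<open>\<sigma>(1) = 1\<close> fixes \<open>B\<close>, so multiplying out \<open>(\<sigma> \<otimes> id)(s(q))\<close> gives \<open>q\<close> as
  well.  For a colinear map \<open>f : V \<rightarrow> P\<close> and \<open>q = f(w)\<close> this becomes the reproducing formula
  \<open>f(w) = \<Sum> \<sigma>(f(v\<^sub>i) p\<^sub>\<mu>) r\<^sub>\<mu>(\<chi>\<^sub>i(w))\<close> (\<open>colinear_reproducing\<close>), where \<open>\<chi>\<^sub>i(v\<^sub>j) = e\<^sub>i\<^sub>j\<close>.  The functions
  \<open>w \<mapsto> r\<^sub>\<mu>(\<chi>\<^sub>i(w))\<close> are themselves colinear, by right colinearity of \<open>l\<close>.

  So \<open>combine\<close>, which maps a row \<open>x\<close> over \<open>B\<close> to \<open>w \<mapsto> \<Sum> x\<^sub>\<mu>\<^sub>i r\<^sub>\<mu>(\<chi>\<^sub>i(w))\<close>, and \<open>coeff\<close>, which maps \<open>f\<close>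
  to the row of the \<open>\<sigma>(f(v\<^sub>j) p\<^sub>\<nu>)\<close>, are \<open>B\<close>-linear maps between \<open>B\<^sup>N\<close> and the space of colinear maps with
  \<open>combine \<circ> coeff = id\<close>.  The other composite is \<open>x \<mapsto> x E\<close> (\<open>coeff_combine\<close>).  Therefore \<open>E\<close> is
  idempotent, and \<open>combine\<close> restricts to an isomorphism from \<open>B\<^sup>N E\<close>, the image of \<open>coeff\<close>, onto the
  space of colinear maps.

  Tensors are handled throughout through the universal property.  Instead of sums of pure tensors, the
  arguments apply functionals to one tensor factor (\<open>left_slice\<close>, \<open>right_slice\<close>), and they pass to
  coordinates only to see that a tensor is determined by its slices along a basis.
\<close>

section \<open>Linear maps\<close>

lemma linear_mapsI:
  assumes "\<And>x. x \<in> carrier M \<Longrightarrow> f x \<in> carrier N"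
    and "\<And>x y. \<lbrakk>x \<in> carrier M; y \<in> carrier M\<rbrakk> \<Longrightarrow> f (x \<oplus>\<^bsub>M\<^esub> y) = f x \<oplus>\<^bsub>N\<^esub> f y"
    and "\<And>a x. \<lbrakk>a \<in> carrier K; x \<in> carrier M\<rbrakk> \<Longrightarrow> f (a \<odot>\<^bsub>M\<^esub> x) = a \<odot>\<^bsub>N\<^esub> f x"
  shows "f \<in> linear_maps K M N"
  using assms by (auto simp: linear_maps_def)

lemma linear_closed: "\<lbrakk>f \<in> linear_maps K M N; x \<in> carrier M\<rbrakk> \<Longrightarrow> f x \<in> carrier N"
  by (auto simp: linear_maps_def)

lemma linear_add:
  "\<lbrakk>f \<in> linear_maps K M N; x \<in> carrier M; y \<in> carrier M\<rbrakk> \<Longrightarrow> f (x \<oplus>\<^bsub>M\<^esub> y) = f x \<oplus>\<^bsub>N\<^esub> f y"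
  by (auto simp: linear_maps_def)

lemma linear_smult:
  "\<lbrakk>f \<in> linear_maps K M N; a \<in> carrier K; x \<in> carrier M\<rbrakk> \<Longrightarrow> f (a \<odot>\<^bsub>M\<^esub> x) = a \<odot>\<^bsub>N\<^esub> f x"
  by (auto simp: linear_maps_def)

lemma linear_comp:
  "\<lbrakk>f \<in> linear_maps K L M; g \<in> linear_maps K M N\<rbrakk> \<Longrightarrow> (\<lambda>x. g (f x)) \<in> linear_maps K L N"
  by (intro linear_mapsI) (simp_all add: linear_closed linear_add[of f] linear_add[of g] linear_smult[of f] linear_smult[of g])

lemma linear_ident: "(\<lambda>x. x) \<in> linear_maps K M M"
  by (auto simp: linear_maps_def)

lemma linear_id: "id \<in> linear_maps K M M"
  by (auto simp: linear_maps_def)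

lemma
  assumes "f \<in> linear_maps K M N" "abelian_group M" "abelian_group N"
  shows linear_zero: "f \<zero>\<^bsub>M\<^esub> = \<zero>\<^bsub>N\<^esub>"
    and linear_minus: "x \<in> carrier M \<Longrightarrow> f (\<ominus>\<^bsub>M\<^esub> x) = \<ominus>\<^bsub>N\<^esub> f x"
    and linear_diff: "\<lbrakk>x \<in> carrier M; y \<in> carrier M\<rbrakk> \<Longrightarrow> f (x \<ominus>\<^bsub>M\<^esub> y) = f x \<ominus>\<^bsub>N\<^esub> f y"
proof -
  interpret M: abelian_group M by fact
  interpret N: abelian_group N by fact
  interpret h: abelian_group_hom M N f
    by (rule abelian_group_homI)
      (use assms in \<open>auto simp: linear_maps_def group_hom_def group_hom_axioms_def hom_def
        M.a_group N.a_group M.abelian_group_axioms N.abelian_group_axioms\<close>)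
  show "f \<zero>\<^bsub>M\<^esub> = \<zero>\<^bsub>N\<^esub>" "x \<in> carrier M \<Longrightarrow> f (\<ominus>\<^bsub>M\<^esub> x) = \<ominus>\<^bsub>N\<^esub> f x" for x
    by simp_all
  then show "f (x \<ominus>\<^bsub>M\<^esub> y) = f x \<ominus>\<^bsub>N\<^esub> f y" if "x \<in> carrier M" "y \<in> carrier M" for x y
    using that by (simp add: a_minus_def linear_add[OF assms(1)])
qed

lemma linear_finsum:
  assumes f: "f \<in> linear_maps K M N" and M: "abelian_group M" and N: "abelian_group N"
    and "finite A" "g \<in> A \<rightarrow> carrier M"
  shows "f (\<Oplus>\<^bsub>M\<^esub>i\<in>A. g i) = (\<Oplus>\<^bsub>N\<^esub>i\<in>A. f (g i))"
proof -
  interpret M: abelian_group M by fact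
  interpret N: abelian_group N by fact
  show ?thesis using assms(4,5)
  proof (induction A rule: finite_induct)
    case empty
    then show ?case by (simp add: linear_zero[OF f M N])
  next
    case (insert x F)
    then have "g x \<in> carrier M" "g \<in> F \<rightarrow> carrier M" by auto
    moreover from this have "(\<lambda>i. f (g i)) \<in> F \<rightarrow> carrier N"
      by (auto intro: linear_closed[OF f])
    ultimately show ?case
      using insert by (simp add: linear_add[OF f] linear_closed[OF f])
  qed
qed

lemma module_abelian: "module K M \<Longrightarrow> abelian_group M"
  by (simp add: module_def)

lemma module_cring: "module K M \<Longrightarrow> cring K"
  by (simp add: module_def)

lemma linear_plus:
  assumes "module K N" "f \<in> linear_maps K M N" "g \<in> linear_maps K M N"
  shows "(\<lambda>x. f x \<oplus>\<^bsub>N\<^esub> g x) \<in> linear_maps K M N"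
proof -
  interpret N: module K N by fact
  show ?thesis
    by (rule linear_mapsI)
      (simp_all add: linear_closed[OF assms(2)] linear_closed[OF assms(3)] linear_add[OF assms(2)]
        linear_add[OF assms(3)] linear_smult[OF assms(2)] linear_smult[OF assms(3)] N.smult_r_distr N.M.a_ac)
qed

lemma linear_scale:
  assumes "module K N" "f \<in> linear_maps K M N" "a \<in> carrier K"
  shows "(\<lambda>x. a \<odot>\<^bsub>N\<^esub> f x) \<in> linear_maps K M N"
proof -
  interpret N: module K N by fact
  show ?thesis
    by (rule linear_mapsI)
      (simp_all add: assms(3) linear_closed[OF assms(2)] linear_add[OF assms(2)] linear_smult[OF assms(2)]
        N.smult_r_distr N.R.m_comm flip: N.smult_assoc1)
qed

lemma linear_sum:
  assumes N: "module K N" and M: "module K M" and "finite A" "\<And>i. i \<in> A \<Longrightarrow> f i \<in> linear_maps K M N"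
  shows "(\<lambda>x. \<Oplus>\<^bsub>N\<^esub>i\<in>A. f i x) \<in> linear_maps K M N"
proof -
  interpret N: module K N by fact
  interpret M: module K M by fact
  have cl: "(\<lambda>i. f i x) \<in> A \<rightarrow> carrier N" if "x \<in> carrier M" for x
    using assms(4) that by (auto intro: linear_closed)
  show ?thesis
  proof (rule linear_mapsI)
    fix x y assume xy: "x \<in> carrier M" "y \<in> carrier M"
    have "(\<Oplus>\<^bsub>N\<^esub>i\<in>A. f i (x \<oplus>\<^bsub>M\<^esub> y)) = (\<Oplus>\<^bsub>N\<^esub>i\<in>A. f i x \<oplus>\<^bsub>N\<^esub> f i y)"
      using cl[OF xy(1)] cl[OF xy(2)] xy by (intro N.finsum_cong') (auto simp: linear_add[OF assms(4)])
    then show "(\<Oplus>\<^bsub>N\<^esub>i\<in>A. f i (x \<oplus>\<^bsub>M\<^esub> y)) = (\<Oplus>\<^bsub>N\<^esub>i\<in>A. f i x) \<oplus>\<^bsub>N\<^esub> (\<Oplus>\<^bsub>N\<^esub>i\<in>A. f i y)"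
      using N.finsum_addf[OF cl[OF xy(1)] cl[OF xy(2)]] by simp
  next
    fix a x assume ax: "a \<in> carrier K" "x \<in> carrier M"
    have "(\<Oplus>\<^bsub>N\<^esub>i\<in>A. f i (a \<odot>\<^bsub>M\<^esub> x)) = (\<Oplus>\<^bsub>N\<^esub>i\<in>A. a \<odot>\<^bsub>N\<^esub> f i x)"
      using cl[OF ax(2)] ax by (intro N.finsum_cong') (auto simp: linear_smult[OF assms(4)])
    then show "(\<Oplus>\<^bsub>N\<^esub>i\<in>A. f i (a \<odot>\<^bsub>M\<^esub> x)) = a \<odot>\<^bsub>N\<^esub> (\<Oplus>\<^bsub>N\<^esub>i\<in>A. f i x)"
      using N.finsum_smult_ldistr[OF assms(3) ax(1) cl[OF ax(2)]] by simp
  qed (auto intro!: N.finsum_closed cl)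
qed

lemma linear_cong:
  assumes "module K M" "f \<in> linear_maps K M N" "\<And>x. x \<in> carrier M \<Longrightarrow> f' x = f x"
  shows "f' \<in> linear_maps K M N"
proof -
  interpret M: module K M by fact
  show ?thesis
    by (rule linear_mapsI) (simp_all add: assms(3) linear_closed[OF assms(2)] linear_add[OF assms(2)] linear_smult[OF assms(2)])
qed

section \<open>Spans and quotients\<close>

text \<open>The kernel of \<open>f\<close> is one of the submodules whose intersection is the span.\<close>

lemma linear_span_zero:
  assumes M: "module K M" and W: "module K W" and f: "f \<in> linear_maps K M W"
    and S: "S \<subseteq> carrier M" "\<And>s. s \<in> S \<Longrightarrow> f s = \<zero>\<^bsub>W\<^esub>"
    and x: "x \<in> module_span K M S"
  shows "f x = \<zero>\<^bsub>W\<^esub>"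
proof -
  interpret M: module K M by fact
  interpret W: module K W by fact
  note ab = module_abelian[OF M] module_abelian[OF W]
  have "submodule {y \<in> carrier M. f y = \<zero>\<^bsub>W\<^esub>} K M"
    by (rule M.submoduleI)
      (auto simp: linear_add[OF f] linear_smult[OF f] linear_minus[OF f ab] linear_zero[OF f ab])
  with x S show ?thesis
    by (auto simp: module_span_def)
qed

lemma module_span_submodule:
  assumes M: "module K M" and S: "S \<subseteq> carrier M"
  shows "submodule (module_span K M S) K M"
proof -
  interpret M: module K M by fact
  have c: "submodule (carrier M) K M" by (rule M.carrier_is_submodule)
  note E = M.submoduleE
  have z: "\<zero>\<^bsub>M\<^esub> \<in> H" if "submodule H K M" for H
    using subgroup.one_closed[OF submodule.axioms(1)[OF that]] by simp
  show ?thesis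
    unfolding module_span_def
    by (rule M.submoduleI) (use c S z E(3,4,5) in auto)
qed

lemma module_span_base: "S \<subseteq> module_span K M S"
  by (auto simp: module_span_def)

lemma submodule_abelian_subgroup:
  assumes "module K M" "submodule H K M" shows "abelian_subgroup H M"
proof -
  interpret M: module K M by fact
  show ?thesis
    by (rule abelian_subgroupI3)
      (auto intro!: additive_subgroup.intro submodule.axioms(1)[OF assms(2)] M.abelian_group_axioms)
qed

lemma coset_rep_cases:
  assumes M: "module K M" and H: "submodule H K M" and m: "m \<in> carrier M"
    and t: "t \<in> H +>\<^bsub>M\<^esub> m"
  obtains h where "h \<in> H" "h \<in> carrier M" "t = h \<oplus>\<^bsub>M\<^esub> m"
  using t module.submoduleE(1)[OF M H] by (auto simp: a_r_coset_def')

lemma coset_self: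
  assumes M: "module K M" and H: "submodule H K M" and m: "m \<in> carrier M"
  shows "m \<in> H +>\<^bsub>M\<^esub> m"
  by (rule abelian_subgroup.a_rcos_self[OF submodule_abelian_subgroup[OF M H] m])

lemma linear_coset_const:
  assumes M: "module K M" and W: "module K W" and H: "submodule H K M"
    and f: "f \<in> linear_maps K M W" and fH: "\<And>h. h \<in> H \<Longrightarrow> f h = \<zero>\<^bsub>W\<^esub>"
    and m: "m \<in> carrier M" and t: "t \<in> H +>\<^bsub>M\<^esub> m"
  shows "f t = f m"
proof -
  interpret W: module K W by fact
  obtain h where "h \<in> H" "h \<in> carrier M" "t = h \<oplus>\<^bsub>M\<^esub> m"
    using coset_rep_cases[OF M H m t] .
  then show ?thesis
    using m by (simp add: linear_add[OF f] fH linear_closed[OF f])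
qed

text \<open>Maps on quotients and on tensor products are evaluated on a chosen representative of a coset; the
  choice is immaterial for a linear map that vanishes on the submodule.\<close>

lemma linear_coset_some:
  assumes M: "module K M" and W: "module K W" and H: "submodule H K M"
    and f: "f \<in> linear_maps K M W" and fH: "\<And>h. h \<in> H \<Longrightarrow> f h = \<zero>\<^bsub>W\<^esub>"
    and m: "m \<in> carrier M"
  shows "f (SOME t. t \<in> H +>\<^bsub>M\<^esub> m) = f m"
  using linear_coset_const[OF M W H f fH m] someI[of "\<lambda>t. t \<in> H +>\<^bsub>M\<^esub> m", OF coset_self[OF M H m]]
  by blast

lemma
  assumes M: "module K M" and H: "submodule H K M"
  shows quotient_module_module: "module K (quotient_module M H)"
    and quotient_proj_linear: "(\<lambda>m. H +>\<^bsub>M\<^esub> m) \<in> linear_maps K M (quotient_module M H)"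
proof -
  interpret M: module K M by fact
  interpret H: abelian_subgroup H M by (rule submodule_abelian_subgroup[OF M H])
  let ?Q = "quotient_module M H"
  let ?q = "\<lambda>m. H +>\<^bsub>M\<^esub> m"
  have car: "carrier ?Q = a_rcosets\<^bsub>M\<^esub> H" by (simp add: quotient_module_def)
  have carE: "\<exists>m\<in>carrier M. X = ?q m" if "X \<in> carrier ?Q" for X
    using that by (auto simp: car A_RCOSETS_def')
  have carI: "?q m \<in> carrier ?Q" if "m \<in> carrier M" for m
    using that by (auto simp: car A_RCOSETS_def')
  have add: "?q x \<oplus>\<^bsub>?Q\<^esub> ?q y = ?q (x \<oplus>\<^bsub>M\<^esub> y)" if "x \<in> carrier M" "y \<in> carrier M" for x y
    using H.a_rcos_sum[OF that] by (simp add: quotient_module_def)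
  have smult: "a \<odot>\<^bsub>?Q\<^esub> ?q x = ?q (a \<odot>\<^bsub>M\<^esub> x)" if "a \<in> carrier K" "x \<in> carrier M" for a x
  proof -
    have "?q (a \<odot>\<^bsub>M\<^esub> t) = ?q (a \<odot>\<^bsub>M\<^esub> x)" if t: "t \<in> ?q x" for t
    proof -
      obtain h where h: "h \<in> H" "h \<in> carrier M" "t = h \<oplus>\<^bsub>M\<^esub> x"
        using coset_rep_cases[OF M H \<open>x \<in> carrier M\<close> t] .
      have "a \<odot>\<^bsub>M\<^esub> h \<in> H"
        using h(1) \<open>a \<in> carrier K\<close> M.submoduleE(4)[OF H] by blast
      then have "a \<odot>\<^bsub>M\<^esub> t \<in> ?q (a \<odot>\<^bsub>M\<^esub> x)"
        using h \<open>a \<in> carrier K\<close> \<open>x \<in> carrier M\<close>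
        by (auto simp: a_r_coset_def' M.smult_r_distr)
      then show ?thesis
        using H.a_repr_independence' \<open>a \<in> carrier K\<close> \<open>x \<in> carrier M\<close> by auto
    qed
    moreover have "?q x \<noteq> {}" using coset_self[OF M H \<open>x \<in> carrier M\<close>] by auto
    ultimately show ?thesis
      by (auto simp: quotient_module_def)
  qed
  have zero: "\<zero>\<^bsub>?Q\<^esub> = ?q \<zero>\<^bsub>M\<^esub>"
    using M.a_coset_add_zero[OF H.a_subset] by (simp add: quotient_module_def)
  have ag: "abelian_group ?Q"
  proof (rule abelian_groupI)
    show "\<zero>\<^bsub>?Q\<^esub> \<in> carrier ?Q" by (simp add: zero carI)
  next
    fix x y assume "x \<in> carrier ?Q" "y \<in> carrier ?Q"
    then show "x \<oplus>\<^bsub>?Q\<^esub> y \<in> carrier ?Q" "x \<oplus>\<^bsub>?Q\<^esub> y = y \<oplus>\<^bsub>?Q\<^esub> x"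
      using carE[of x] carE[of y] by (auto simp: add carI M.a_comm)
  next
    fix x y z assume "x \<in> carrier ?Q" "y \<in> carrier ?Q" "z \<in> carrier ?Q"
    then show "x \<oplus>\<^bsub>?Q\<^esub> y \<oplus>\<^bsub>?Q\<^esub> z = x \<oplus>\<^bsub>?Q\<^esub> (y \<oplus>\<^bsub>?Q\<^esub> z)"
      using carE[of x] carE[of y] carE[of z] by (auto simp: add M.a_assoc)
  next
    fix x assume "x \<in> carrier ?Q"
    then obtain m where m: "m \<in> carrier M" "x = ?q m" using carE by blast
    show "\<zero>\<^bsub>?Q\<^esub> \<oplus>\<^bsub>?Q\<^esub> x = x" using m by (simp add: zero add)
    have "?q (\<ominus>\<^bsub>M\<^esub> m) \<oplus>\<^bsub>?Q\<^esub> x = \<zero>\<^bsub>?Q\<^esub>"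
      using m by (simp add: zero add M.l_neg)
    then show "\<exists>y\<in>carrier ?Q. y \<oplus>\<^bsub>?Q\<^esub> x = \<zero>\<^bsub>?Q\<^esub>"
      using m carI[of "\<ominus>\<^bsub>M\<^esub> m"] by blast
  qed
  show "?q \<in> linear_maps K M ?Q"
    by (rule linear_mapsI) (auto simp: carI add smult)
  show "module K ?Q"
  proof (rule moduleI)
    show "cring K" by (rule module_cring[OF M])
    show "abelian_group ?Q" by (rule ag)
  next
    fix a x assume "a \<in> carrier K" "x \<in> carrier ?Q"
    then show "a \<odot>\<^bsub>?Q\<^esub> x \<in> carrier ?Q" using carE[of x] by (auto simp: smult carI)
  next
    fix a b x assume "a \<in> carrier K" "b \<in> carrier K" "x \<in> carrier ?Q"
    then show "(a \<oplus>\<^bsub>K\<^esub> b) \<odot>\<^bsub>?Q\<^esub> x = a \<odot>\<^bsub>?Q\<^esub> x \<oplus>\<^bsub>?Q\<^esub> b \<odot>\<^bsub>?Q\<^esub> x"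
      and "(a \<otimes>\<^bsub>K\<^esub> b) \<odot>\<^bsub>?Q\<^esub> x = a \<odot>\<^bsub>?Q\<^esub> (b \<odot>\<^bsub>?Q\<^esub> x)"
      using carE[of x] by (auto simp: smult add M.smult_l_distr M.smult_assoc1)
  next
    fix a x y assume "a \<in> carrier K" "x \<in> carrier ?Q" "y \<in> carrier ?Q"
    then show "a \<odot>\<^bsub>?Q\<^esub> (x \<oplus>\<^bsub>?Q\<^esub> y) = a \<odot>\<^bsub>?Q\<^esub> x \<oplus>\<^bsub>?Q\<^esub> a \<odot>\<^bsub>?Q\<^esub> y"
      using carE[of x] carE[of y] by (auto simp: smult add M.smult_r_distr)
  next
    fix x assume "x \<in> carrier ?Q"
    then show "\<one>\<^bsub>K\<^esub> \<odot>\<^bsub>?Q\<^esub> x = x" using carE[of x] by (auto simp: smult)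
  qed
qed

lemma quotient_carrier_cases:
  assumes "X \<in> carrier (quotient_module M H)"
  obtains m where "m \<in> carrier M" "X = H +>\<^bsub>M\<^esub> m"
  using assms by (auto simp: quotient_module_def A_RCOSETS_def')

lemma regular_module_simps [simp]:
  "carrier (regular_module R X) = X" "\<zero>\<^bsub>regular_module R X\<^esub> = \<zero>\<^bsub>R\<^esub>"
  "add (regular_module R X) = add R" "smult (regular_module R X) = mult R"
  by (simp_all add: regular_module_def)

section \<open>Free modules\<close>

context
  fixes K :: "('k, 'x) ring_scheme" (structure) and Z :: "'z set"
  assumes K: "cring K"
begin

interpretation K: cring K by (rule K)

lemma free_module_val: "f \<in> carrier (free_module K Z) \<Longrightarrow> f z \<in> carrier K"
  by (cases "z \<in> Z") (auto simp: free_module_def)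

lemma free_module_module: "module K (free_module K Z)"
proof -
  let ?F = "free_module K Z"
  have closed: "f \<in> carrier ?F"
    if "\<And>z. f z \<in> carrier K" "\<And>z. z \<notin> Z \<Longrightarrow> f z = \<zero>" "finite A" "\<And>z. z \<notin> A \<Longrightarrow> f z = \<zero>" for f A
    using that by (auto simp: free_module_def intro!: finite_subset[of _ A])
  have out: "f z = \<zero>" if "f \<in> carrier ?F" "z \<notin> Z" for f z
    using that by (auto simp: free_module_def)
  have fin: "finite {z. f z \<noteq> \<zero>}" if "f \<in> carrier ?F" for f
    using that by (auto simp: free_module_def)
  have op: "(f \<oplus>\<^bsub>?F\<^esub> g) z = f z \<oplus> g z" "(a \<odot>\<^bsub>?F\<^esub> f) z = a \<otimes> f z" "\<zero>\<^bsub>?F\<^esub> z = \<zero>" for a f g z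
    by (simp_all add: free_module_def)
  note val = free_module_val
  have addc: "f \<oplus>\<^bsub>?F\<^esub> g \<in> carrier ?F" if "f \<in> carrier ?F" "g \<in> carrier ?F" for f g
    by (rule closed[of _ "{z. f z \<noteq> \<zero>} \<union> {z. g z \<noteq> \<zero>}"]) (use that in \<open>auto simp: op val out fin\<close>)
  have zeroc: "\<zero>\<^bsub>?F\<^esub> \<in> carrier ?F"
    by (rule closed[of _ "{}"]) (auto simp: op)
  have ag: "abelian_group ?F"
  proof (rule abelian_groupI)
    fix f assume f: "f \<in> carrier ?F"
    have "(\<lambda>z. \<ominus> f z) \<in> carrier ?F"
      by (rule closed[of _ "{z. f z \<noteq> \<zero>}"]) (use f in \<open>auto simp: val out fin\<close>)
    moreover have "(\<lambda>z. \<ominus> f z) \<oplus>\<^bsub>?F\<^esub> f = \<zero>\<^bsub>?F\<^esub>"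
      using val[OF f] by (simp add: fun_eq_iff op K.l_neg)
    ultimately show "\<exists>y\<in>carrier ?F. y \<oplus>\<^bsub>?F\<^esub> f = \<zero>\<^bsub>?F\<^esub>" by blast
  qed (simp_all add: fun_eq_iff op val addc zeroc K.a_ac)
  show ?thesis
  proof (rule moduleI)
    fix a f assume "a \<in> carrier K" "f \<in> carrier ?F"
    then show "a \<odot>\<^bsub>?F\<^esub> f \<in> carrier ?F"
      by (intro closed[of _ "{z. f z \<noteq> \<zero>}"]) (auto simp: op val out fin)
  qed (simp_all add: fun_eq_iff op val K ag K.l_distr K.r_distr K.m_assoc)
qed

lemma free_gen_closed: "z \<in> Z \<Longrightarrow> free_gen K z \<in> carrier (free_module K Z)"
  by (auto simp: free_module_def free_gen_def)

lemma regular_module_module: "module K (regular_module K (carrier K))"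
proof (rule moduleI)
  show "abelian_group (regular_module K (carrier K))"
    by (rule abelian_groupI)
      (auto simp: regular_module_def K.a_ac intro: exI[of _ "\<ominus> x" for x] K.l_neg bexI[of _ "\<ominus> x" for x])
qed (auto simp: regular_module_def K K.l_distr K.r_distr K.m_assoc)

text \<open>Checked pointwise: evaluation at \<open>y\<close> is a linear functional, and only the summand at \<open>y\<close>
  survives it.\<close>

lemma free_module_expand:
  assumes f: "f \<in> carrier (free_module K Z)"
  shows "f = (\<Oplus>\<^bsub>free_module K Z\<^esub>z\<in>{z. f z \<noteq> \<zero>}. f z \<odot>\<^bsub>free_module K Z\<^esub> free_gen K z)"
proof
  fix y
  let ?F = "free_module K Z" and ?A = "{z. f z \<noteq> \<zero>}"
  interpret F: module K ?F by (rule free_module_module)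
  interpret R: module K "regular_module K (carrier K)" by (rule regular_module_module)
  have fin: "finite ?A" using f by (auto simp: free_module_def)
  have sub: "?A \<subseteq> Z" using f by (auto simp: free_module_def)
  let ?g = "\<lambda>z. f z \<odot>\<^bsub>?F\<^esub> free_gen K z"
  have ev: "(\<lambda>h. h y) \<in> linear_maps K ?F (regular_module K (carrier K))"
    by (rule linear_mapsI) (auto simp: regular_module_def free_module_val, auto simp: free_module_def)
  have "?g \<in> ?A \<rightarrow> carrier ?F"
    using sub by (auto intro!: F.smult_closed free_gen_closed free_module_val[OF f])
  then have "(\<Oplus>\<^bsub>?F\<^esub>z\<in>?A. ?g z) y = (\<Oplus>\<^bsub>regular_module K (carrier K)\<^esub>z\<in>?A. ?g z y)"
    using linear_finsum[OF ev F.abelian_group_axioms module_abelian[OF regular_module_module] fin] by simp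
  also have "\<dots> = (\<Oplus>\<^bsub>regular_module K (carrier K)\<^esub>z\<in>?A. if y = z then f z else \<zero>)"
    by (rule R.finsum_cong') (auto simp: free_module_def free_gen_def free_module_val[OF f] regular_module_def)
  also have "\<dots> = f y"
  proof (cases "y \<in> ?A")
    case True
    then show ?thesis
      using R.add.finprod_singleton[OF True fin, of f] free_module_val[OF f] by (simp add: Pi_def cong: if_cong)
  next
    case False
    then have "(\<Oplus>\<^bsub>regular_module K (carrier K)\<^esub>z\<in>?A. if y = z then f z else \<zero>) =
        (\<Oplus>\<^bsub>regular_module K (carrier K)\<^esub>z\<in>?A. \<zero>\<^bsub>regular_module K (carrier K)\<^esub>)"
      by (intro R.finsum_cong') auto
    also have "\<dots> = \<zero>" by (subst R.finsum_zero) simp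
    finally show ?thesis using False by simp
  qed
  finally show "f y = (\<Oplus>\<^bsub>?F\<^esub>z\<in>?A. ?g z) y" ..
qed

text \<open>The linear extension of \<open>\<beta>\<close> sums over the support; to compare the supports of \<open>f\<close>, \<open>g\<close> and
  \<open>f + g\<close> all three sums are taken over a common finite set.\<close>

lemma free_module_lift:
  assumes W: "module K W" and \<beta>: "\<beta> \<in> Z \<rightarrow> carrier W"
  defines "L \<equiv> \<lambda>f. \<Oplus>\<^bsub>W\<^esub>z\<in>{z. f z \<noteq> \<zero>}. f z \<odot>\<^bsub>W\<^esub> \<beta> z"
  shows "L \<in> linear_maps K (free_module K Z) W"
    and "z \<in> Z \<Longrightarrow> L (free_gen K z) = \<beta> z"
proof -
  let ?F = "free_module K Z"
  interpret W: module K W by (rule W)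
  have fin: "finite {z. f z \<noteq> \<zero>}" and sub: "{z. f z \<noteq> \<zero>} \<subseteq> Z" if "f \<in> carrier ?F" for f
    using that by (auto simp: free_module_def)
  have L: "L f = (\<Oplus>\<^bsub>W\<^esub>z\<in>A. f z \<odot>\<^bsub>W\<^esub> \<beta> z)"
    if f: "f \<in> carrier ?F" and A: "finite A" "{z. f z \<noteq> \<zero>} \<subseteq> A" "A \<subseteq> Z" for f A
  proof -
    have "\<beta> z \<in> carrier W" if "z \<in> A" for z using that A(3) \<beta> by blast
    with A free_module_val[OF f] show ?thesis
      unfolding L_def by - (rule W.add.finprod_mono_neutral_cong_left, auto)
  qed
  have clos: "(\<lambda>z. f z \<odot>\<^bsub>W\<^esub> \<beta> z) \<in> A \<rightarrow> carrier W" if "f \<in> carrier ?F" "A \<subseteq> Z" for f A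
    using that \<beta> free_module_val[OF that(1)] by auto
  interpret F: module K ?F by (rule free_module_module)
  show "L \<in> linear_maps K ?F W"
  proof (rule linear_mapsI)
    fix f assume f: "f \<in> carrier ?F"
    show "L f \<in> carrier W"
      unfolding L_def by (rule W.finsum_closed) (rule clos[OF f sub[OF f]])
  next
    fix f g assume f: "f \<in> carrier ?F" and g: "g \<in> carrier ?F"
    let ?A = "{z. f z \<noteq> \<zero>} \<union> {z. g z \<noteq> \<zero>}"
    have A: "finite ?A" "?A \<subseteq> Z" using fin sub f g by auto
    have "L (f \<oplus>\<^bsub>?F\<^esub> g) = (\<Oplus>\<^bsub>W\<^esub>z\<in>?A. (f \<oplus>\<^bsub>?F\<^esub> g) z \<odot>\<^bsub>W\<^esub> \<beta> z)"
    proof (rule L[OF F.a_closed[OF f g] A(1) _ A(2)])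
      show "{z. (f \<oplus>\<^bsub>?F\<^esub> g) z \<noteq> \<zero>} \<subseteq> ?A" by (auto simp: free_module_def)
    qed
    also have "\<dots> = (\<Oplus>\<^bsub>W\<^esub>z\<in>?A. f z \<odot>\<^bsub>W\<^esub> \<beta> z \<oplus>\<^bsub>W\<^esub> g z \<odot>\<^bsub>W\<^esub> \<beta> z)"
    proof (rule W.finsum_cong')
      show "(\<lambda>z. f z \<odot>\<^bsub>W\<^esub> \<beta> z \<oplus>\<^bsub>W\<^esub> g z \<odot>\<^bsub>W\<^esub> \<beta> z) \<in> ?A \<rightarrow> carrier W"
        using clos[OF f A(2)] clos[OF g A(2)] by blast
      fix z assume "z \<in> ?A"
      then have "\<beta> z \<in> carrier W" using A(2) \<beta> by blast
      then show "(f \<oplus>\<^bsub>?F\<^esub> g) z \<odot>\<^bsub>W\<^esub> \<beta> z = f z \<odot>\<^bsub>W\<^esub> \<beta> z \<oplus>\<^bsub>W\<^esub> g z \<odot>\<^bsub>W\<^esub> \<beta> z"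
        using W.smult_l_distr[OF free_module_val[OF f] free_module_val[OF g]] by (simp add: free_module_def)
    qed simp
    also have "\<dots> = (\<Oplus>\<^bsub>W\<^esub>z\<in>?A. f z \<odot>\<^bsub>W\<^esub> \<beta> z) \<oplus>\<^bsub>W\<^esub> (\<Oplus>\<^bsub>W\<^esub>z\<in>?A. g z \<odot>\<^bsub>W\<^esub> \<beta> z)"
      by (rule W.finsum_addf) (use clos[OF f A(2)] clos[OF g A(2)] in auto)
    also have "\<dots> = L f \<oplus>\<^bsub>W\<^esub> L g" using L[OF f A(1) _ A(2)] L[OF g A(1) _ A(2)] by simp
    finally show "L (f \<oplus>\<^bsub>?F\<^esub> g) = L f \<oplus>\<^bsub>W\<^esub> L g" .
  next
    fix a f assume a: "a \<in> carrier K" and f: "f \<in> carrier ?F"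
    let ?A = "{z. f z \<noteq> \<zero>}"
    have "L (a \<odot>\<^bsub>?F\<^esub> f) = (\<Oplus>\<^bsub>W\<^esub>z\<in>?A. (a \<odot>\<^bsub>?F\<^esub> f) z \<odot>\<^bsub>W\<^esub> \<beta> z)"
    proof (rule L[OF F.smult_closed[OF a f] fin[OF f] _ sub[OF f]])
      show "{z. (a \<odot>\<^bsub>?F\<^esub> f) z \<noteq> \<zero>} \<subseteq> ?A" using a by (auto simp: free_module_def)
    qed
    also have "\<dots> = (\<Oplus>\<^bsub>W\<^esub>z\<in>?A. a \<odot>\<^bsub>W\<^esub> (f z \<odot>\<^bsub>W\<^esub> \<beta> z))"
    proof (rule W.finsum_cong')
      show "(\<lambda>z. a \<odot>\<^bsub>W\<^esub> (f z \<odot>\<^bsub>W\<^esub> \<beta> z)) \<in> ?A \<rightarrow> carrier W"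
        using clos[OF f sub[OF f]] a by blast
      fix z assume "z \<in> ?A"
      then have "\<beta> z \<in> carrier W" using sub[OF f] \<beta> by blast
      then show "(a \<odot>\<^bsub>?F\<^esub> f) z \<odot>\<^bsub>W\<^esub> \<beta> z = a \<odot>\<^bsub>W\<^esub> (f z \<odot>\<^bsub>W\<^esub> \<beta> z)"
        using W.smult_assoc1[OF a free_module_val[OF f]] by (simp add: free_module_def)
    qed simp
    also have "\<dots> = a \<odot>\<^bsub>W\<^esub> L f"
      unfolding L_def by (rule W.finsum_smult_ldistr[symmetric, OF fin[OF f] a clos[OF f sub[OF f]]])
    finally show "L (a \<odot>\<^bsub>?F\<^esub> f) = a \<odot>\<^bsub>W\<^esub> L f" .
  qed
  show "L (free_gen K z) = \<beta> z" if z: "z \<in> Z" for z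
  proof -
    have bz: "\<beta> z \<in> carrier W" using z \<beta> by blast
    have "L (free_gen K z) = (\<Oplus>\<^bsub>W\<^esub>y\<in>{z}. free_gen K z y \<odot>\<^bsub>W\<^esub> \<beta> y)"
      by (rule L) (use z free_gen_closed in \<open>auto simp: free_gen_def split: if_splits\<close>)
    then show ?thesis using bz by (simp add: free_gen_def)
  qed
qed

end

section \<open>Tensor products\<close>

definition bilinear ::
  "('k, 'x) ring_scheme \<Rightarrow> ('k, 'm) module \<Rightarrow> ('k, 'n) module \<Rightarrow> ('k, 'w) module \<Rightarrow>
   ('m \<Rightarrow> 'n \<Rightarrow> 'w) \<Rightarrow> bool" where
  "bilinear K M N W \<beta> \<longleftrightarrow>
     (\<forall>m\<in>carrier M. \<beta> m \<in> linear_maps K N W) \<and>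
     (\<forall>n\<in>carrier N. (\<lambda>m. \<beta> m n) \<in> linear_maps K M W)"

lemma bilinearI:
  assumes "\<And>m. m \<in> carrier M \<Longrightarrow> \<beta> m \<in> linear_maps K N W"
    and "\<And>n. n \<in> carrier N \<Longrightarrow> (\<lambda>m. \<beta> m n) \<in> linear_maps K M W"
  shows "bilinear K M N W \<beta>"
  using assms by (simp add: bilinear_def)

lemma bilinear_left: "\<lbrakk>bilinear K M N W \<beta>; n \<in> carrier N\<rbrakk> \<Longrightarrow> (\<lambda>m. \<beta> m n) \<in> linear_maps K M W"
  and bilinear_right: "\<lbrakk>bilinear K M N W \<beta>; m \<in> carrier M\<rbrakk> \<Longrightarrow> \<beta> m \<in> linear_maps K N W"
  by (simp_all add: bilinear_def)

lemma bilinear_closed: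
  "\<lbrakk>bilinear K M N W \<beta>; m \<in> carrier M; n \<in> carrier N\<rbrakk> \<Longrightarrow> \<beta> m n \<in> carrier W"
  by (rule linear_closed[OF bilinear_right])

lemma bilinear_comp:
  assumes "bilinear K M N W \<beta>" "f \<in> linear_maps K M' M" "g \<in> linear_maps K N' N" "h \<in> linear_maps K W W'"
  shows "bilinear K M' N' W' (\<lambda>m n. h (\<beta> (f m) (g n)))"
proof (rule bilinearI)
  fix m assume "m \<in> carrier M'"
  then show "(\<lambda>n. h (\<beta> (f m) (g n))) \<in> linear_maps K N' W'"
    by (intro linear_comp[OF linear_comp[OF assms(3) bilinear_right[OF assms(1)]] assms(4)]
      linear_closed[OF assms(2)])
next
  fix n assume "n \<in> carrier N'"
  then show "(\<lambda>m. h (\<beta> (f m) (g n))) \<in> linear_maps K M' W'"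
    by (intro linear_comp[OF linear_comp[OF assms(2) bilinear_left[OF assms(1)]] assms(4)]
      linear_closed[OF assms(3)])
qed

lemma bilinear_cong:
  assumes "module K M" "module K N" "bilinear K M N W \<beta>"
    and "\<And>m n. \<lbrakk>m \<in> carrier M; n \<in> carrier N\<rbrakk> \<Longrightarrow> \<beta>' m n = \<beta> m n"
  shows "bilinear K M N W \<beta>'"
proof (rule bilinearI)
  show "\<beta>' m \<in> linear_maps K N W" if "m \<in> carrier M" for m
    by (rule linear_cong[OF assms(2) bilinear_right[OF assms(3) that]]) (simp add: assms(4) that)
  show "(\<lambda>m. \<beta>' m n) \<in> linear_maps K M W" if "n \<in> carrier N" for n
    by (rule linear_cong[OF assms(1) bilinear_left[OF assms(3) that]]) (simp add: assms(4) that)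
qed

locale tensor_factors =
  fixes K :: "('k, 'x) ring_scheme" and M :: "('k, 'm) module" and N :: "('k, 'n) module"
  assumes M: "module K M" and N: "module K N"
begin

interpretation M: module K M by (rule M)
interpretation N: module K N by (rule N)

abbreviation "F \<equiv> free_module K (carrier M \<times> carrier N)"
abbreviation "g \<equiv> \<lambda>m n. free_gen K (m, n)"

lemma free: "module K F"
  by (rule free_module_module[OF module_cring[OF M]])

lemma gen_closed: "\<lbrakk>m \<in> carrier M; n \<in> carrier N\<rbrakk> \<Longrightarrow> g m n \<in> carrier F"
  by (rule free_gen_closed[OF module_cring[OF M]]) simp

lemma relators_closed: "tensor_relators K M N \<subseteq> carrier F"
proof -
  interpret F: module K F by (rule free)
  show ?thesis
    by (auto simp: tensor_relators_def Let_def intro!: F.minus_closed F.a_closed F.smult_closed gen_closed)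
qed

lemma null_submodule: "submodule (tensor_null K M N) K F"
  unfolding tensor_null_def by (rule module_span_submodule[OF free relators_closed])

lemma tensor_module: "module K (M \<boxtimes>\<^bsub>K\<^esub> N)"
  unfolding tensor_def by (rule quotient_module_module[OF free null_submodule])

lemma proj_linear: "(\<lambda>f. tensor_null K M N +>\<^bsub>F\<^esub> f) \<in> linear_maps K F (M \<boxtimes>\<^bsub>K\<^esub> N)"
  unfolding tensor_def by (rule quotient_proj_linear[OF free null_submodule])

lemma proj_relator:
  assumes "x \<ominus>\<^bsub>F\<^esub> y \<in> tensor_relators K M N" "x \<in> carrier F" "y \<in> carrier F"
  shows "tensor_null K M N +>\<^bsub>F\<^esub> x = tensor_null K M N +>\<^bsub>F\<^esub> y"
proof -
  interpret H: abelian_subgroup "tensor_null K M N" F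
    by (rule submodule_abelian_subgroup[OF free null_submodule])
  have "x \<ominus>\<^bsub>F\<^esub> y \<in> tensor_null K M N"
    using assms(1) module_span_base[of "tensor_relators K M N" K F] by (auto simp: tensor_null_def)
  then have "x \<in> tensor_null K M N +>\<^bsub>F\<^esub> y"
    using H.a_rcos_module[OF assms(3,2)] by (simp add: a_minus_def)
  then show ?thesis using H.a_repr_independence' assms(3) by simp
qed

lemma pure_bilinear: "bilinear K M N (M \<boxtimes>\<^bsub>K\<^esub> N) (pure K M N)"
proof -
  interpret F: module K F by (rule free)
  have rel: "\<And>m m' n. \<lbrakk>m \<in> carrier M; m' \<in> carrier M; n \<in> carrier N\<rbrakk> \<Longrightarrow>
      g (m \<oplus>\<^bsub>M\<^esub> m') n \<ominus>\<^bsub>F\<^esub> (g m n \<oplus>\<^bsub>F\<^esub> g m' n) \<in> tensor_relators K M N"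
    "\<And>m n n'. \<lbrakk>m \<in> carrier M; n \<in> carrier N; n' \<in> carrier N\<rbrakk> \<Longrightarrow>
      g m (n \<oplus>\<^bsub>N\<^esub> n') \<ominus>\<^bsub>F\<^esub> (g m n \<oplus>\<^bsub>F\<^esub> g m n') \<in> tensor_relators K M N"
    "\<And>a m n. \<lbrakk>a \<in> carrier K; m \<in> carrier M; n \<in> carrier N\<rbrakk> \<Longrightarrow>
      g (a \<odot>\<^bsub>M\<^esub> m) n \<ominus>\<^bsub>F\<^esub> a \<odot>\<^bsub>F\<^esub> g m n \<in> tensor_relators K M N"
    "\<And>a m n. \<lbrakk>a \<in> carrier K; m \<in> carrier M; n \<in> carrier N\<rbrakk> \<Longrightarrow>
      g m (a \<odot>\<^bsub>N\<^esub> n) \<ominus>\<^bsub>F\<^esub> a \<odot>\<^bsub>F\<^esub> g m n \<in> tensor_relators K M N"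
    unfolding tensor_relators_def Let_def by blast+
  note lin = linear_add[OF proj_linear, symmetric] linear_smult[OF proj_linear, symmetric]
  show ?thesis
    by (intro bilinearI linear_mapsI; simp add: pure_def lin gen_closed linear_closed[OF proj_linear];
        intro proj_relator rel F.a_closed F.smult_closed gen_closed; simp)
qed

text \<open>Bilinearity says precisely that the linear extension to the free module kills the relators, so
  any representative of a tensor may be used to evaluate the lift.\<close>

lemma lift_eq_free_lift:
  assumes W: "module K W" and \<beta>: "bilinear K M N W \<beta>"
  defines "L \<equiv> \<lambda>f. \<Oplus>\<^bsub>W\<^esub>z\<in>{z. f z \<noteq> \<zero>\<^bsub>K\<^esub>}. f z \<odot>\<^bsub>W\<^esub> \<beta> (fst z) (snd z)"
  shows "L \<in> linear_maps K F W"
    and "\<lbrakk>m \<in> carrier M; n \<in> carrier N\<rbrakk> \<Longrightarrow> L (g m n) = \<beta> m n"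
    and "f \<in> carrier F \<Longrightarrow> tensor_lift K W \<beta> (tensor_null K M N +>\<^bsub>F\<^esub> f) = L f"
proof -
  interpret W: module K W by (rule W)
  interpret F: module K F by (rule free)
  have cl: "(\<lambda>z. \<beta> (fst z) (snd z)) \<in> carrier M \<times> carrier N \<rightarrow> carrier W"
    using bilinear_closed[OF \<beta>] by auto
  show L: "L \<in> linear_maps K F W"
    unfolding L_def by (rule free_module_lift(1)[OF module_cring[OF M] W cl])
  show gen: "L (g m n) = \<beta> m n" if "m \<in> carrier M" "n \<in> carrier N" for m n
    using free_module_lift(2)[OF module_cring[OF M] W cl, of "(m, n)"] that by (simp add: L_def)
  note lin = linear_diff[OF L F.abelian_group_axioms W.abelian_group_axioms] linear_add[OF L]
    linear_smult[OF L] gen gen_closed linear_add[OF bilinear_left[OF \<beta>]] linear_add[OF bilinear_right[OF \<beta>]]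
    linear_smult[OF bilinear_left[OF \<beta>]] linear_smult[OF bilinear_right[OF \<beta>]] bilinear_closed[OF \<beta>]
  have "L s = \<zero>\<^bsub>W\<^esub>" if "s \<in> tensor_relators K M N" for s
    using that by (auto simp: tensor_relators_def Let_def lin W.r_neg W.minus_eq)
  then have null: "L h = \<zero>\<^bsub>W\<^esub>" if "h \<in> tensor_null K M N" for h
    using linear_span_zero[OF free W L relators_closed] that by (simp add: tensor_null_def)
  show "tensor_lift K W \<beta> (tensor_null K M N +>\<^bsub>F\<^esub> f) = L f" if "f \<in> carrier F"
    unfolding tensor_lift_def Let_def
    using linear_coset_some[OF free W null_submodule L null that] by (simp add: L_def)
qed

lemma tensor_lift_linear:
  assumes "module K W" "bilinear K M N W \<beta>"
  shows "tensor_lift K W \<beta> \<in> linear_maps K (M \<boxtimes>\<^bsub>K\<^esub> N) W"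
proof -
  let ?q = "\<lambda>f. tensor_null K M N +>\<^bsub>F\<^esub> f"
  interpret F: module K F by (rule free)
  note aux = lift_eq_free_lift[OF assms]
  have rep: "\<exists>f\<in>carrier F. X = ?q f" if "X \<in> carrier (M \<boxtimes>\<^bsub>K\<^esub> N)" for X
    using that unfolding tensor_def by (auto elim!: quotient_carrier_cases)
  note q = linear_add[OF proj_linear, symmetric] linear_smult[OF proj_linear, symmetric]
  show ?thesis
  proof (rule linear_mapsI)
    fix X assume "X \<in> carrier (M \<boxtimes>\<^bsub>K\<^esub> N)"
    with rep obtain f where "f \<in> carrier F" "X = ?q f" by blast
    then show "tensor_lift K W \<beta> X \<in> carrier W" using aux(3) linear_closed[OF aux(1)] by simp
  next
    fix X Y assume "X \<in> carrier (M \<boxtimes>\<^bsub>K\<^esub> N)" "Y \<in> carrier (M \<boxtimes>\<^bsub>K\<^esub> N)"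
    with rep obtain f h where "f \<in> carrier F" "X = ?q f" "h \<in> carrier F" "Y = ?q h" by meson
    then show "tensor_lift K W \<beta> (X \<oplus>\<^bsub>M \<boxtimes>\<^bsub>K\<^esub> N\<^esub> Y) = tensor_lift K W \<beta> X \<oplus>\<^bsub>W\<^esub> tensor_lift K W \<beta> Y"
      using aux(3) linear_add[OF aux(1)] by (simp add: q)
  next
    fix a X assume a: "a \<in> carrier K" and "X \<in> carrier (M \<boxtimes>\<^bsub>K\<^esub> N)"
    with rep obtain f where "f \<in> carrier F" "X = ?q f" by blast
    then show "tensor_lift K W \<beta> (a \<odot>\<^bsub>M \<boxtimes>\<^bsub>K\<^esub> N\<^esub> X) = a \<odot>\<^bsub>W\<^esub> tensor_lift K W \<beta> X"
      using aux(3) linear_smult[OF aux(1)] a by (simp add: q)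
  qed
qed

lemma tensor_lift_pure:
  assumes "module K W" "bilinear K M N W \<beta>" "m \<in> carrier M" "n \<in> carrier N"
  shows "tensor_lift K W \<beta> (pure K M N m n) = \<beta> m n"
  using lift_eq_free_lift[OF assms(1,2)] assms(3,4) gen_closed by (simp add: pure_def)

lemma tensor_finite_sum:
  assumes "t \<in> carrier (M \<boxtimes>\<^bsub>K\<^esub> N)"
  obtains A :: "('m \<times> 'n) set" and x y where "finite A" "x \<in> A \<rightarrow> carrier M" "y \<in> A \<rightarrow> carrier N"
    "t = (\<Oplus>\<^bsub>M \<boxtimes>\<^bsub>K\<^esub> N\<^esub>z\<in>A. pure K M N (x z) (y z))"
proof -
  let ?q = "\<lambda>f. tensor_null K M N +>\<^bsub>F\<^esub> f"
  interpret F: module K F by (rule free)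
  interpret T: module K "M \<boxtimes>\<^bsub>K\<^esub> N" by (rule tensor_module)
  obtain f where f: "f \<in> carrier F" "t = ?q f"
    using assms unfolding tensor_def by (auto elim!: quotient_carrier_cases)
  let ?A = "{z. f z \<noteq> \<zero>\<^bsub>K\<^esub>}"
  have A: "finite ?A" "?A \<subseteq> carrier M \<times> carrier N"
    using f(1) by (auto simp: free_module_def)
  have val: "f z \<in> carrier K" for z by (rule free_module_val[OF module_cring[OF M] f(1)])
  have gc: "(\<lambda>z. f z \<odot>\<^bsub>F\<^esub> free_gen K z) \<in> ?A \<rightarrow> carrier F"
    using A(2) by (auto intro!: F.smult_closed val gen_closed)
  have "t = (\<Oplus>\<^bsub>M \<boxtimes>\<^bsub>K\<^esub> N\<^esub>z\<in>?A. ?q (f z \<odot>\<^bsub>F\<^esub> free_gen K z))"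
    unfolding f(2) by (subst free_module_expand[OF module_cring[OF M] f(1)])
      (rule linear_finsum[OF proj_linear F.abelian_group_axioms T.abelian_group_axioms A(1) gc])
  also have "\<dots> = (\<Oplus>\<^bsub>M \<boxtimes>\<^bsub>K\<^esub> N\<^esub>z\<in>?A. pure K M N (f z \<odot>\<^bsub>M\<^esub> fst z) (snd z))"
  proof (rule T.finsum_cong')
    show "(\<lambda>z. pure K M N (f z \<odot>\<^bsub>M\<^esub> fst z) (snd z)) \<in> ?A \<rightarrow> carrier (M \<boxtimes>\<^bsub>K\<^esub> N)"
    proof
      fix z assume "z \<in> ?A"
      with A(2) have "z \<in> carrier M \<times> carrier N" by blast
      then show "pure K M N (f z \<odot>\<^bsub>M\<^esub> fst z) (snd z) \<in> carrier (M \<boxtimes>\<^bsub>K\<^esub> N)"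
        by (intro bilinear_closed[OF pure_bilinear] M.smult_closed val) auto
    qed
    fix z assume "z \<in> ?A"
    then obtain m n where z: "z = (m, n)" "m \<in> carrier M" "n \<in> carrier N" using A(2) by blast
    then show "?q (f z \<odot>\<^bsub>F\<^esub> free_gen K z) = pure K M N (f z \<odot>\<^bsub>M\<^esub> fst z) (snd z)"
      using linear_smult[OF proj_linear val gen_closed]
        linear_smult[OF bilinear_left[OF pure_bilinear z(3)] val z(2)]
      by (simp add: pure_def)
  qed simp
  finally have sum: "t = (\<Oplus>\<^bsub>M \<boxtimes>\<^bsub>K\<^esub> N\<^esub>z\<in>?A. pure K M N (f z \<odot>\<^bsub>M\<^esub> fst z) (snd z))" .
  show thesis
  proof (rule that[OF A(1) _ _ sum])
    show "(\<lambda>z. f z \<odot>\<^bsub>M\<^esub> fst z) \<in> ?A \<rightarrow> carrier M" "snd \<in> ?A \<rightarrow> carrier N"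
      using subsetD[OF A(2)] by (fastforce intro!: M.smult_closed val)+
  qed
qed

text \<open>The workhorse of all that follows: an identity between maps that are linear in a tensor need only
  be checked on pure tensors.\<close>

lemma tensor_linear_eqI:
  assumes W: "module K W"
    and f: "f \<in> linear_maps K (M \<boxtimes>\<^bsub>K\<^esub> N) W" and h: "h \<in> linear_maps K (M \<boxtimes>\<^bsub>K\<^esub> N) W"
    and eq: "\<And>m n. \<lbrakk>m \<in> carrier M; n \<in> carrier N\<rbrakk> \<Longrightarrow> f (pure K M N m n) = h (pure K M N m n)"
    and t: "t \<in> carrier (M \<boxtimes>\<^bsub>K\<^esub> N)"
  shows "f t = h t"
proof -
  interpret T: module K "M \<boxtimes>\<^bsub>K\<^esub> N" by (rule tensor_module)
  interpret W: module K W by (rule W)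
  obtain A :: "('m \<times> 'n) set" and x y where A: "finite A" "x \<in> A \<rightarrow> carrier M" "y \<in> A \<rightarrow> carrier N"
    "t = (\<Oplus>\<^bsub>M \<boxtimes>\<^bsub>K\<^esub> N\<^esub>z\<in>A. pure K M N (x z) (y z))"
    by (rule tensor_finite_sum[OF t])
  have cl: "(\<lambda>z. pure K M N (x z) (y z)) \<in> A \<rightarrow> carrier (M \<boxtimes>\<^bsub>K\<^esub> N)"
    using A(2,3) by (auto intro!: bilinear_closed[OF pure_bilinear])
  show ?thesis
    unfolding A(4) linear_finsum[OF f T.abelian_group_axioms W.abelian_group_axioms A(1) cl]
      linear_finsum[OF h T.abelian_group_axioms W.abelian_group_axioms A(1) cl]
    using A(2,3) cl by (intro W.finsum_cong') (auto intro!: eq linear_closed[OF h])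
qed

end

lemmas tensor_module = tensor_factors.tensor_module[OF tensor_factors.intro]
lemmas pure_bilinear = tensor_factors.pure_bilinear[OF tensor_factors.intro]
lemmas tensor_lift_linear = tensor_factors.tensor_lift_linear[OF tensor_factors.intro]
lemmas tensor_lift_pure = tensor_factors.tensor_lift_pure[OF tensor_factors.intro]
lemmas tensor_linear_eqI = tensor_factors.tensor_linear_eqI[OF tensor_factors.intro]
lemmas tensor_finite_sum = tensor_factors.tensor_finite_sum[OF tensor_factors.intro]

section \<open>Maps between tensor products\<close>

lemma pure_closed:
  "\<lbrakk>module K M; module K N; m \<in> carrier M; n \<in> carrier N\<rbrakk> \<Longrightarrow> pure K M N m n \<in> carrier (M \<boxtimes>\<^bsub>K\<^esub> N)"
  by (rule bilinear_closed[OF pure_bilinear])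

text \<open>Both sides of the required identities are linear in the tensor and agree on pure tensors.  This is
  what makes iterated lifts, such as the associator, well behaved.\<close>

lemma tensor_lift_bilinear:
  assumes M: "module K M" "module K N" and L: "module K L" and W: "module K W"
    and \<beta>: "\<And>x. x \<in> carrier L \<Longrightarrow> bilinear K M N W (\<beta> x)"
    and lin: "\<And>m n. \<lbrakk>m \<in> carrier M; n \<in> carrier N\<rbrakk> \<Longrightarrow> (\<lambda>x. \<beta> x m n) \<in> linear_maps K L W"
  shows "bilinear K (M \<boxtimes>\<^bsub>K\<^esub> N) L W (\<lambda>t x. tensor_lift K W (\<beta> x) t)"
proof (rule bilinearI)
  interpret L: module K L by (rule L)
  note lift = tensor_lift_linear[OF M W \<beta>]
  show "\<And>x. x \<in> carrier L \<Longrightarrow> tensor_lift K W (\<beta> x) \<in> linear_maps K (M \<boxtimes>\<^bsub>K\<^esub> N) W"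
    by (rule lift)
  fix t assume t: "t \<in> carrier (M \<boxtimes>\<^bsub>K\<^esub> N)"
  show "(\<lambda>x. tensor_lift K W (\<beta> x) t) \<in> linear_maps K L W"
  proof (rule linear_mapsI)
    fix x assume "x \<in> carrier L"
    then show "tensor_lift K W (\<beta> x) t \<in> carrier W" by (rule linear_closed[OF lift t])
  next
    fix x y assume xy: "x \<in> carrier L" "y \<in> carrier L"
    note xy' = L.M.a_closed[OF xy]
    show "tensor_lift K W (\<beta> (x \<oplus>\<^bsub>L\<^esub> y)) t = tensor_lift K W (\<beta> x) t \<oplus>\<^bsub>W\<^esub> tensor_lift K W (\<beta> y) t"
      by (rule tensor_linear_eqI[OF M W lift[OF xy'] linear_plus[OF W lift[OF xy(1)] lift[OF xy(2)]] _ t])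
        (simp add: tensor_lift_pure[OF M W \<beta>] xy xy' linear_add[OF lin])
  next
    fix a x assume ax: "a \<in> carrier K" "x \<in> carrier L"
    note ax' = L.smult_closed[OF ax]
    show "tensor_lift K W (\<beta> (a \<odot>\<^bsub>L\<^esub> x)) t = a \<odot>\<^bsub>W\<^esub> tensor_lift K W (\<beta> x) t"
      by (rule tensor_linear_eqI[OF M W lift[OF ax'] linear_scale[OF W lift[OF ax(2)] ax(1)] _ t])
        (simp add: tensor_lift_pure[OF M W \<beta>] ax ax' linear_smult[OF lin])
  qed
qed

lemma tensor_map_bilinear:
  assumes "module K A" "module K B" "f \<in> linear_maps K M A" "g \<in> linear_maps K N B"
  shows "bilinear K M N (A \<boxtimes>\<^bsub>K\<^esub> B) (\<lambda>m n. pure K A B (f m) (g n))"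
  using bilinear_comp[OF pure_bilinear[OF assms(1,2)] assms(3,4) linear_ident] .

lemma tensor_map_linear:
  assumes "module K M" "module K N" "module K A" "module K B" "f \<in> linear_maps K M A" "g \<in> linear_maps K N B"
  shows "tensor_map K A B f g \<in> linear_maps K (M \<boxtimes>\<^bsub>K\<^esub> N) (A \<boxtimes>\<^bsub>K\<^esub> B)"
  unfolding tensor_map_def
  by (rule tensor_lift_linear[OF assms(1,2) tensor_module[OF assms(3,4)] tensor_map_bilinear[OF assms(3-6)]])

lemma tensor_map_pure:
  assumes "module K M" "module K N" "module K A" "module K B" "f \<in> linear_maps K M A" "g \<in> linear_maps K N B"
    and "m \<in> carrier M" "n \<in> carrier N"
  shows "tensor_map K A B f g (pure K M N m n) = pure K A B (f m) (g n)"
  unfolding tensor_map_def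
  by (rule tensor_lift_pure[OF assms(1,2) tensor_module[OF assms(3,4)] tensor_map_bilinear[OF assms(3-6)] assms(7,8)])

lemma
  assumes L: "module K L" and M: "module K M" and N: "module K N"
  shows tensor_assoc_linear:
      "tensor_assoc K L M N \<in> linear_maps K ((L \<boxtimes>\<^bsub>K\<^esub> M) \<boxtimes>\<^bsub>K\<^esub> N) (L \<boxtimes>\<^bsub>K\<^esub> (M \<boxtimes>\<^bsub>K\<^esub> N))"
    and tensor_assoc_pure: "\<lbrakk>t \<in> carrier (L \<boxtimes>\<^bsub>K\<^esub> M); n \<in> carrier N\<rbrakk> \<Longrightarrow>
      tensor_assoc K L M N (pure K (L \<boxtimes>\<^bsub>K\<^esub> M) N t n) =
        tensor_lift K (L \<boxtimes>\<^bsub>K\<^esub> (M \<boxtimes>\<^bsub>K\<^esub> N)) (\<lambda>l m. pure K L (M \<boxtimes>\<^bsub>K\<^esub> N) l (pure K M N m n)) t"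
    and tensor_assoc_inner: "n \<in> carrier N \<Longrightarrow>
      bilinear K L M (L \<boxtimes>\<^bsub>K\<^esub> (M \<boxtimes>\<^bsub>K\<^esub> N)) (\<lambda>l m. pure K L (M \<boxtimes>\<^bsub>K\<^esub> N) l (pure K M N m n))"
proof -
  note MN = tensor_module[OF M N] and LM = tensor_module[OF L M]
  note W = tensor_module[OF L MN]
  show inner: "bilinear K L M (L \<boxtimes>\<^bsub>K\<^esub> (M \<boxtimes>\<^bsub>K\<^esub> N)) (\<lambda>l m. pure K L (M \<boxtimes>\<^bsub>K\<^esub> N) l (pure K M N m n))"
    if "n \<in> carrier N" for n
    by (rule bilinear_comp[OF pure_bilinear[OF L MN] linear_ident bilinear_left[OF pure_bilinear[OF M N] that] linear_ident])
  have *: "(\<lambda>n. pure K L (M \<boxtimes>\<^bsub>K\<^esub> N) l (pure K M N m n)) \<in> linear_maps K N (L \<boxtimes>\<^bsub>K\<^esub> (M \<boxtimes>\<^bsub>K\<^esub> N))"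
    if "l \<in> carrier L" "m \<in> carrier M" for l m
    by (rule linear_comp[OF bilinear_right[OF pure_bilinear[OF M N] that(2)] bilinear_right[OF pure_bilinear[OF L MN] that(1)]])
  note outer = tensor_lift_bilinear[OF L M N W inner *]
  show "tensor_assoc K L M N \<in> linear_maps K ((L \<boxtimes>\<^bsub>K\<^esub> M) \<boxtimes>\<^bsub>K\<^esub> N) (L \<boxtimes>\<^bsub>K\<^esub> (M \<boxtimes>\<^bsub>K\<^esub> N))"
    unfolding tensor_assoc_def by (rule tensor_lift_linear[OF LM N W outer])
  show "tensor_assoc K L M N (pure K (L \<boxtimes>\<^bsub>K\<^esub> M) N t n) =
        tensor_lift K (L \<boxtimes>\<^bsub>K\<^esub> (M \<boxtimes>\<^bsub>K\<^esub> N)) (\<lambda>l m. pure K L (M \<boxtimes>\<^bsub>K\<^esub> N) l (pure K M N m n)) t"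
    if "t \<in> carrier (L \<boxtimes>\<^bsub>K\<^esub> M)" "n \<in> carrier N"
    unfolding tensor_assoc_def by (rule tensor_lift_pure[OF LM N W outer that])
qed

lemma linear_tensor_lift:
  assumes M: "module K M" "module K N" and W: "module K W" "module K W'" and \<beta>: "bilinear K M N W \<beta>"
    and h: "h \<in> linear_maps K W W'" and t: "t \<in> carrier (M \<boxtimes>\<^bsub>K\<^esub> N)"
  shows "h (tensor_lift K W \<beta> t) = tensor_lift K W' (\<lambda>m n. h (\<beta> m n)) t"
proof -
  have b: "bilinear K M N W' (\<lambda>m n. h (\<beta> m n))"
    by (rule bilinear_comp[OF \<beta> linear_ident linear_ident h])
  show ?thesis
    by (rule tensor_linear_eqI[OF M W(2) linear_comp[OF tensor_lift_linear[OF M W(1) \<beta>] h]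
      tensor_lift_linear[OF M W(2) b] _ t])
      (simp add: tensor_lift_pure[OF M W(1) \<beta>] tensor_lift_pure[OF M W(2) b])
qed

lemma tensor_lift_tensor_map:
  assumes M: "module K M" "module K N" "module K A" "module K B" and W: "module K W"
    and \<beta>: "bilinear K A B W \<beta>" and f: "f \<in> linear_maps K M A" and g: "g \<in> linear_maps K N B"
    and t: "t \<in> carrier (M \<boxtimes>\<^bsub>K\<^esub> N)"
  shows "tensor_lift K W \<beta> (tensor_map K A B f g t) = tensor_lift K W (\<lambda>m n. \<beta> (f m) (g n)) t"
proof -
  have b: "bilinear K M N W (\<lambda>m n. \<beta> (f m) (g n))"
    by (rule bilinear_comp[OF \<beta> f g linear_ident])
  show ?thesis
    by (rule tensor_linear_eqI[OF M(1,2) W linear_comp[OF tensor_map_linear[OF M f g]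
      tensor_lift_linear[OF M(3,4) W \<beta>]] tensor_lift_linear[OF M(1,2) W b] _ t])
      (simp add: tensor_map_pure[OF M f g] tensor_lift_pure[OF M(3,4) W \<beta>] tensor_lift_pure[OF M(1,2) W b]
        linear_closed[OF f] linear_closed[OF g])
qed

lemma tensor_lift_cong:
  assumes M: "module K M" "module K N" "module K W" and \<beta>: "bilinear K M N W \<beta>" "bilinear K M N W \<beta>'"
    and "\<And>m n. \<lbrakk>m \<in> carrier M; n \<in> carrier N\<rbrakk> \<Longrightarrow> \<beta> m n = \<beta>' m n"
    and t: "t \<in> carrier (M \<boxtimes>\<^bsub>K\<^esub> N)"
  shows "tensor_lift K W \<beta> t = tensor_lift K W \<beta>' t"
  by (rule tensor_linear_eqI[OF M tensor_lift_linear[OF M \<beta>(1)] tensor_lift_linear[OF M \<beta>(2)] _ t])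
    (simp add: tensor_lift_pure[OF M \<beta>(1)] tensor_lift_pure[OF M \<beta>(2)] assms(6))

section \<open>Slice maps\<close>

text \<open>\<open>left_slice d\<close> is \<open>d \<otimes> id\<close> followed by the identification of \<open>k \<otimes> N\<close> with \<open>N\<close>; similarly
  \<open>right_slice d\<close> is \<open>id \<otimes> d\<close>.\<close>

definition left_slice :: "('k, 'x) ring_scheme \<Rightarrow> ('k, 'n) module \<Rightarrow> ('m \<Rightarrow> 'k) \<Rightarrow> ('m \<times> 'n \<Rightarrow> 'k) set \<Rightarrow> 'n" where
  "left_slice K N d = tensor_lift K N (\<lambda>x y. d x \<odot>\<^bsub>N\<^esub> y)"

definition right_slice :: "('k, 'x) ring_scheme \<Rightarrow> ('k, 'm) module \<Rightarrow> ('n \<Rightarrow> 'k) \<Rightarrow> ('m \<times> 'n \<Rightarrow> 'k) set \<Rightarrow> 'm" where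
  "right_slice K M d = tensor_lift K M (\<lambda>x y. d y \<odot>\<^bsub>M\<^esub> x)"

abbreviation functionals :: "('k, 'x) ring_scheme \<Rightarrow> ('k, 'm) module \<Rightarrow> ('m \<Rightarrow> 'k) set" where
  "functionals K M \<equiv> linear_maps K M (regular_module K (carrier K))"

lemma left_slice_bilinear:
  assumes "module K N" "d \<in> functionals K M"
  shows "bilinear K M N N (\<lambda>x y. d x \<odot>\<^bsub>N\<^esub> y)"
proof -
  interpret N: module K N by fact
  note d = linear_closed[OF assms(2), simplified] linear_add[OF assms(2), simplified] linear_smult[OF assms(2), simplified]
  show ?thesis
    by (intro bilinearI linear_mapsI) (simp_all add: d N.smult_r_distr N.smult_l_distr N.R.m_comm flip: N.smult_assoc1)
qed

lemma right_slice_bilinear: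
  assumes "module K M" "d \<in> functionals K N"
  shows "bilinear K M N M (\<lambda>x y. d y \<odot>\<^bsub>M\<^esub> x)"
proof -
  have "bilinear K N M M (\<lambda>y x. d y \<odot>\<^bsub>M\<^esub> x)" by (rule left_slice_bilinear[OF assms])
  then show ?thesis by (simp add: bilinear_def)
qed

lemma left_slice_linear:
  "\<lbrakk>module K M; module K N; d \<in> functionals K M\<rbrakk> \<Longrightarrow> left_slice K N d \<in> linear_maps K (M \<boxtimes>\<^bsub>K\<^esub> N) N"
  unfolding left_slice_def by (rule tensor_lift_linear[OF _ _ _ left_slice_bilinear])

lemma right_slice_linear:
  "\<lbrakk>module K M; module K N; d \<in> functionals K N\<rbrakk> \<Longrightarrow> right_slice K M d \<in> linear_maps K (M \<boxtimes>\<^bsub>K\<^esub> N) M"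
  unfolding right_slice_def by (rule tensor_lift_linear[OF _ _ _ right_slice_bilinear])

lemma left_slice_pure:
  "\<lbrakk>module K M; module K N; d \<in> functionals K M; m \<in> carrier M; n \<in> carrier N\<rbrakk> \<Longrightarrow>
    left_slice K N d (pure K M N m n) = d m \<odot>\<^bsub>N\<^esub> n"
  unfolding left_slice_def by (rule tensor_lift_pure[OF _ _ _ left_slice_bilinear])

lemma right_slice_pure:
  "\<lbrakk>module K M; module K N; d \<in> functionals K N; m \<in> carrier M; n \<in> carrier N\<rbrakk> \<Longrightarrow>
    right_slice K M d (pure K M N m n) = d n \<odot>\<^bsub>M\<^esub> m"
  unfolding right_slice_def by (rule tensor_lift_pure[OF _ _ _ right_slice_bilinear])

text \<open>The next two lemmas apply \<open>d\<close> to the first tensor factor of the two sides of a colinearity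
  condition \<open>(id \<otimes> \<rho>\<^sub>N) \<circ> h = (h \<otimes> id) \<circ> \<rho>\<^sub>X\<close> with \<open>h : X \<rightarrow> M \<otimes> N\<close>.\<close>

lemma left_slice_tensor_map:
  assumes M: "module K M" "module K N" "module K N'" and d: "d \<in> functionals K M" and g: "g \<in> linear_maps K N N'"
    and t: "t \<in> carrier (M \<boxtimes>\<^bsub>K\<^esub> N)"
  shows "left_slice K N' d (tensor_map K M N' id g t) = g (left_slice K N d t)"
proof -
  have "left_slice K N' d (tensor_map K M N' id g t) = tensor_lift K N' (\<lambda>x y. d (id x) \<odot>\<^bsub>N'\<^esub> g y) t"
    unfolding left_slice_def
    by (rule tensor_lift_tensor_map[OF M(1,2,1,3,3) left_slice_bilinear[OF M(3) d] linear_id g t])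
  also have "\<dots> = tensor_lift K N' (\<lambda>x y. g (d x \<odot>\<^bsub>N\<^esub> y)) t"
    by (rule tensor_lift_cong[OF M(1,2,3) bilinear_comp[OF left_slice_bilinear[OF M(3) d] linear_id g linear_ident]
       bilinear_comp[OF left_slice_bilinear[OF M(2) d] linear_ident linear_ident g] _ t])
      (simp add: linear_smult[OF g] linear_closed[OF d, simplified])
  also have "\<dots> = g (left_slice K N d t)"
    unfolding left_slice_def
    by (rule linear_tensor_lift[symmetric, OF M(1,2,2,3) left_slice_bilinear[OF M(2) d] g t])
  finally show ?thesis .
qed

lemma left_slice_assoc:
  assumes M: "module K M" "module K N" "module K C" "module K X" and d: "d \<in> functionals K M"
    and h: "h \<in> linear_maps K X (M \<boxtimes>\<^bsub>K\<^esub> N)" and t: "t \<in> carrier (X \<boxtimes>\<^bsub>K\<^esub> C)"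
  shows "left_slice K (N \<boxtimes>\<^bsub>K\<^esub> C) d (tensor_assoc K M N C (tensor_map K (M \<boxtimes>\<^bsub>K\<^esub> N) C h id t)) =
    tensor_map K N C (\<lambda>x. left_slice K N d (h x)) id t"
proof -
  note MN = tensor_module[OF M(1,2)] and NC = tensor_module[OF M(2,3)]
  note sl = left_slice_linear[OF M(1,2) d] and slC = left_slice_linear[OF M(1) NC d]
  note hs = linear_comp[OF h sl]
  have 1: "left_slice K (N \<boxtimes>\<^bsub>K\<^esub> C) d (tensor_assoc K M N C (pure K (M \<boxtimes>\<^bsub>K\<^esub> N) C u c)) =
    pure K N C (left_slice K N d u) c" if u: "u \<in> carrier (M \<boxtimes>\<^bsub>K\<^esub> N)" and c: "c \<in> carrier C" for u c
  proof -
    have "left_slice K (N \<boxtimes>\<^bsub>K\<^esub> C) d (tensor_assoc K M N C (pure K (M \<boxtimes>\<^bsub>K\<^esub> N) C u c)) =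
      tensor_lift K (N \<boxtimes>\<^bsub>K\<^esub> C) (\<lambda>l m. left_slice K (N \<boxtimes>\<^bsub>K\<^esub> C) d (pure K M (N \<boxtimes>\<^bsub>K\<^esub> C) l (pure K N C m c))) u"
      unfolding tensor_assoc_pure[OF M(1-3) u c]
      by (rule linear_tensor_lift[OF M(1,2) tensor_module[OF M(1) NC] NC tensor_assoc_inner[OF M(1-3) c] slC u])
    also have "\<dots> = tensor_lift K (N \<boxtimes>\<^bsub>K\<^esub> C) (\<lambda>l m. pure K N C (d l \<odot>\<^bsub>N\<^esub> m) c) u"
    proof (rule tensor_lift_cong[OF M(1,2) NC _ _ _ u])
      show "bilinear K M N (N \<boxtimes>\<^bsub>K\<^esub> C) (\<lambda>l m. left_slice K (N \<boxtimes>\<^bsub>K\<^esub> C) d (pure K M (N \<boxtimes>\<^bsub>K\<^esub> C) l (pure K N C m c)))"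
        by (rule bilinear_comp[OF tensor_assoc_inner[OF M(1-3) c] linear_ident linear_ident slC])
      show "bilinear K M N (N \<boxtimes>\<^bsub>K\<^esub> C) (\<lambda>l m. pure K N C (d l \<odot>\<^bsub>N\<^esub> m) c)"
        by (rule bilinear_comp[OF left_slice_bilinear[OF M(2) d] linear_ident linear_ident bilinear_left[OF pure_bilinear[OF M(2,3)] c]])
    next
      fix m n assume mn: "m \<in> carrier M" "n \<in> carrier N"
      then show "left_slice K (N \<boxtimes>\<^bsub>K\<^esub> C) d (pure K M (N \<boxtimes>\<^bsub>K\<^esub> C) m (pure K N C n c)) = pure K N C (d m \<odot>\<^bsub>N\<^esub> n) c"
        using left_slice_pure[OF M(1) NC d mn(1) pure_closed[OF M(2,3) mn(2) c]]
          linear_smult[OF bilinear_left[OF pure_bilinear[OF M(2,3)] c] linear_closed[OF d, simplified, OF mn(1)] mn(2)] by simp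
    qed
    also have "\<dots> = pure K N C (left_slice K N d u) c"
      unfolding left_slice_def
      by (rule linear_tensor_lift[symmetric, OF M(1,2,2) NC left_slice_bilinear[OF M(2) d]
        bilinear_left[OF pure_bilinear[OF M(2,3)] c] u])
    finally show ?thesis .
  qed
  show ?thesis
    by (rule tensor_linear_eqI[OF M(4,3) NC linear_comp[OF linear_comp[OF tensor_map_linear[OF M(4,3) MN M(3) h linear_id]
       tensor_assoc_linear[OF M(1-3)]] slC] tensor_map_linear[OF M(4,3,2,3) hs linear_id] _ t])
      (simp add: tensor_map_pure[OF M(4,3) MN M(3) h linear_id] tensor_map_pure[OF M(4,3,2,3) hs linear_id] 1 linear_closed[OF h])
qed

text \<open>Likewise, the next two lemmas apply \<open>d\<close> to the last tensor factor of the two sides of a left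
  colinearity condition.\<close>

lemma right_slice_tensor_map:
  assumes M: "module K C" "module K X" "module K Y" "module K M" and d: "d \<in> functionals K Y"
    and h: "h \<in> linear_maps K X (M \<boxtimes>\<^bsub>K\<^esub> Y)" and t: "t \<in> carrier (C \<boxtimes>\<^bsub>K\<^esub> X)"
  shows "tensor_map K C M id (right_slice K M d) (tensor_map K C (M \<boxtimes>\<^bsub>K\<^esub> Y) id h t) =
    tensor_map K C M id (\<lambda>x. right_slice K M d (h x)) t"
proof -
  note MY = tensor_module[OF M(4,3)]
  note sl = right_slice_linear[OF M(4,3) d]
  note hs = linear_comp[OF h sl]
  show ?thesis
    by (rule tensor_linear_eqI[OF M(1,2) tensor_module[OF M(1,4)] linear_comp[OF
        tensor_map_linear[OF M(1,2,1) MY linear_id h] tensor_map_linear[OF M(1) MY M(1,4) linear_id sl]]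
        tensor_map_linear[OF M(1,2,1,4) linear_id hs] _ t])
      (simp add: tensor_map_pure[OF M(1,2,1) MY linear_id h] tensor_map_pure[OF M(1) MY M(1,4) linear_id sl]
        tensor_map_pure[OF M(1,2,1,4) linear_id hs] linear_closed[OF h])
qed

lemma right_slice_assoc:
  assumes M: "module K C" "module K M" "module K X" "module K Y" and d: "d \<in> functionals K Y"
    and f: "f \<in> linear_maps K X (C \<boxtimes>\<^bsub>K\<^esub> M)" and t: "t \<in> carrier (X \<boxtimes>\<^bsub>K\<^esub> Y)"
  shows "tensor_map K C M id (right_slice K M d) (tensor_assoc K C M Y (tensor_map K (C \<boxtimes>\<^bsub>K\<^esub> M) Y f id t)) =
    f (right_slice K X d t)"
proof -
  note CM = tensor_module[OF M(1,2)] and MY = tensor_module[OF M(2,4)]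
  note sl = right_slice_linear[OF M(2,4) d] and slX = right_slice_linear[OF M(3,4) d]
  note ts = tensor_map_linear[OF M(1) MY M(1,2) linear_id sl]
  have 1: "tensor_map K C M id (right_slice K M d) (tensor_assoc K C M Y (pure K (C \<boxtimes>\<^bsub>K\<^esub> M) Y u y)) =
    d y \<odot>\<^bsub>C \<boxtimes>\<^bsub>K\<^esub> M\<^esub> u" if u: "u \<in> carrier (C \<boxtimes>\<^bsub>K\<^esub> M)" and y: "y \<in> carrier Y" for u y
  proof -
    note dy = linear_closed[OF d, simplified, OF y]
    show ?thesis
      unfolding tensor_assoc_pure[OF M(1,2,4) u y]
    proof (rule tensor_linear_eqI[OF M(1,2) CM _ _ _ u])
      show "(\<lambda>u. tensor_map K C M id (right_slice K M d) (tensor_lift K (C \<boxtimes>\<^bsub>K\<^esub> (M \<boxtimes>\<^bsub>K\<^esub> Y))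
        (\<lambda>l m. pure K C (M \<boxtimes>\<^bsub>K\<^esub> Y) l (pure K M Y m y)) u)) \<in> linear_maps K (C \<boxtimes>\<^bsub>K\<^esub> M) (C \<boxtimes>\<^bsub>K\<^esub> M)"
        by (rule linear_comp[OF tensor_lift_linear[OF M(1,2) tensor_module[OF M(1) MY] tensor_assoc_inner[OF M(1,2,4) y]] ts])
      show "(\<odot>\<^bsub>C \<boxtimes>\<^bsub>K\<^esub> M\<^esub>) (d y) \<in> linear_maps K (C \<boxtimes>\<^bsub>K\<^esub> M) (C \<boxtimes>\<^bsub>K\<^esub> M)"
        using linear_scale[OF CM linear_ident dy] .
      fix c m assume "c \<in> carrier C" "m \<in> carrier M"
      then show "tensor_map K C M id (right_slice K M d) (tensor_lift K (C \<boxtimes>\<^bsub>K\<^esub> (M \<boxtimes>\<^bsub>K\<^esub> Y))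
        (\<lambda>l m. pure K C (M \<boxtimes>\<^bsub>K\<^esub> Y) l (pure K M Y m y)) (pure K C M c m)) = d y \<odot>\<^bsub>C \<boxtimes>\<^bsub>K\<^esub> M\<^esub> pure K C M c m"
        using y dy by (simp add: tensor_lift_pure[OF M(1,2) tensor_module[OF M(1) MY] tensor_assoc_inner[OF M(1,2,4) y]]
          tensor_map_pure[OF M(1) MY M(1,2) linear_id sl] pure_closed[OF M(2,4)] right_slice_pure[OF M(2,4) d]
          linear_smult[OF bilinear_right[OF pure_bilinear[OF M(1,2)]]])
    qed
  qed
  show ?thesis
    by (rule tensor_linear_eqI[OF M(3,4) CM linear_comp[OF linear_comp[OF tensor_map_linear[OF M(3,4) CM M(4) f linear_id]
        tensor_assoc_linear[OF M(1,2,4)]] ts] linear_comp[OF slX f] _ t])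
      (simp add: tensor_map_pure[OF M(3,4) CM M(4) f linear_id] 1 linear_closed[OF f] right_slice_pure[OF M(3,4) d]
        linear_smult[OF f] linear_closed[OF d, simplified])
qed

section \<open>Expansions along a basis\<close>

lemma basis_closed: "\<lbrakk>basis K M I b; i \<in> I\<rbrakk> \<Longrightarrow> b i \<in> carrier M"
  by (auto simp: basis_def)

lemma basis_spanE:
  assumes "basis K M I b" "x \<in> carrier M"
  obtains F a where "finite F" "F \<subseteq> I" "a \<in> F \<rightarrow> carrier K" "x = (\<Oplus>\<^bsub>M\<^esub>j\<in>F. a j \<odot>\<^bsub>M\<^esub> b j)"
  using bspec[OF assms(1)[unfolded basis_def, THEN conjunct2, THEN conjunct2] assms(2)] by metis

lemma basis_independent:
  assumes "basis K M I b" "finite F" "F \<subseteq> I" "a \<in> F \<rightarrow> carrier K" "(\<Oplus>\<^bsub>M\<^esub>j\<in>F. a j \<odot>\<^bsub>M\<^esub> b j) = \<zero>\<^bsub>M\<^esub>" "i \<in> F"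
  shows "a i = \<zero>\<^bsub>K\<^esub>"
  using assms(1)[unfolded basis_def, THEN conjunct2, THEN conjunct1, rule_format, of F a i] assms(2-6) by simp

lemma basis_coefficients:
  assumes M: "module K M" and b: "basis K M I b" and d: "dual_family K M I b d"
    and F: "finite F" "F \<subseteq> I" "a \<in> F \<rightarrow> carrier K" and i: "i \<in> I"
  shows "d i (\<Oplus>\<^bsub>M\<^esub>j\<in>F. a j \<odot>\<^bsub>M\<^esub> b j) = (if i \<in> F then a i else \<zero>\<^bsub>K\<^esub>)"
proof -
  let ?R = "regular_module K (carrier K)"
  interpret M: module K M by (rule M)
  interpret R: module K ?R by (rule regular_module_module[OF module_cring[OF M]])
  have di: "d i \<in> functionals K M" and dij: "\<And>j. j \<in> I \<Longrightarrow> d i (b j) = (if i = j then \<one>\<^bsub>K\<^esub> else \<zero>\<^bsub>K\<^esub>)"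
    using d i by (auto simp: dual_family_def)
  have a: "a j \<in> carrier K" "b j \<in> carrier M" "j \<in> I" if "j \<in> F" for j
    using F that basis_closed[OF b] by auto
  have "d i (\<Oplus>\<^bsub>M\<^esub>j\<in>F. a j \<odot>\<^bsub>M\<^esub> b j) = (\<Oplus>\<^bsub>?R\<^esub>j\<in>F. d i (a j \<odot>\<^bsub>M\<^esub> b j))"
    by (rule linear_finsum[OF di M.abelian_group_axioms R.abelian_group_axioms F(1)]) (use a in auto)
  also have "\<dots> = (\<Oplus>\<^bsub>?R\<^esub>j\<in>F. if i = j then a j else \<zero>\<^bsub>?R\<^esub>)"
    by (rule R.finsum_cong') (use a in \<open>auto simp: linear_smult[OF di] dij\<close>)
  also have "\<dots> = (if i \<in> F then a i else \<zero>\<^bsub>K\<^esub>)"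
  proof (cases "i \<in> F")
    case True
    then show ?thesis using R.add.finprod_singleton[OF True F(1), of a] F(3) by (simp cong: if_cong)
  next
    case False
    then have "(\<Oplus>\<^bsub>?R\<^esub>j\<in>F. if i = j then a j else \<zero>\<^bsub>?R\<^esub>) = (\<Oplus>\<^bsub>?R\<^esub>j\<in>F. \<zero>\<^bsub>?R\<^esub>)"
      by (intro R.finsum_cong') auto
    also have "\<dots> = \<zero>\<^bsub>K\<^esub>" by (subst R.finsum_zero) simp
    finally show ?thesis using False by simp
  qed
  finally show ?thesis .
qed

lemma basis_finite_support:
  assumes M: "module K M" and b: "basis K M I b" and d: "dual_family K M I b d" and x: "x \<in> carrier M"
  shows "finite {i \<in> I. d i x \<noteq> \<zero>\<^bsub>K\<^esub>}"
proof -
  obtain F a where F: "finite F" "F \<subseteq> I" "a \<in> F \<rightarrow> carrier K" "x = (\<Oplus>\<^bsub>M\<^esub>j\<in>F. a j \<odot>\<^bsub>M\<^esub> b j)"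
    by (rule basis_spanE[OF b x])
  have "{i \<in> I. d i x \<noteq> \<zero>\<^bsub>K\<^esub>} \<subseteq> F"
    using basis_coefficients[OF M b d F(1-3)] F(4) by (auto split: if_splits)
  then show ?thesis using F(1) finite_subset by blast
qed

lemma basis_expansion:
  assumes M: "module K M" and b: "basis K M I b" and d: "dual_family K M I b d" and x: "x \<in> carrier M"
    and A: "finite A" "A \<subseteq> I" "\<And>i. \<lbrakk>i \<in> I; d i x \<noteq> \<zero>\<^bsub>K\<^esub>\<rbrakk> \<Longrightarrow> i \<in> A"
  shows "(\<Oplus>\<^bsub>M\<^esub>i\<in>A. d i x \<odot>\<^bsub>M\<^esub> b i) = x"
proof -
  interpret M: module K M by (rule M)
  obtain F a where F: "finite F" "F \<subseteq> I" "a \<in> F \<rightarrow> carrier K" "x = (\<Oplus>\<^bsub>M\<^esub>j\<in>F. a j \<odot>\<^bsub>M\<^esub> b j)"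
    by (rule basis_spanE[OF b x])
  have dx: "d i x = (if i \<in> F then a i else \<zero>\<^bsub>K\<^esub>)" if "i \<in> I" for i
    using basis_coefficients[OF M b d F(1-3) that] F(4) by simp
  have dc: "d i x \<in> carrier K" "b i \<in> carrier M" if "i \<in> I" for i
    using dx[OF that] F(3) basis_closed[OF b that] by auto
  have "(\<Oplus>\<^bsub>M\<^esub>i\<in>A. d i x \<odot>\<^bsub>M\<^esub> b i) = (\<Oplus>\<^bsub>M\<^esub>i\<in>A \<union> F. d i x \<odot>\<^bsub>M\<^esub> b i)"
  proof (rule M.add.finprod_mono_neutral_cong_left)
    show "d i x \<odot>\<^bsub>M\<^esub> b i = \<zero>\<^bsub>M\<^esub>" if "i \<in> A \<union> F - A" for i
    proof -
      have "i \<in> I" "d i x = \<zero>\<^bsub>K\<^esub>" using that F(2) A(3) by auto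
      then show ?thesis using dc(2) by simp
    qed
  qed (use A F dc in auto)
  also have "\<dots> = (\<Oplus>\<^bsub>M\<^esub>i\<in>F. a i \<odot>\<^bsub>M\<^esub> b i)"
  proof (rule M.add.finprod_mono_neutral_cong_right)
    show "d i x \<odot>\<^bsub>M\<^esub> b i = \<zero>\<^bsub>M\<^esub>" if "i \<in> A \<union> F - F" for i
    proof -
      have "i \<in> I" "d i x = \<zero>\<^bsub>K\<^esub>" using that A(2) dx by auto
      then show ?thesis using dc(2) by simp
    qed
    show "d i x \<odot>\<^bsub>M\<^esub> b i = a i \<odot>\<^bsub>M\<^esub> b i" if "i \<in> F" for i
      using that dx F(2) by auto
  qed (use A F dc in auto)
  finally show ?thesis using F(4) by simp
qed

text \<open>Coordinates exist because the basis spans, and they are linear because they are unique.\<close>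

lemma finite_basis_dual:
  assumes M: "module K M" and b: "basis K M I b" and I: "finite I"
  obtains d where "dual_family K M I b d"
proof -
  interpret M: module K M by (rule M)
  let ?s = "\<lambda>a. \<Oplus>\<^bsub>M\<^esub>i\<in>I. a i \<odot>\<^bsub>M\<^esub> b i"
  note bc = basis_closed[OF b]
  have ex: "\<exists>a. a \<in> I \<rightarrow> carrier K \<and> x = ?s a" if x: "x \<in> carrier M" for x
  proof -
    obtain F a where F: "finite F" "F \<subseteq> I" "a \<in> F \<rightarrow> carrier K" "x = (\<Oplus>\<^bsub>M\<^esub>j\<in>F. a j \<odot>\<^bsub>M\<^esub> b j)"
      by (rule basis_spanE[OF b x])
    let ?a = "\<lambda>i. if i \<in> F then a i else \<zero>\<^bsub>K\<^esub>"
    have "x = ?s ?a"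
      unfolding F(4) by (rule M.add.finprod_mono_neutral_cong_left) (use F I bc in \<open>auto simp: Pi_iff\<close>)
    moreover have "?a \<in> I \<rightarrow> carrier K" using F(3) by auto
    ultimately show ?thesis by blast
  qed
  have plus: "?s (\<lambda>i. a i \<oplus>\<^bsub>K\<^esub> a' i) = ?s a \<oplus>\<^bsub>M\<^esub> ?s a'"
    if "a \<in> I \<rightarrow> carrier K" "a' \<in> I \<rightarrow> carrier K" for a a'
  proof -
    have "?s (\<lambda>i. a i \<oplus>\<^bsub>K\<^esub> a' i) = (\<Oplus>\<^bsub>M\<^esub>i\<in>I. a i \<odot>\<^bsub>M\<^esub> b i \<oplus>\<^bsub>M\<^esub> a' i \<odot>\<^bsub>M\<^esub> b i)"
      by (rule M.finsum_cong') (use that bc in \<open>auto simp: M.smult_l_distr Pi_iff\<close>)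
    then show ?thesis using that bc by (subst M.finsum_addf[symmetric]) auto
  qed
  have scale: "?s (\<lambda>i. r \<otimes>\<^bsub>K\<^esub> a i) = r \<odot>\<^bsub>M\<^esub> ?s a"
    if "a \<in> I \<rightarrow> carrier K" "r \<in> carrier K" for a r
  proof -
    have "?s (\<lambda>i. r \<otimes>\<^bsub>K\<^esub> a i) = (\<Oplus>\<^bsub>M\<^esub>i\<in>I. r \<odot>\<^bsub>M\<^esub> (a i \<odot>\<^bsub>M\<^esub> b i))"
      by (rule M.finsum_cong') (use that bc in \<open>auto simp: M.smult_assoc1 Pi_iff\<close>)
    then show ?thesis using that bc I by (subst M.finsum_smult_ldistr) auto
  qed
  have uniq: "a i = a' i"
    if a: "a \<in> I \<rightarrow> carrier K" "a' \<in> I \<rightarrow> carrier K" and eq: "?s a = ?s a'" and i: "i \<in> I" for a a' i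
  proof -
    let ?c = "\<lambda>i. a i \<oplus>\<^bsub>K\<^esub> \<ominus>\<^bsub>K\<^esub> \<one>\<^bsub>K\<^esub> \<otimes>\<^bsub>K\<^esub> a' i"
    have n: "\<ominus>\<^bsub>K\<^esub> \<one>\<^bsub>K\<^esub> \<in> carrier K" by simp
    have cl: "?s a' \<in> carrier M" using a bc by (intro M.finsum_closed) auto
    have "?s ?c = ?s a \<oplus>\<^bsub>M\<^esub> (\<ominus>\<^bsub>K\<^esub> \<one>\<^bsub>K\<^esub>) \<odot>\<^bsub>M\<^esub> ?s a'"
      using plus[of a "\<lambda>i. \<ominus>\<^bsub>K\<^esub> \<one>\<^bsub>K\<^esub> \<otimes>\<^bsub>K\<^esub> a' i"] scale[OF a(2) n] a by (auto simp: Pi_iff)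
    also have "\<dots> = \<zero>\<^bsub>M\<^esub>"
      using cl by (simp add: eq M.smult_l_minus M.r_neg)
    finally have "?s ?c = \<zero>\<^bsub>M\<^esub>" .
    moreover have "?c \<in> I \<rightarrow> carrier K" using a by auto
    ultimately have "?c i = \<zero>\<^bsub>K\<^esub>" using basis_independent[OF b I subset_refl _ _ i] by simp
    moreover have "a i \<in> carrier K" "a' i \<in> carrier K" using a i by auto
    ultimately show ?thesis
      using M.R.minus_equality[of "a i" "\<ominus>\<^bsub>K\<^esub> a' i"] by (simp add: M.R.l_minus M.R.a_comm)
  qed
  define co where "co x = (SOME a. a \<in> I \<rightarrow> carrier K \<and> x = ?s a)" for x
  have co: "co x \<in> I \<rightarrow> carrier K" "?s (co x) = x" if "x \<in> carrier M" for x
    using someI_ex[OF ex[OF that]] by (auto simp: co_def)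
  have coI: "co x i = a i" if "a \<in> I \<rightarrow> carrier K" "x = ?s a" "i \<in> I" for x a i
  proof -
    have x: "x \<in> carrier M" using that bc by (auto intro!: M.finsum_closed)
    show ?thesis by (rule uniq[OF co(1)[OF x] that(1) trans[OF co(2)[OF x] that(2)] that(3)])
  qed
  have "dual_family K M I b (\<lambda>i x. co x i)"
    unfolding dual_family_def
  proof (intro ballI conjI)
    fix i assume i: "i \<in> I"
    show "(\<lambda>x. co x i) \<in> functionals K M"
    proof (rule linear_mapsI)
      fix x assume "x \<in> carrier M"
      then show "co x i \<in> carrier (regular_module K (carrier K))" using co(1) i by auto
    next
      fix x y assume xy: "x \<in> carrier M" "y \<in> carrier M"
      have "co (x \<oplus>\<^bsub>M\<^esub> y) i = co x i \<oplus>\<^bsub>K\<^esub> co y i"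
        using co(1)[OF xy(1)] co(1)[OF xy(2)] plus co(2) xy i by (intro coI) auto
      then show "co (x \<oplus>\<^bsub>M\<^esub> y) i = co x i \<oplus>\<^bsub>regular_module K (carrier K)\<^esub> co y i" by simp
    next
      fix r x assume rx: "r \<in> carrier K" "x \<in> carrier M"
      have "co (r \<odot>\<^bsub>M\<^esub> x) i = r \<otimes>\<^bsub>K\<^esub> co x i"
        using co(1)[OF rx(2)] scale co(2) rx i by (intro coI) auto
      then show "co (r \<odot>\<^bsub>M\<^esub> x) i = r \<odot>\<^bsub>regular_module K (carrier K)\<^esub> co x i" by simp
    qed
    fix j assume j: "j \<in> I"
    have "b j = (\<Oplus>\<^bsub>M\<^esub>i\<in>I. if j = i then b i else \<zero>\<^bsub>M\<^esub>)"
      by (subst M.add.finprod_singleton) (use j I bc in auto)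
    also have "\<dots> = (\<Oplus>\<^bsub>M\<^esub>i\<in>I. (if i = j then \<one>\<^bsub>K\<^esub> else \<zero>\<^bsub>K\<^esub>) \<odot>\<^bsub>M\<^esub> b i)"
      by (rule M.finsum_cong') (use bc in auto)
    finally show "co (b j) i = (if i = j then \<one>\<^bsub>K\<^esub> else \<zero>\<^bsub>K\<^esub>)"
      using i by (intro coI) auto
  qed
  then show thesis by (rule that)
qed

lemma dual_functional: "\<lbrakk>dual_family K M I b d; i \<in> I\<rbrakk> \<Longrightarrow> d i \<in> functionals K M"
  by (simp add: dual_family_def)

text \<open>A tensor is a finite sum of pure tensors \<open>x \<otimes> y\<close>, and \<open>S\<close> collects the finitely many basis indices
  occurring in the first factors \<open>x\<close>.  Enlarging the index set beyond \<open>S\<close> is allowed for so that the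
  expansions of all summands can be taken over one set.\<close>

lemma tensor_slices_finite_support:
  fixes M :: "('k, 'm) module" and N :: "('k, 'n) module"
  assumes M: "module K M" and N: "module K N" and b: "basis K M I b" and d: "dual_family K M I b d"
    and t: "t \<in> carrier (M \<boxtimes>\<^bsub>K\<^esub> N)"
  shows "\<exists>S. finite S \<and> S \<subseteq> I \<and> (\<forall>i\<in>I - S. left_slice K N (d i) t = \<zero>\<^bsub>N\<^esub>) \<and>
     (\<forall>A. finite A \<and> S \<subseteq> A \<and> A \<subseteq> I \<longrightarrow> (\<Oplus>\<^bsub>M \<boxtimes>\<^bsub>K\<^esub> N\<^esub>i\<in>A. pure K M N (b i) (left_slice K N (d i) t)) = t)"
proof -
  note MN = tensor_module[OF M N]
  interpret M: module K M by (rule M)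
  interpret N: module K N by (rule N)
  interpret T: module K "M \<boxtimes>\<^bsub>K\<^esub> N" by (rule MN)
  note dl = linear_closed[OF dual_functional[OF d], simplified]
  note bc = basis_closed[OF b]
  obtain Z :: "('m \<times> 'n) set" and x y where Z: "finite Z" "x \<in> Z \<rightarrow> carrier M" "y \<in> Z \<rightarrow> carrier N"
    and t_eq: "t = (\<Oplus>\<^bsub>M \<boxtimes>\<^bsub>K\<^esub> N\<^esub>z\<in>Z. pure K M N (x z) (y z))"
    by (rule tensor_finite_sum[OF M N t])
  have xy: "x z \<in> carrier M" "y z \<in> carrier N" if "z \<in> Z" for z using Z that by auto
  have pc: "(\<lambda>z. pure K M N (x z) (y z)) \<in> Z \<rightarrow> carrier (M \<boxtimes>\<^bsub>K\<^esub> N)"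
    using xy by (auto intro: pure_closed[OF M N])
  let ?S = "\<Union>z\<in>Z. {i \<in> I. d i (x z) \<noteq> \<zero>\<^bsub>K\<^esub>}"
  have finS: "finite ?S"
    using Z(1) by (auto intro!: basis_finite_support[OF M b d] xy)
  have zero: "left_slice K N (d i) t = \<zero>\<^bsub>N\<^esub>" if i: "i \<in> I - ?S" for i
  proof -
    note di = dual_functional[OF d, of i]
    have "left_slice K N (d i) t = (\<Oplus>\<^bsub>N\<^esub>z\<in>Z. left_slice K N (d i) (pure K M N (x z) (y z)))"
      unfolding t_eq using i
      by (intro linear_finsum[OF left_slice_linear[OF M N di] T.abelian_group_axioms N.abelian_group_axioms Z(1) pc]) simp
    also have "\<dots> = (\<Oplus>\<^bsub>N\<^esub>z\<in>Z. \<zero>\<^bsub>N\<^esub>)"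
      by (rule N.finsum_cong') (use i xy in \<open>auto simp: left_slice_pure[OF M N di]\<close>)
    finally show ?thesis by simp
  qed
  have expand: "(\<Oplus>\<^bsub>M \<boxtimes>\<^bsub>K\<^esub> N\<^esub>i\<in>A. pure K M N (b i) (left_slice K N (d i) t)) = t"
    if A: "finite A" "?S \<subseteq> A" "A \<subseteq> I" for A
  proof -
    let ?h = "\<lambda>t. \<Oplus>\<^bsub>M \<boxtimes>\<^bsub>K\<^esub> N\<^esub>i\<in>A. pure K M N (b i) (left_slice K N (d i) t)"
    have h: "?h \<in> linear_maps K (M \<boxtimes>\<^bsub>K\<^esub> N) (M \<boxtimes>\<^bsub>K\<^esub> N)"
    proof (rule linear_sum[OF MN MN A(1)])
      fix i assume "i \<in> A"
      then have "i \<in> I" using A(3) by blast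
      show "(\<lambda>t. pure K M N (b i) (left_slice K N (d i) t)) \<in> linear_maps K (M \<boxtimes>\<^bsub>K\<^esub> N) (M \<boxtimes>\<^bsub>K\<^esub> N)"
        by (rule linear_comp[OF left_slice_linear[OF M N dual_functional[OF d \<open>i \<in> I\<close>]]
          bilinear_right[OF pure_bilinear[OF M N] bc[OF \<open>i \<in> I\<close>]]])
    qed
    have hp: "?h (pure K M N (x z) (y z)) = pure K M N (x z) (y z)" if z: "z \<in> Z" for z
    proof -
      note pl = bilinear_left[OF pure_bilinear[OF M N] xy(2)[OF z]]
      have AI: "i \<in> I" if "i \<in> A" for i using A(3) that by blast
      have "?h (pure K M N (x z) (y z)) = (\<Oplus>\<^bsub>M \<boxtimes>\<^bsub>K\<^esub> N\<^esub>i\<in>A. pure K M N (d i (x z) \<odot>\<^bsub>M\<^esub> b i) (y z))"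
        by (rule T.finsum_cong')
          (auto dest!: AI intro!: pure_closed[OF M N] simp: xy[OF z] bc dl left_slice_pure[OF M N dual_functional[OF d]] linear_smult[OF pl]
            linear_smult[OF bilinear_right[OF pure_bilinear[OF M N]]])
      also have "\<dots> = pure K M N (\<Oplus>\<^bsub>M\<^esub>i\<in>A. d i (x z) \<odot>\<^bsub>M\<^esub> b i) (y z)"
        by (rule linear_finsum[symmetric, OF pl M.abelian_group_axioms T.abelian_group_axioms A(1)])
          (auto dest!: AI simp: xy[OF z] bc dl)
      also have "(\<Oplus>\<^bsub>M\<^esub>i\<in>A. d i (x z) \<odot>\<^bsub>M\<^esub> b i) = x z"
        by (rule basis_expansion[OF M b d xy(1)[OF z] A(1,3)]) (use z A(2) in auto)
      finally show ?thesis .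
    qed
    have "?h t = (\<Oplus>\<^bsub>M \<boxtimes>\<^bsub>K\<^esub> N\<^esub>z\<in>Z. ?h (pure K M N (x z) (y z)))"
      using linear_finsum[OF h T.abelian_group_axioms T.abelian_group_axioms Z(1) pc] by (simp add: t_eq)
    also have "\<dots> = t"
      unfolding t_eq by (rule T.finsum_cong') (use pc hp in auto)
    finally show ?thesis .
  qed
  show ?thesis using finS zero expand by (intro exI[of _ ?S]) auto
qed

lemma left_slices_finite:
  assumes M: "module K M" and N: "module K N" and b: "basis K M I b" and d: "dual_family K M I b d"
    and t: "t \<in> carrier (M \<boxtimes>\<^bsub>K\<^esub> N)"
  shows "finite {i \<in> I. left_slice K N (d i) t \<noteq> \<zero>\<^bsub>N\<^esub>}"
proof -
  obtain S where S: "finite S" "\<forall>i\<in>I - S. left_slice K N (d i) t = \<zero>\<^bsub>N\<^esub>"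
    using tensor_slices_finite_support[OF assms] by blast
  show ?thesis by (rule finite_subset[OF _ S(1)]) (use S(2) in auto)
qed

lemma left_slices_expand:
  assumes M: "module K M" and N: "module K N" and b: "basis K M I b" and d: "dual_family K M I b d"
    and t: "t \<in> carrier (M \<boxtimes>\<^bsub>K\<^esub> N)"
    and A: "finite A" "A \<subseteq> I" "\<And>i. \<lbrakk>i \<in> I; left_slice K N (d i) t \<noteq> \<zero>\<^bsub>N\<^esub>\<rbrakk> \<Longrightarrow> i \<in> A"
  shows "(\<Oplus>\<^bsub>M \<boxtimes>\<^bsub>K\<^esub> N\<^esub>i\<in>A. pure K M N (b i) (left_slice K N (d i) t)) = t"
proof -
  interpret T: module K "M \<boxtimes>\<^bsub>K\<^esub> N" by (rule tensor_module[OF M N])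
  interpret M: module K M by (rule M)
  interpret N: module K N by (rule N)
  obtain S where S: "finite S" "S \<subseteq> I" and
    e: "\<forall>A. finite A \<and> S \<subseteq> A \<and> A \<subseteq> I \<longrightarrow> (\<Oplus>\<^bsub>M \<boxtimes>\<^bsub>K\<^esub> N\<^esub>i\<in>A. pure K M N (b i) (left_slice K N (d i) t)) = t"
    using tensor_slices_finite_support[OF M N b d t] by blast
  have c: "pure K M N (b i) (left_slice K N (d i) t) \<in> carrier (M \<boxtimes>\<^bsub>K\<^esub> N)" if "i \<in> I" for i
    by (rule pure_closed[OF M N basis_closed[OF b that] linear_closed[OF left_slice_linear[OF M N dual_functional[OF d that]] t]])
  have "(\<Oplus>\<^bsub>M \<boxtimes>\<^bsub>K\<^esub> N\<^esub>i\<in>A. pure K M N (b i) (left_slice K N (d i) t)) =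
     (\<Oplus>\<^bsub>M \<boxtimes>\<^bsub>K\<^esub> N\<^esub>i\<in>A \<union> S. pure K M N (b i) (left_slice K N (d i) t))"
  proof (rule T.add.finprod_mono_neutral_cong_left)
    show "pure K M N (b i) (left_slice K N (d i) t) = \<zero>\<^bsub>M \<boxtimes>\<^bsub>K\<^esub> N\<^esub>" if "i \<in> A \<union> S - A" for i
    proof -
      have i: "i \<in> I" "left_slice K N (d i) t = \<zero>\<^bsub>N\<^esub>" using that S(2) A(3) by auto
      show ?thesis
        unfolding i(2) by (rule linear_zero[OF bilinear_right[OF pure_bilinear[OF M N] basis_closed[OF b i(1)]]
          N.abelian_group_axioms T.abelian_group_axioms])
    qed
  qed (use A S c in auto)
  also have "\<dots> = t" using e A S by auto
  finally show ?thesis .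
qed

text \<open>Obtained from the expansion by left slices along the flip of the tensor factors.\<close>

lemma right_slices_expand:
  assumes M: "module K M" and N: "module K N" and b: "basis K M I b" and d: "dual_family K M I b d"
    and t: "t \<in> carrier (N \<boxtimes>\<^bsub>K\<^esub> M)"
  obtains A where "finite A" "A \<subseteq> I"
    "t = (\<Oplus>\<^bsub>N \<boxtimes>\<^bsub>K\<^esub> M\<^esub>i\<in>A. pure K N M (right_slice K N (d i) t) (b i))"
proof -
  let ?f = "tensor_lift K (M \<boxtimes>\<^bsub>K\<^esub> N) (\<lambda>n m. pure K M N m n)" and ?g = "tensor_lift K (N \<boxtimes>\<^bsub>K\<^esub> M) (\<lambda>m n. pure K N M n m)"
  note MN = tensor_module[OF M N] and NM = tensor_module[OF N M]
  interpret MN: module K "M \<boxtimes>\<^bsub>K\<^esub> N" by (rule MN)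
  interpret NM: module K "N \<boxtimes>\<^bsub>K\<^esub> M" by (rule NM)
  have bf: "bilinear K N M (M \<boxtimes>\<^bsub>K\<^esub> N) (\<lambda>n m. pure K M N m n)"
    and bg: "bilinear K M N (N \<boxtimes>\<^bsub>K\<^esub> M) (\<lambda>m n. pure K N M n m)"
    using pure_bilinear[OF M N] pure_bilinear[OF N M] by (simp_all add: bilinear_def)
  note f = tensor_lift_linear[OF N M MN bf] and fp = tensor_lift_pure[OF N M MN bf]
  note g = tensor_lift_linear[OF M N NM bg] and gp = tensor_lift_pure[OF M N NM bg]
  note ft = linear_closed[OF f t]
  have gf: "?g (?f t) = t"
    by (rule tensor_linear_eqI[OF N M NM linear_comp[OF f g] linear_ident _ t]) (simp add: fp gp)
  have sl: "left_slice K N (d i) (?f t) = right_slice K N (d i) t" if i: "i \<in> I" for i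
  proof -
    note di = dual_functional[OF d i]
    show ?thesis
      by (rule tensor_linear_eqI[OF N M N linear_comp[OF f left_slice_linear[OF M N di]] right_slice_linear[OF N M di] _ t])
        (simp add: fp left_slice_pure[OF M N di] right_slice_pure[OF N M di])
  qed
  let ?A = "{i \<in> I. left_slice K N (d i) (?f t) \<noteq> \<zero>\<^bsub>N\<^esub>}"
  have A: "finite ?A" by (rule left_slices_finite[OF M N b d ft])
  have e: "(\<Oplus>\<^bsub>M \<boxtimes>\<^bsub>K\<^esub> N\<^esub>i\<in>?A. pure K M N (b i) (left_slice K N (d i) (?f t))) = ?f t"
    by (rule left_slices_expand[OF M N b d ft A]) auto
  have c: "b i \<in> carrier M" "right_slice K N (d i) t \<in> carrier N" if "i \<in> I" for i
    using linear_closed[OF right_slice_linear[OF N M dual_functional[OF d that]] t] basis_closed[OF b that] by auto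
  have "t = (\<Oplus>\<^bsub>N \<boxtimes>\<^bsub>K\<^esub> M\<^esub>i\<in>?A. ?g (pure K M N (b i) (left_slice K N (d i) (?f t))))"
    using linear_finsum[OF g MN.abelian_group_axioms NM.abelian_group_axioms A, of "\<lambda>i. pure K M N (b i) (left_slice K N (d i) (?f t))"] c
    unfolding e gf by (auto simp: sl pure_closed[OF M N])
  also have "\<dots> = (\<Oplus>\<^bsub>N \<boxtimes>\<^bsub>K\<^esub> M\<^esub>i\<in>?A. pure K N M (right_slice K N (d i) t) (b i))"
    by (rule NM.finsum_cong') (auto simp: sl gp c intro!: pure_closed[OF N M])
  finally show thesis using that[OF A] by blast
qed

section \<open>Colinear maps\<close>

text \<open>Both the maps \<open>r\<^sub>\<mu>\<close> cut out of a strong connection and the coefficient maps of a corepresentation,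
  cut out of its coaction, arise in this way.  Colinearity survives because the coaction of \<open>M \<otimes> N\<close> only involves the second
  factor, while the functional only sees the first.\<close>

lemma left_slice_colinear:
  assumes M: "module K M" "module K N" "module K C" "module K X" and d: "d \<in> functionals K M"
    and h: "h \<in> linear_maps K X (M \<boxtimes>\<^bsub>K\<^esub> N)" and \<rho>X: "\<rho>X \<in> linear_maps K X (X \<boxtimes>\<^bsub>K\<^esub> C)"
    and \<rho>N: "\<rho>N \<in> linear_maps K N (N \<boxtimes>\<^bsub>K\<^esub> C)"
    and eq: "\<And>x. x \<in> carrier X \<Longrightarrow> tensor_map K M (N \<boxtimes>\<^bsub>K\<^esub> C) id \<rho>N (h x) =
      tensor_assoc K M N C (tensor_map K (M \<boxtimes>\<^bsub>K\<^esub> N) C h id (\<rho>X x))"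
  shows "(\<lambda>x. left_slice K N d (h x)) \<in> colinear_maps K C X \<rho>X N \<rho>N"
proof -
  have "\<rho>N (left_slice K N d (h x)) = tensor_map K N C (\<lambda>x. left_slice K N d (h x)) id (\<rho>X x)" if x: "x \<in> carrier X" for x
    unfolding left_slice_tensor_map[symmetric, OF M(1,2) tensor_module[OF M(2,3)] d \<rho>N linear_closed[OF h x]] eq[OF x]
    by (rule left_slice_assoc[OF M d h linear_closed[OF \<rho>X x]])
  then show ?thesis
    using linear_comp[OF h left_slice_linear[OF M(1,2) d]] by (simp add: colinear_maps_def)
qed

lemma tensor_map_cong:
  assumes M: "module K M" "module K N" "module K A" and f: "f \<in> linear_maps K M A"
    and eq: "\<And>m. m \<in> carrier M \<Longrightarrow> f' m = f m" and t: "t \<in> carrier (M \<boxtimes>\<^bsub>K\<^esub> N)"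
  shows "tensor_map K A N f' id t = tensor_map K A N f id t"
proof -
  have f': "f' \<in> linear_maps K M A" by (rule linear_cong[OF M(1) f eq])
  show ?thesis
    by (rule tensor_linear_eqI[OF M(1,2) tensor_module[OF M(3,2)] tensor_map_linear[OF M(1,2,3,2) f' linear_id]
      tensor_map_linear[OF M(1,2,3,2) f linear_id] _ t])
      (simp add: tensor_map_pure[OF M(1,2,3,2) f' linear_id] tensor_map_pure[OF M(1,2,3,2) f linear_id] eq)
qed

lemma colinear_comp:
  assumes M: "module K L" "module K M" "module K N" "module K C"
    and f: "f \<in> colinear_maps K C L \<rho>L M \<rho>M" and g: "g \<in> colinear_maps K C M \<rho>M N \<rho>N"
    and \<rho>: "\<rho>L \<in> linear_maps K L (L \<boxtimes>\<^bsub>K\<^esub> C)"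
  shows "(\<lambda>x. g (f x)) \<in> colinear_maps K C L \<rho>L N \<rho>N"
proof -
  have fl: "f \<in> linear_maps K L M" and gl: "g \<in> linear_maps K M N"
    and fr: "\<And>x. x \<in> carrier L \<Longrightarrow> \<rho>M (f x) = tensor_map K M C f id (\<rho>L x)"
    and gr: "\<And>x. x \<in> carrier M \<Longrightarrow> \<rho>N (g x) = tensor_map K N C g id (\<rho>M x)"
    using f g by (simp_all add: colinear_maps_def)
  have "tensor_map K N C g id (tensor_map K M C f id t) = tensor_map K N C (\<lambda>x. g (f x)) id t"
    if t: "t \<in> carrier (L \<boxtimes>\<^bsub>K\<^esub> C)" for t
    by (rule tensor_linear_eqI[OF M(1,4) tensor_module[OF M(3,4)] linear_comp[OF tensor_map_linear[OF M(1,4,2,4) fl linear_id]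
        tensor_map_linear[OF M(2,4,3,4) gl linear_id]] tensor_map_linear[OF M(1,4,3,4) linear_comp[OF fl gl] linear_id] _ t])
      (simp add: tensor_map_pure[OF M(1,4,2,4) fl linear_id] tensor_map_pure[OF M(2,4,3,4) gl linear_id]
        tensor_map_pure[OF M(1,4,3,4) linear_comp[OF fl gl] linear_id] linear_closed[OF fl])
  then show ?thesis
    using linear_comp[OF fl gl] by (simp add: colinear_maps_def fr gr linear_closed[OF fl] linear_closed[OF \<rho>])
qed

section \<open>Finite sums\<close>

lemma (in abelian_monoid) finsum_Times:
  assumes A: "finite A" and B: "finite B" and g: "\<And>a b. \<lbrakk>a \<in> A; b \<in> B\<rbrakk> \<Longrightarrow> g a b \<in> carrier G"
  shows "(\<Oplus>b\<in>B. \<Oplus>a\<in>A. g a b) = (\<Oplus>z\<in>A \<times> B. g (fst z) (snd z))"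
  using B g
proof (induction B rule: finite_induct)
  case (insert b B)
  have 1: "(\<Oplus>z\<in>A \<times> {b}. g (fst z) (snd z)) = (\<Oplus>a\<in>A. g a b)"
  proof -
    have "(\<Oplus>z\<in>(\<lambda>a. (a, b)) ` A. g (fst z) (snd z)) = (\<Oplus>a\<in>A. g (fst (a, b)) (snd (a, b)))"
      by (rule finsum_reindex) (use insert.prems in \<open>auto simp: inj_on_def\<close>)
    moreover have "A \<times> {b} = (\<lambda>a. (a, b)) ` A" by auto
    ultimately show ?thesis by simp
  qed
  have "A \<times> insert b B = A \<times> {b} \<union> A \<times> B" by auto
  then have "(\<Oplus>z\<in>A \<times> insert b B. g (fst z) (snd z)) =
      (\<Oplus>z\<in>A \<times> {b}. g (fst z) (snd z)) \<oplus> (\<Oplus>z\<in>A \<times> B. g (fst z) (snd z))"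
    using A insert.hyps insert.prems by (simp only:) (rule finsum_Un_disjoint, auto)
  moreover have "(\<Oplus>a\<in>A. g a b) \<in> carrier G" "(\<lambda>b. \<Oplus>a\<in>A. g a b) \<in> B \<rightarrow> carrier G"
    using insert.prems by (auto intro!: finsum_closed)
  ultimately show ?case
    using insert 1 by simp
qed simp

lemma (in ring) finsum_subring:
  assumes S: "subring S R" and A: "finite A" "f \<in> A \<rightarrow> S"
  shows "(\<Oplus>\<^bsub>R\<lparr>carrier := S\<rparr>\<^esub>i\<in>A. f i) = (\<Oplus>i\<in>A. f i)"
proof -
  interpret S: ring "R\<lparr>carrier := S\<rparr>" by (rule subring_is_ring[OF S])
  have "S \<subseteq> carrier R" by (rule subringE(1)[OF S])
  with A show ?thesis
  proof (induction A rule: finite_induct)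
    case empty
    show ?case using S.finsum_empty[of f] by simp
  next
    case (insert x F)
    then have "f x \<in> S" "f \<in> F \<rightarrow> S" "f x \<in> carrier R" "f \<in> F \<rightarrow> carrier R" by auto
    then show ?case
      using insert S.finsum_insert[OF insert.hyps, of f] by simp
  qed
qed

section \<open>Modules of functions\<close>

lemma row_module_simps [simp]:
  "carrier (row_module R J) = J \<rightarrow>\<^sub>E carrier R" "\<zero>\<^bsub>row_module R J\<^esub> = (\<lambda>j\<in>J. \<zero>\<^bsub>R\<^esub>)"
  "x \<oplus>\<^bsub>row_module R J\<^esub> y = (\<lambda>j\<in>J. x j \<oplus>\<^bsub>R\<^esub> y j)" "b \<odot>\<^bsub>row_module R J\<^esub> x = (\<lambda>j\<in>J. b \<otimes>\<^bsub>R\<^esub> x j)"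
  by (simp_all add: row_module_def)

text \<open>Both the row space of a matrix over a subring and a space of colinear maps are closed under the
  pointwise operations inside a space of functions into the big ring.\<close>

lemma (in ring) function_module:
  assumes S: "subring S R" and N: "N \<subseteq> J \<rightarrow>\<^sub>E carrier R"
    and zero: "(\<lambda>j\<in>J. \<zero>) \<in> N"
    and add: "\<And>x y. \<lbrakk>x \<in> N; y \<in> N\<rbrakk> \<Longrightarrow> (\<lambda>j\<in>J. x j \<oplus> y j) \<in> N"
    and smult: "\<And>b x. \<lbrakk>b \<in> S; x \<in> N\<rbrakk> \<Longrightarrow> (\<lambda>j\<in>J. b \<otimes> x j) \<in> N"
  shows "left_module (R\<lparr>carrier := S\<rparr>) ((row_module R J)\<lparr>carrier := N\<rparr>)"
proof -
  note SR = subringE(1)[OF S] and S1 = subringE(3,5)[OF S]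
  have val: "x j \<in> carrier R" if "x \<in> N" "j \<in> J" for x j
    using that N by auto
  have ext: "x = y" if "x \<in> N" "y \<in> extensional J" "\<And>j. j \<in> J \<Longrightarrow> x j = y j" for x y
    using that N by (intro extensionalityI[of _ J]) (auto simp: PiE_def)
  have "abelian_group ((row_module R J)\<lparr>carrier := N\<rparr>)"
  proof (rule abelian_groupI)
    fix x assume x: "x \<in> carrier ((row_module R J)\<lparr>carrier := N\<rparr>)"
    have neg: "(\<lambda>j\<in>J. (\<ominus> \<one>) \<otimes> x j) \<in> N" using x S1 by (intro smult) auto
    have inv: "(\<lambda>j\<in>J. (\<ominus> \<one>) \<otimes> x j) \<oplus>\<^bsub>(row_module R J)\<lparr>carrier := N\<rparr>\<^esub> x = \<zero>\<^bsub>(row_module R J)\<lparr>carrier := N\<rparr>\<^esub>"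
      using x val by (auto simp: l_minus l_neg intro!: restrict_ext)
    show "\<exists>y\<in>carrier ((row_module R J)\<lparr>carrier := N\<rparr>). y \<oplus>\<^bsub>(row_module R J)\<lparr>carrier := N\<rparr>\<^esub> x = \<zero>\<^bsub>(row_module R J)\<lparr>carrier := N\<rparr>\<^esub>"
      by (rule bexI[where x = "\<lambda>j\<in>J. (\<ominus> \<one>) \<otimes> x j"]) (rule inv, simp add: neg)
    show "\<zero>\<^bsub>(row_module R J)\<lparr>carrier := N\<rparr>\<^esub> \<oplus>\<^bsub>(row_module R J)\<lparr>carrier := N\<rparr>\<^esub> x = x"
      using x val by (auto intro!: ext[symmetric])
  qed (use zero add val in \<open>auto intro!: restrict_ext simp: a_ac\<close>)
  then show ?thesis
    unfolding left_module_def
    using subring_is_ring[OF S] smult val SR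
    by (auto simp: subset_eq l_distr r_distr m_assoc intro!: restrict_ext ext[symmetric])
qed

section \<open>Multiplication in an algebra and its action on tensors\<close>

locale algebra_over_ring = unital_algebra K P
  for K :: "('k, 'x) ring_scheme" (structure) and P :: "('k, 'p) module" (structure)
begin

lemma alg_module: "module K P" ..

lemma mult_bilinear: "bilinear K P P P (mult P)"
  by (intro bilinearI linear_mapsI) (simp_all add: P.r_distr P.l_distr smult_mult_left smult_mult_right)

lemma left_mult_linear: "x \<in> carrier P \<Longrightarrow> (\<lambda>y. x \<otimes>\<^bsub>P\<^esub> y) \<in> linear_maps K P P"
  by (rule bilinear_right[OF mult_bilinear])

lemma right_mult_linear: "x \<in> carrier P \<Longrightarrow> (\<lambda>y. y \<otimes>\<^bsub>P\<^esub> x) \<in> linear_maps K P P"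
  by (rule bilinear_left[OF mult_bilinear])

lemma left_act_linear: "\<lbrakk>module K C; x \<in> carrier P\<rbrakk> \<Longrightarrow> left_act K P C x \<in> linear_maps K (P \<boxtimes>\<^bsub>K\<^esub> C) (P \<boxtimes>\<^bsub>K\<^esub> C)"
  unfolding left_act_def by (rule tensor_map_linear[OF alg_module _ alg_module _ left_mult_linear linear_id])

lemma left_act_pure: "\<lbrakk>module K C; x \<in> carrier P; y \<in> carrier P; c \<in> carrier C\<rbrakk> \<Longrightarrow>
    left_act K P C x (pure K P C y c) = pure K P C (x \<otimes>\<^bsub>P\<^esub> y) c"
  unfolding left_act_def by (simp add: tensor_map_pure[OF alg_module _ alg_module _ left_mult_linear linear_id])

lemma left_act_bilinear:
  assumes C: "module K C"
  shows "bilinear K P (P \<boxtimes>\<^bsub>K\<^esub> C) (P \<boxtimes>\<^bsub>K\<^esub> C) (left_act K P C)"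
proof -
  have "bilinear K (P \<boxtimes>\<^bsub>K\<^esub> C) P (P \<boxtimes>\<^bsub>K\<^esub> C) (\<lambda>t x. left_act K P C x t)"
    unfolding left_act_def tensor_map_def
  proof (rule tensor_lift_bilinear[OF alg_module C alg_module tensor_module[OF alg_module C]])
    show "bilinear K P C (P \<boxtimes>\<^bsub>K\<^esub> C) (\<lambda>m n. pure K P C (x \<otimes>\<^bsub>P\<^esub> m) (id n))" if "x \<in> carrier P" for x
      by (rule tensor_map_bilinear[OF alg_module C left_mult_linear[OF that] linear_id])
    show "(\<lambda>x. pure K P C (x \<otimes>\<^bsub>P\<^esub> m) (id n)) \<in> linear_maps K P (P \<boxtimes>\<^bsub>K\<^esub> C)"
      if "m \<in> carrier P" "n \<in> carrier C" for m n
      using linear_comp[OF right_mult_linear[OF that(1)] bilinear_left[OF pure_bilinear[OF alg_module C] that(2)]]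
      by simp
  qed
  then show ?thesis by (simp add: bilinear_def)
qed

lemma left_act_mult:
  assumes C: "module K C" and xy: "x \<in> carrier P" "y \<in> carrier P" and t: "t \<in> carrier (P \<boxtimes>\<^bsub>K\<^esub> C)"
  shows "left_act K P C (x \<otimes>\<^bsub>P\<^esub> y) t = left_act K P C x (left_act K P C y t)"
  by (rule tensor_linear_eqI[OF alg_module C tensor_module[OF alg_module C] left_act_linear[OF C]
      linear_comp[OF left_act_linear[OF C] left_act_linear[OF C]] _ t])
    (simp_all add: xy left_act_pure[OF C] P.m_assoc)

lemma left_act_one:
  assumes C: "module K C" and t: "t \<in> carrier (P \<boxtimes>\<^bsub>K\<^esub> C)"
  shows "left_act K P C \<one>\<^bsub>P\<^esub> t = t"
  by (rule tensor_linear_eqI[OF alg_module C tensor_module[OF alg_module C] left_act_linear[OF C] linear_ident _ t])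
    (simp_all add: left_act_pure[OF C])

lemma right_slice_left_act:
  assumes C: "module K C" and d: "d \<in> functionals K C" and x: "x \<in> carrier P" and t: "t \<in> carrier (P \<boxtimes>\<^bsub>K\<^esub> C)"
  shows "right_slice K P d (left_act K P C x t) = x \<otimes>\<^bsub>P\<^esub> right_slice K P d t"
  by (rule tensor_linear_eqI[OF alg_module C alg_module linear_comp[OF left_act_linear[OF C x] right_slice_linear[OF alg_module C d]]
       linear_comp[OF right_slice_linear[OF alg_module C d] left_mult_linear[OF x]] _ t])
    (simp add: x left_act_pure[OF C] right_slice_pure[OF alg_module C d] smult_mult_right linear_closed[OF d, simplified])

end

section \<open>The coinvariants\<close>

locale comodule_algebra = algebra_over_ring K P
  for K :: "('k, 'x) ring_scheme" (structure) and P :: "('k, 'p) module" (structure) +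
  fixes C :: "('k, 'c) module" and \<Delta> :: "'c \<Rightarrow> ('c \<times> 'c \<Rightarrow> 'k) set" and \<epsilon> :: "'c \<Rightarrow> 'k"
    and \<rho> :: "'p \<Rightarrow> ('p \<times> 'c \<Rightarrow> 'k) set"
  assumes coalg: "coalgebra K C \<Delta> \<epsilon>" and comod: "right_comodule K C \<Delta> \<epsilon> P \<rho>"
begin

lemma C_module: "module K C"
  and comult_linear: "\<Delta> \<in> linear_maps K C (C \<boxtimes>\<^bsub>K\<^esub> C)"
  and counit_linear: "\<epsilon> \<in> functionals K C"
  using coalg by (simp_all add: coalgebra_def)

lemma coaction_linear: "\<rho> \<in> linear_maps K P (P \<boxtimes>\<^bsub>K\<^esub> C)"
  and coaction_coassoc: "x \<in> carrier P \<Longrightarrow>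
    tensor_assoc K P C C (tensor_map K (P \<boxtimes>\<^bsub>K\<^esub> C) C \<rho> id (\<rho> x)) = tensor_map K P (C \<boxtimes>\<^bsub>K\<^esub> C) id \<Delta> (\<rho> x)"
  and coaction_counit: "x \<in> carrier P \<Longrightarrow> right_slice K P \<epsilon> (\<rho> x) = x"
  using comod by (simp_all add: right_comodule_def right_slice_def)

lemmas PC_module = tensor_module[OF alg_module C_module]
lemmas PP_module = tensor_module[OF alg_module alg_module]
lemmas coaction_closed = linear_closed[OF coaction_linear]

abbreviation "B \<equiv> coinvariants K C P \<rho>"
abbreviation "act \<equiv> left_act K P C"

lemma coinvariantsD:
  assumes "b \<in> B"
  shows "b \<in> carrier P" "x \<in> carrier P \<Longrightarrow> \<rho> (b \<otimes>\<^bsub>P\<^esub> x) = act b (\<rho> x)"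
  using assms by (auto simp: coinvariants_def)

lemma coinvariantsI:
  assumes "b \<in> carrier P" "\<And>x. x \<in> carrier P \<Longrightarrow> \<rho> (b \<otimes>\<^bsub>P\<^esub> x) = act b (\<rho> x)"
  shows "b \<in> B"
  using assms by (auto simp: coinvariants_def)

text \<open>Since \<open>B\<close> contains the scalars, \<open>B\<close>-linear maps are \<open>K\<close>-linear.\<close>

lemma scalars_coinvariant:
  assumes a: "a \<in> carrier K" shows "a \<odot>\<^bsub>P\<^esub> \<one>\<^bsub>P\<^esub> \<in> B"
proof (rule coinvariantsI)
  fix x assume x: "x \<in> carrier P"
  show "\<rho> ((a \<odot>\<^bsub>P\<^esub> \<one>\<^bsub>P\<^esub>) \<otimes>\<^bsub>P\<^esub> x) = act (a \<odot>\<^bsub>P\<^esub> \<one>\<^bsub>P\<^esub>) (\<rho> x)"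
    using a x linear_smult[OF bilinear_left[OF left_act_bilinear[OF C_module] coaction_closed[OF x]] a, of "\<one>\<^bsub>P\<^esub>"]
    by (simp add: smult_mult_left linear_smult[OF coaction_linear] left_act_one[OF C_module] coaction_closed)
qed (use a in simp)

lemma coinvariants_subring: "subring B P"
proof (rule P.subringI)
  interpret PC: module K "P \<boxtimes>\<^bsub>K\<^esub> C" by (rule PC_module)
  note D = coinvariantsD
  note actl = bilinear_left[OF left_act_bilinear[OF C_module] coaction_closed]
  show "B \<subseteq> carrier P" using D by blast
  show "\<one>\<^bsub>P\<^esub> \<in> B" using scalars_coinvariant[OF one_closed] by simp
  show "\<ominus>\<^bsub>P\<^esub> b \<in> B" if b: "b \<in> B" for b
    using D[OF b]
    by (intro coinvariantsI)
      (auto simp: P.l_minus linear_minus[OF coaction_linear P.abelian_group_axioms PC.abelian_group_axioms]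
        linear_minus[OF actl P.abelian_group_axioms PC.abelian_group_axioms])
  show "b \<otimes>\<^bsub>P\<^esub> c \<in> B" if b: "b \<in> B" and c: "c \<in> B" for b c
    using D[OF b] D[OF c]
    by (intro coinvariantsI) (auto simp: P.m_assoc left_act_mult[OF C_module] coaction_closed)
  show "b \<oplus>\<^bsub>P\<^esub> c \<in> B" if b: "b \<in> B" and c: "c \<in> B" for b c
    using D[OF b] D[OF c]
    by (intro coinvariantsI) (auto simp: P.l_distr linear_add[OF coaction_linear] linear_add[OF actl])
qed

section \<open>The canonical map\<close>

lemma balanced_gens:
  "{pure K P P (p \<otimes>\<^bsub>P\<^esub> b) q \<ominus>\<^bsub>P \<boxtimes>\<^bsub>K\<^esub> P\<^esub> pure K P P p (b \<otimes>\<^bsub>P\<^esub> q) |p b q.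
     p \<in> carrier P \<and> b \<in> B \<and> q \<in> carrier P} \<subseteq> carrier (P \<boxtimes>\<^bsub>K\<^esub> P)"
proof -
  interpret PP: module K "P \<boxtimes>\<^bsub>K\<^esub> P" by (rule PP_module)
  show ?thesis
    by (auto intro!: PP.minus_closed pure_closed[OF alg_module alg_module] P.m_closed dest: coinvariantsD(1))
qed

lemma balanced_null_submodule: "submodule (balanced_null K P B) K (P \<boxtimes>\<^bsub>K\<^esub> P)"
  unfolding balanced_null_def by (rule module_span_submodule[OF PP_module balanced_gens])

lemma balanced_module: "module K (balanced_tensor K P B)"
  unfolding balanced_tensor_def by (rule quotient_module_module[OF PP_module balanced_null_submodule])

lemma balanced_proj_linear: "balanced_proj K P B \<in> linear_maps K (P \<boxtimes>\<^bsub>K\<^esub> P) (balanced_tensor K P B)"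
  using quotient_proj_linear[OF PP_module balanced_null_submodule]
  by (simp add: balanced_tensor_def balanced_proj_def[abs_def])

definition balanced :: "(('p \<times> 'p \<Rightarrow> 'k) set \<Rightarrow> 'w) \<Rightarrow> bool" where
  "balanced f \<longleftrightarrow> (\<forall>p\<in>carrier P. \<forall>b\<in>B. \<forall>q\<in>carrier P.
     f (pure K P P (p \<otimes>\<^bsub>P\<^esub> b) q) = f (pure K P P p (b \<otimes>\<^bsub>P\<^esub> q)))"

lemma balancedD: "\<lbrakk>balanced f; p \<in> carrier P; b \<in> B; q \<in> carrier P\<rbrakk> \<Longrightarrow>
    f (pure K P P (p \<otimes>\<^bsub>P\<^esub> b) q) = f (pure K P P p (b \<otimes>\<^bsub>P\<^esub> q))"
  by (simp add: balanced_def)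

text \<open>Balanced maps vanish on the generators of the kernel of \<open>P \<otimes> P \<rightarrow> P \<otimes>\<^sub>B P\<close>; hence they may be
  evaluated on any representative of an element of \<open>P \<otimes>\<^sub>B P\<close>.\<close>

lemma balanced_kills:
  assumes W: "module K W" and f: "f \<in> linear_maps K (P \<boxtimes>\<^bsub>K\<^esub> P) W" and bal: "balanced f"
    and h: "h \<in> balanced_null K P B"
  shows "f h = \<zero>\<^bsub>W\<^esub>"
proof -
  interpret W: module K W by (rule W)
  interpret PP: module K "P \<boxtimes>\<^bsub>K\<^esub> P" by (rule PP_module)
  have "f s = \<zero>\<^bsub>W\<^esub>" if s: "s \<in> {pure K P P (p \<otimes>\<^bsub>P\<^esub> b) q \<ominus>\<^bsub>P \<boxtimes>\<^bsub>K\<^esub> P\<^esub> pure K P P p (b \<otimes>\<^bsub>P\<^esub> q) |p b q.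
     p \<in> carrier P \<and> b \<in> B \<and> q \<in> carrier P}" for s
  proof -
    obtain p b q where s: "s = pure K P P (p \<otimes>\<^bsub>P\<^esub> b) q \<ominus>\<^bsub>P \<boxtimes>\<^bsub>K\<^esub> P\<^esub> pure K P P p (b \<otimes>\<^bsub>P\<^esub> q)"
      and m: "p \<in> carrier P" "b \<in> B" "q \<in> carrier P" using s by blast
    have c: "pure K P P (p \<otimes>\<^bsub>P\<^esub> b) q \<in> carrier (P \<boxtimes>\<^bsub>K\<^esub> P)" "pure K P P p (b \<otimes>\<^bsub>P\<^esub> q) \<in> carrier (P \<boxtimes>\<^bsub>K\<^esub> P)"
      using m coinvariantsD(1)[OF m(2)] by (auto intro!: pure_closed[OF alg_module alg_module])
    show ?thesis
      unfolding s linear_diff[OF f PP.abelian_group_axioms W.abelian_group_axioms c]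
      using linear_closed[OF f c(2)] by (simp add: balancedD[OF bal m] W.r_neg W.minus_eq)
  qed
  then show ?thesis
    using linear_span_zero[OF PP_module W f balanced_gens] h by (simp add: balanced_null_def)
qed

lemma balanced_some:
  assumes W: "module K W" and f: "f \<in> linear_maps K (P \<boxtimes>\<^bsub>K\<^esub> P) W" and bal: "balanced f"
    and t: "t \<in> carrier (P \<boxtimes>\<^bsub>K\<^esub> P)"
  shows "f (SOME s. s \<in> balanced_proj K P B t) = f t"
  unfolding balanced_proj_def
  by (rule linear_coset_some[OF PP_module W balanced_null_submodule f balanced_kills[OF W f bal] t])

lemma balanced_eqD:
  assumes W: "module K W" and f: "f \<in> linear_maps K (P \<boxtimes>\<^bsub>K\<^esub> P) W" and bal: "balanced f"
    and t: "t \<in> carrier (P \<boxtimes>\<^bsub>K\<^esub> P)" "t' \<in> carrier (P \<boxtimes>\<^bsub>K\<^esub> P)"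
    and eq: "balanced_proj K P B t = balanced_proj K P B t'"
  shows "f t = f t'"
  using balanced_some[OF W f bal t(1)] balanced_some[OF W f bal t(2)] eq by simp

text \<open>The canonical map lifted to \<open>P \<otimes> P\<close> and preceded by right multiplication with \<open>x\<close>.  The parameter
  \<open>x\<close> is there for the entwining map, which satisfies \<open>\<psi>(c \<otimes> x) = can x (l c)\<close>.\<close>

definition can :: "'p \<Rightarrow> ('p \<times> 'p \<Rightarrow> 'k) set \<Rightarrow> ('p \<times> 'c \<Rightarrow> 'k) set" where
  "can x = tensor_lift K (P \<boxtimes>\<^bsub>K\<^esub> C) (\<lambda>u v. act u (\<rho> (v \<otimes>\<^bsub>P\<^esub> x)))"

lemma can_inner: "x \<in> carrier P \<Longrightarrow> bilinear K P P (P \<boxtimes>\<^bsub>K\<^esub> C) (\<lambda>u v. act u (\<rho> (v \<otimes>\<^bsub>P\<^esub> x)))"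
  by (rule bilinear_comp[OF left_act_bilinear[OF C_module] linear_ident linear_comp[OF right_mult_linear coaction_linear] linear_ident])

lemma can_bilinear: "bilinear K (P \<boxtimes>\<^bsub>K\<^esub> P) P (P \<boxtimes>\<^bsub>K\<^esub> C) (\<lambda>t x. can x t)"
  unfolding can_def
proof (rule tensor_lift_bilinear[OF alg_module alg_module alg_module PC_module can_inner])
  show "(\<lambda>x. act m (\<rho> (n \<otimes>\<^bsub>P\<^esub> x))) \<in> linear_maps K P (P \<boxtimes>\<^bsub>K\<^esub> C)"
    if "m \<in> carrier P" "n \<in> carrier P" for m n
    by (rule linear_comp[OF linear_comp[OF left_mult_linear[OF that(2)] coaction_linear] left_act_linear[OF C_module that(1)]])
qed

lemma can_linear: "x \<in> carrier P \<Longrightarrow> can x \<in> linear_maps K (P \<boxtimes>\<^bsub>K\<^esub> P) (P \<boxtimes>\<^bsub>K\<^esub> C)"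
  by (rule bilinear_left[OF can_bilinear])

lemma can_pure: "\<lbrakk>x \<in> carrier P; u \<in> carrier P; v \<in> carrier P\<rbrakk> \<Longrightarrow> can x (pure K P P u v) = act u (\<rho> (v \<otimes>\<^bsub>P\<^esub> x))"
  unfolding can_def by (rule tensor_lift_pure[OF alg_module alg_module PC_module can_inner])

text \<open>This is where the definition of \<open>B\<close> enters: \<open>u b \<Delta>\<^sub>P(v x) = u \<Delta>\<^sub>P(b v x)\<close>.\<close>

lemma can_balanced: "x \<in> carrier P \<Longrightarrow> balanced (can x)"
  using coinvariantsD
  by (auto simp: balanced_def can_pure P.m_assoc left_act_mult[OF C_module] coaction_closed)

lemma can_R_proj:
  assumes t: "t \<in> carrier (P \<boxtimes>\<^bsub>K\<^esub> P)"
  shows "can_R K C P \<rho> (balanced_proj K P B t) = can \<one>\<^bsub>P\<^esub> t"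
proof -
  let ?f = "tensor_lift K (P \<boxtimes>\<^bsub>K\<^esub> C) (\<lambda>u v. act u (\<rho> v))"
  have b: "bilinear K P P (P \<boxtimes>\<^bsub>K\<^esub> C) (\<lambda>u v. act u (\<rho> v))"
    by (rule bilinear_comp[OF left_act_bilinear[OF C_module] linear_ident coaction_linear linear_ident])
  have lin: "?f \<in> linear_maps K (P \<boxtimes>\<^bsub>K\<^esub> P) (P \<boxtimes>\<^bsub>K\<^esub> C)"
    by (rule tensor_lift_linear[OF alg_module alg_module PC_module b])
  have eq: "?f s = can \<one>\<^bsub>P\<^esub> s" if "s \<in> carrier (P \<boxtimes>\<^bsub>K\<^esub> P)" for s
    unfolding can_def
    by (rule tensor_lift_cong[OF alg_module alg_module PC_module b can_inner _ that]) simp_all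
  have "balanced ?f"
    using can_balanced[OF P.one_closed] coinvariantsD(1)
    by (auto simp: balanced_def eq pure_closed[OF alg_module alg_module])
  from balanced_some[OF PC_module lin this t] show ?thesis
    by (simp add: can_R_def eq[OF t])
qed

lemma right_act_proj:
  assumes t: "t \<in> carrier (P \<boxtimes>\<^bsub>K\<^esub> P)" and x: "x \<in> carrier P"
  shows "right_act K P B (balanced_proj K P B t) x =
    balanced_proj K P B (tensor_map K P P id (\<lambda>y. y \<otimes>\<^bsub>P\<^esub> x) t)"
proof -
  let ?m = "tensor_map K P P id (\<lambda>y. y \<otimes>\<^bsub>P\<^esub> x)"
  interpret PP: module K "P \<boxtimes>\<^bsub>K\<^esub> P" by (rule PP_module)
  interpret Q: module K "balanced_tensor K P B" by (rule balanced_module)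
  note m = tensor_map_linear[OF alg_module alg_module alg_module alg_module linear_id right_mult_linear[OF x]]
  note mp = tensor_map_pure[OF alg_module alg_module alg_module alg_module linear_id right_mult_linear[OF x]]
  note lin = linear_comp[OF m balanced_proj_linear]
  have "balanced (\<lambda>s. balanced_proj K P B (?m s))"
    unfolding balanced_def
  proof (intro ballI)
    fix p b q assume h: "p \<in> carrier P" "b \<in> B" "q \<in> carrier P"
    note b = coinvariantsD(1)[OF h(2)]
    have c: "pure K P P (p \<otimes>\<^bsub>P\<^esub> b) (q \<otimes>\<^bsub>P\<^esub> x) \<in> carrier (P \<boxtimes>\<^bsub>K\<^esub> P)"
      "pure K P P p (b \<otimes>\<^bsub>P\<^esub> (q \<otimes>\<^bsub>P\<^esub> x)) \<in> carrier (P \<boxtimes>\<^bsub>K\<^esub> P)"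
      using h b x by (auto intro!: pure_closed[OF alg_module alg_module])
    have "pure K P P (p \<otimes>\<^bsub>P\<^esub> b) (q \<otimes>\<^bsub>P\<^esub> x) \<ominus>\<^bsub>P \<boxtimes>\<^bsub>K\<^esub> P\<^esub> pure K P P p (b \<otimes>\<^bsub>P\<^esub> (q \<otimes>\<^bsub>P\<^esub> x)) \<in> balanced_null K P B"
      unfolding balanced_null_def by (rule subsetD[OF module_span_base]) (use h x in blast)
    then have "pure K P P (p \<otimes>\<^bsub>P\<^esub> b) (q \<otimes>\<^bsub>P\<^esub> x) \<in> balanced_proj K P B (pure K P P p (b \<otimes>\<^bsub>P\<^esub> (q \<otimes>\<^bsub>P\<^esub> x)))"
      unfolding balanced_proj_def
      using abelian_subgroup.a_rcos_module[OF submodule_abelian_subgroup[OF PP_module balanced_null_submodule] c(2,1)]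
      by (simp add: a_minus_def)
    from abelian_subgroup.a_repr_independence'[OF submodule_abelian_subgroup[OF PP_module balanced_null_submodule]
       this[unfolded balanced_proj_def] c(2)]
    show "balanced_proj K P B (?m (pure K P P (p \<otimes>\<^bsub>P\<^esub> b) q)) = balanced_proj K P B (?m (pure K P P p (b \<otimes>\<^bsub>P\<^esub> q)))"
      using h b x by (simp add: mp P.m_assoc balanced_proj_def)
  qed
  from balanced_some[OF balanced_module lin this t] show ?thesis
    by (simp add: right_act_def)
qed

text \<open>By counitality of the coaction, \<open>id \<otimes> \<epsilon>\<close> turns \<open>u \<Delta>\<^sub>P(v)\<close> into \<open>u v\<close>.\<close>

lemma right_slice_can:
  assumes t: "t \<in> carrier (P \<boxtimes>\<^bsub>K\<^esub> P)"
  shows "right_slice K P \<epsilon> (can \<one>\<^bsub>P\<^esub> t) = tensor_lift K P (mult P) t"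
  by (rule tensor_linear_eqI[OF alg_module alg_module alg_module linear_comp[OF can_linear right_slice_linear[OF alg_module C_module counit_linear]]
      tensor_lift_linear[OF alg_module alg_module alg_module mult_bilinear] _ t])
    (simp_all add: can_pure right_slice_left_act[OF C_module counit_linear] coaction_closed coaction_counit
      tensor_lift_pure[OF alg_module alg_module alg_module mult_bilinear])

end

section \<open>Strong connections\<close>

locale strongly_connected_extension = comodule_algebra K P C \<Delta> \<epsilon> \<rho>
  for K :: "('k, 'x) ring_scheme" (structure) and P :: "('k, 'p) module" (structure)
    and C :: "('k, 'c) module" and \<Delta> \<epsilon> \<rho> +
  fixes e :: 'c and l :: "'c \<Rightarrow> ('p \<times> 'p \<Rightarrow> 'k) set"
  assumes principal: "principal_extension K C \<Delta> \<epsilon> P \<rho> e"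
    and connection: "strong_connection K C \<Delta> P \<rho> e l"
begin

lemma l_linear: "l \<in> linear_maps K C (P \<boxtimes>\<^bsub>K\<^esub> P)"
  and l_translation: "c \<in> carrier C \<Longrightarrow> balanced_proj K P B (l c) = translation K C P \<rho> c"
  and l_right_colinear: "c \<in> carrier C \<Longrightarrow> tensor_map K P (P \<boxtimes>\<^bsub>K\<^esub> C) id \<rho> (l c) =
          tensor_assoc K P P C (tensor_map K (P \<boxtimes>\<^bsub>K\<^esub> P) C l id (\<Delta> c))"
  and l_left_colinear: "c \<in> carrier C \<Longrightarrow>
      tensor_assoc K C P P (tensor_map K (C \<boxtimes>\<^bsub>K\<^esub> P) P (left_coaction K C P \<rho> e) id (l c)) =
          tensor_map K C (P \<boxtimes>\<^bsub>K\<^esub> P) id l (\<Delta> c)"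
  using connection by (auto simp: strong_connection_def)

lemma e_closed: "e \<in> carrier C"
  using principal by (simp add: principal_extension_def group_like_def)

lemmas l_closed = linear_closed[OF l_linear]
lemmas CP_module = tensor_module[OF C_module alg_module]

abbreviation "\<psi> \<equiv> entwining K C P \<rho>"

lemma psi_bij: "bij_betw \<psi> (carrier (C \<boxtimes>\<^bsub>K\<^esub> P)) (carrier (P \<boxtimes>\<^bsub>K\<^esub> C))"
  and can_bij: "bij_betw (can_R K C P \<rho>) (carrier (balanced_tensor K P B)) (carrier (P \<boxtimes>\<^bsub>K\<^esub> C))"
  and coaction_psi: "x \<in> carrier P \<Longrightarrow> \<rho> x = \<psi> (pure K C P e x)"
  using principal by (auto simp: principal_extension_def)

text \<open>A strong connection represents the translation map, which inverts the canonical map on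
  \<open>1 \<otimes> C\<close>.\<close>

lemma can_l: "c \<in> carrier C \<Longrightarrow> can \<one>\<^bsub>P\<^esub> (l c) = pure K P C \<one>\<^bsub>P\<^esub> c"
proof -
  assume c: "c \<in> carrier C"
  have "can_R K C P \<rho> (translation K C P \<rho> c) = pure K P C \<one>\<^bsub>P\<^esub> c"
    unfolding translation_def
    by (rule f_inv_into_f) (use can_bij c in \<open>auto simp: bij_betw_def intro!: pure_closed[OF alg_module C_module]\<close>)
  then show ?thesis
    using can_R_proj[OF l_closed[OF c]] l_translation[OF c] by simp
qed

lemma can_injective:
  assumes "s \<in> carrier (P \<boxtimes>\<^bsub>K\<^esub> P)" "t \<in> carrier (P \<boxtimes>\<^bsub>K\<^esub> P)" "can \<one>\<^bsub>P\<^esub> s = can \<one>\<^bsub>P\<^esub> t"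
  shows "balanced_proj K P B s = balanced_proj K P B t"
proof (rule inj_onD)
  show "inj_on (can_R K C P \<rho>) (carrier (balanced_tensor K P B))"
    using can_bij by (simp add: bij_betw_def)
qed (use assms linear_closed[OF balanced_proj_linear] in \<open>simp_all add: can_R_proj\<close>)

lemma psi_inner: "bilinear K C P (P \<boxtimes>\<^bsub>K\<^esub> C) (\<lambda>c x. can x (l c))"
  by (rule bilinear_comp[OF can_bilinear l_linear linear_ident linear_ident])

lemma psi_factor:
  assumes c: "c \<in> carrier C" and x: "x \<in> carrier P"
  shows "can_R K C P \<rho> (right_act K P B (translation K C P \<rho> c) x) = can x (l c)"
proof -
  note m = tensor_map_linear[OF alg_module alg_module alg_module alg_module linear_id right_mult_linear[OF x]]
  have "can_R K C P \<rho> (right_act K P B (translation K C P \<rho> c) x) =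
      can \<one>\<^bsub>P\<^esub> (tensor_map K P P id (\<lambda>y. y \<otimes>\<^bsub>P\<^esub> x) (l c))"
    by (simp add: l_translation[OF c, symmetric] right_act_proj l_closed c x can_R_proj linear_closed[OF m])
  also have "\<dots> = tensor_lift K (P \<boxtimes>\<^bsub>K\<^esub> C) (\<lambda>u v. act (id u) (\<rho> (v \<otimes>\<^bsub>P\<^esub> x \<otimes>\<^bsub>P\<^esub> \<one>\<^bsub>P\<^esub>))) (l c)"
    unfolding can_def
    by (rule tensor_lift_tensor_map[OF alg_module alg_module alg_module alg_module PC_module can_inner linear_id
       right_mult_linear[OF x] l_closed[OF c]]) simp
  also have "\<dots> = can x (l c)"
    unfolding can_def
    by (rule tensor_lift_cong[OF alg_module alg_module PC_module bilinear_comp[OF can_inner linear_id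
       right_mult_linear[OF x] linear_ident] can_inner _ l_closed[OF c]]) (simp_all add: x)
  finally show ?thesis .
qed

lemma psi_linear: "\<psi> \<in> linear_maps K (C \<boxtimes>\<^bsub>K\<^esub> P) (P \<boxtimes>\<^bsub>K\<^esub> C)"
  and psi_pure: "\<lbrakk>c \<in> carrier C; x \<in> carrier P\<rbrakk> \<Longrightarrow> \<psi> (pure K C P c x) = can x (l c)"
proof -
  have b: "bilinear K C P (P \<boxtimes>\<^bsub>K\<^esub> C) (\<lambda>c x. can_R K C P \<rho> (right_act K P B (translation K C P \<rho> c) x))"
    by (rule bilinear_cong[OF C_module alg_module psi_inner]) (simp add: psi_factor)
  show "\<psi> \<in> linear_maps K (C \<boxtimes>\<^bsub>K\<^esub> P) (P \<boxtimes>\<^bsub>K\<^esub> C)"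
    unfolding entwining_def by (rule tensor_lift_linear[OF C_module alg_module PC_module b])
  show "\<psi> (pure K C P c x) = can x (l c)" if "c \<in> carrier C" "x \<in> carrier P"
    unfolding entwining_def using tensor_lift_pure[OF C_module alg_module PC_module b that] psi_factor[OF that] by simp
qed

lemma left_coaction_closed: "x \<in> carrier P \<Longrightarrow> left_coaction K C P \<rho> e x \<in> carrier (C \<boxtimes>\<^bsub>K\<^esub> P)"
  and psi_left_coaction: "x \<in> carrier P \<Longrightarrow> \<psi> (left_coaction K C P \<rho> e x) = pure K P C x e"
proof -
  assume "x \<in> carrier P"
  then have "pure K P C x e \<in> \<psi> ` carrier (C \<boxtimes>\<^bsub>K\<^esub> P)"
    using psi_bij e_closed by (simp add: bij_betw_def pure_closed[OF alg_module C_module])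
  then show "left_coaction K C P \<rho> e x \<in> carrier (C \<boxtimes>\<^bsub>K\<^esub> P)" "\<psi> (left_coaction K C P \<rho> e x) = pure K P C x e"
    unfolding left_coaction_def by (rule inv_into_into, rule f_inv_into_f)
qed

text \<open>As the values of an inverse of \<open>\<psi>\<close>, left coactions are compared by applying the injective
  linear map \<open>\<psi>\<close>.\<close>

lemma left_coaction_linear: "left_coaction K C P \<rho> e \<in> linear_maps K P (C \<boxtimes>\<^bsub>K\<^esub> P)"
proof -
  interpret CP: module K "C \<boxtimes>\<^bsub>K\<^esub> P" by (rule CP_module)
  have inj: "s = t" if "\<psi> s = \<psi> t" "s \<in> carrier (C \<boxtimes>\<^bsub>K\<^esub> P)" "t \<in> carrier (C \<boxtimes>\<^bsub>K\<^esub> P)" for s t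
    using psi_bij that by (auto simp: bij_betw_def dest: inj_onD)
  note pe = bilinear_left[OF pure_bilinear[OF alg_module C_module] e_closed]
  show ?thesis
    by (rule linear_mapsI; (rule inj)?)
      (simp_all add: left_coaction_closed psi_left_coaction linear_add[OF psi_linear] linear_smult[OF psi_linear]
        linear_add[OF pe] linear_smult[OF pe])
qed

text \<open>Composed with the coaction this is \<open>q \<mapsto> q\<^sub>0 l(q\<^sub>1)\<close>, a section of the multiplication map with
  values in \<open>B \<otimes> P\<close>.\<close>

definition split :: "('p \<times> 'c \<Rightarrow> 'k) set \<Rightarrow> ('p \<times> 'p \<Rightarrow> 'k) set" where
  "split = tensor_lift K (P \<boxtimes>\<^bsub>K\<^esub> P) (\<lambda>u c. left_act K P P u (l c))"

lemma split_inner: "bilinear K P C (P \<boxtimes>\<^bsub>K\<^esub> P) (\<lambda>u c. left_act K P P u (l c))"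
  by (rule bilinear_comp[OF left_act_bilinear[OF alg_module] linear_ident l_linear linear_ident])

lemma split_linear: "split \<in> linear_maps K (P \<boxtimes>\<^bsub>K\<^esub> C) (P \<boxtimes>\<^bsub>K\<^esub> P)"
  unfolding split_def by (rule tensor_lift_linear[OF alg_module C_module PP_module split_inner])

lemma split_pure: "\<lbrakk>u \<in> carrier P; c \<in> carrier C\<rbrakk> \<Longrightarrow> split (pure K P C u c) = left_act K P P u (l c)"
  unfolding split_def by (rule tensor_lift_pure[OF alg_module C_module PP_module split_inner])

lemma can_left_act:
  assumes x: "x \<in> carrier P" and u: "u \<in> carrier P" and t: "t \<in> carrier (P \<boxtimes>\<^bsub>K\<^esub> P)"
  shows "can x (left_act K P P u t) = act u (can x t)"
  by (rule tensor_linear_eqI[OF alg_module alg_module PC_module linear_comp[OF left_act_linear[OF alg_module u] can_linear[OF x]]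
      linear_comp[OF can_linear[OF x] left_act_linear[OF C_module u]] _ t])
    (simp add: x u can_pure left_act_pure[OF alg_module] left_act_mult[OF C_module] coaction_closed)

lemma can_split:
  assumes t: "t \<in> carrier (P \<boxtimes>\<^bsub>K\<^esub> C)"
  shows "can \<one>\<^bsub>P\<^esub> (split t) = t"
  by (rule tensor_linear_eqI[OF alg_module C_module PC_module linear_comp[OF split_linear can_linear] linear_ident _ t])
    (simp_all add: split_pure can_left_act l_closed can_l left_act_pure[OF C_module])

text \<open>Both \<open>q\<^sub>0 l(q\<^sub>1)\<close> and \<open>1 \<otimes> q\<close> are mapped to \<open>\<Delta>\<^sub>P(q)\<close> by the canonical map, hence they agree in
  \<open>P \<otimes>\<^sub>B P\<close>; multiplying by \<open>x\<close> on the right gives \<open>\<Delta>\<^sub>P(q x) = q\<^sub>0 \<psi>(q\<^sub>1 \<otimes> x)\<close>.\<close>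

lemma coaction_mult:
  assumes q: "q \<in> carrier P" and x: "x \<in> carrier P"
  shows "\<rho> (q \<otimes>\<^bsub>P\<^esub> x) = can x (split (\<rho> q))"
proof -
  note c = linear_closed[OF split_linear coaction_closed[OF q]] pure_closed[OF alg_module alg_module P.one_closed q]
  have "can \<one>\<^bsub>P\<^esub> (split (\<rho> q)) = can \<one>\<^bsub>P\<^esub> (pure K P P \<one>\<^bsub>P\<^esub> q)"
    by (simp add: can_split coaction_closed q can_pure left_act_one[OF C_module])
  from balanced_eqD[OF PC_module can_linear[OF x] can_balanced[OF x] c can_injective[OF c this]]
  show ?thesis by (simp add: can_pure x q left_act_one[OF C_module] coaction_closed)
qed

lemma coaction_mult_lift:
  assumes q: "q \<in> carrier P" and x: "x \<in> carrier P"
  shows "\<rho> (q \<otimes>\<^bsub>P\<^esub> x) = tensor_lift K (P \<boxtimes>\<^bsub>K\<^esub> C) (\<lambda>u c. act u (can x (l c))) (\<rho> q)"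
proof -
  have "can x (split (\<rho> q)) = tensor_lift K (P \<boxtimes>\<^bsub>K\<^esub> C) (\<lambda>u c. can x (left_act K P P u (l c))) (\<rho> q)"
    unfolding split_def
    by (rule linear_tensor_lift[OF alg_module C_module PP_module PC_module split_inner can_linear[OF x] coaction_closed[OF q]])
  also have "\<dots> = tensor_lift K (P \<boxtimes>\<^bsub>K\<^esub> C) (\<lambda>u c. act u (can x (l c))) (\<rho> q)"
    by (rule tensor_lift_cong[OF alg_module C_module PC_module bilinear_comp[OF split_inner linear_ident linear_ident can_linear[OF x]]
        bilinear_comp[OF left_act_bilinear[OF C_module] linear_ident linear_comp[OF l_linear can_linear[OF x]] linear_ident] _
        coaction_closed[OF q]])
      (simp add: can_left_act x l_closed)
  finally show ?thesis using coaction_mult[OF assms] by simp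
qed

text \<open>If \<open>\<Delta>\<^sub>P(b) = b \<otimes> e\<close>, then \<open>\<Delta>\<^sub>P(b x) = b \<psi>(e \<otimes> x) = b \<Delta>\<^sub>P(x)\<close>.\<close>

lemma coinvariant_if_trivial_coaction:
  assumes b: "b \<in> carrier P" and r: "\<rho> b = pure K P C b e"
  shows "b \<in> B"
proof (rule coinvariantsI[OF b])
  fix x assume x: "x \<in> carrier P"
  have "\<rho> (b \<otimes>\<^bsub>P\<^esub> x) = act b (can x (l e))"
    using coaction_mult[OF b x] r by (simp add: split_pure b e_closed can_left_act x l_closed)
  then show "\<rho> (b \<otimes>\<^bsub>P\<^esub> x) = act b (\<rho> x)"
    using coaction_psi[OF x] psi_pure[OF e_closed x] by simp
qed

lemma right_slice_l_linear: "d \<in> functionals K P \<Longrightarrow> (\<lambda>c. right_slice K P d (l c)) \<in> linear_maps K C P"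
  by (rule linear_comp[OF l_linear right_slice_linear[OF alg_module alg_module]])

text \<open>With \<open>L = (id \<otimes> d) \<circ> l\<close>, left colinearity of \<open>l\<close> says that the left coaction sends \<open>L(c)\<close> to
  \<open>c\<^sub>1 \<otimes> L(c\<^sub>2)\<close>.  The entwining map takes the left coaction of \<open>L(c)\<close> to \<open>L(c) \<otimes> e\<close>.\<close>

lemma right_slice_l_coaction:
  assumes d: "d \<in> functionals K P" and c: "c \<in> carrier C"
  shows "\<psi> (tensor_map K C P id (\<lambda>c. right_slice K P d (l c)) (\<Delta> c)) = pure K P C (right_slice K P d (l c)) e"
proof -
  have "left_coaction K C P \<rho> e (right_slice K P d (l c)) =
    tensor_map K C P id (right_slice K P d) (tensor_assoc K C P P (tensor_map K (C \<boxtimes>\<^bsub>K\<^esub> P) P (left_coaction K C P \<rho> e) id (l c)))"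
    by (rule right_slice_assoc[symmetric, OF C_module alg_module alg_module alg_module d left_coaction_linear l_closed[OF c]])
  also have "\<dots> = tensor_map K C P id (\<lambda>c. right_slice K P d (l c)) (\<Delta> c)"
    unfolding l_left_colinear[OF c]
    by (rule right_slice_tensor_map[OF C_module C_module alg_module alg_module d l_linear linear_closed[OF comult_linear c]])
  finally show ?thesis
    using psi_left_coaction[OF linear_closed[OF right_slice_l_linear[OF d] c]] by simp
qed

lemma right_slice_split:
  assumes d: "d \<in> functionals K P" and t: "t \<in> carrier (P \<boxtimes>\<^bsub>K\<^esub> C)"
  shows "right_slice K P d (split t) = tensor_lift K P (\<lambda>u c. u \<otimes>\<^bsub>P\<^esub> right_slice K P d (l c)) t"
  by (rule tensor_linear_eqI[OF alg_module C_module alg_module linear_comp[OF split_linear right_slice_linear[OF alg_module alg_module d]]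
     tensor_lift_linear[OF alg_module C_module alg_module] _ t])
    (simp_all add: bilinear_comp[OF mult_bilinear linear_ident right_slice_l_linear[OF d] linear_ident] split_pure
      tensor_lift_pure[OF alg_module C_module alg_module] right_slice_left_act[OF alg_module d] l_closed)

text \<open>With \<open>L = (id \<otimes> d) \<circ> l\<close>, the slice is \<open>b = q\<^sub>0 L(q\<^sub>1)\<close>, and
  \<open>\<Delta>\<^sub>P(b) = q\<^sub>0 \<psi>(q\<^sub>1 \<otimes> L(q\<^sub>2))\<close> by the product formula and coassociativity.  The previous lemmas turn
  \<open>\<psi>(c\<^sub>1 \<otimes> L(c\<^sub>2))\<close> into \<open>L(c) \<otimes> e\<close>, so that \<open>\<Delta>\<^sub>P(b) = b \<otimes> e\<close> and \<open>b\<close> is coinvariant.  As \<open>d\<close> ranges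
  over the coordinate functionals of a basis, this says that \<open>q\<^sub>0 l(q\<^sub>1)\<close> lies in \<open>B \<otimes> P\<close>.\<close>

lemma right_slice_split_coinvariant:
  assumes d: "d \<in> functionals K P" and q: "q \<in> carrier P"
  shows "right_slice K P d (split (\<rho> q)) \<in> B"
proof (rule coinvariant_if_trivial_coaction)
  let ?L = "\<lambda>c. right_slice K P d (l c)"
  let ?b = "right_slice K P d (split (\<rho> q))"
  let ?\<gamma> = "\<lambda>u w. act u (\<psi> (tensor_map K C P id ?L w))"
  note L = right_slice_l_linear[OF d]
  note CC = tensor_module[OF C_module C_module]
  note rq = coaction_closed[OF q]
  show "?b \<in> carrier P"
    by (rule linear_closed[OF linear_comp[OF split_linear right_slice_linear[OF alg_module alg_module d]] rq])
  note tm = tensor_map_linear[OF C_module C_module C_module alg_module linear_id L]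
  \<comment> \<open>Both \<open>q\<^sub>0 \<otimes> q\<^sub>1 \<otimes> q\<^sub>2\<close> computed by iterating the coaction and the same tensor computed with the
    coproduct are fed into the lift of \<open>\<gamma>\<close>, which is \<open>u \<otimes> c' \<otimes> c \<mapsto> u \<psi>(c' \<otimes> L(c))\<close> on pure tensors.\<close>
  have \<gamma>: "bilinear K P (C \<boxtimes>\<^bsub>K\<^esub> C) (P \<boxtimes>\<^bsub>K\<^esub> C) ?\<gamma>"
    by (rule bilinear_comp[OF left_act_bilinear[OF C_module] linear_ident linear_comp[OF tm psi_linear] linear_ident])
  note G = tensor_lift_linear[OF alg_module CC PC_module \<gamma>]
  have uL: "bilinear K P C P (\<lambda>u c. u \<otimes>\<^bsub>P\<^esub> ?L c)"
    by (rule bilinear_comp[OF mult_bilinear linear_ident L linear_ident])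
  note ruL = bilinear_comp[OF uL linear_ident linear_ident coaction_linear]
  note tr = tensor_map_linear[OF alg_module C_module PC_module C_module coaction_linear linear_id]
  note as = tensor_assoc_linear[OF alg_module C_module C_module]
  have "\<rho> ?b = tensor_lift K (P \<boxtimes>\<^bsub>K\<^esub> C) (\<lambda>u c. \<rho> (u \<otimes>\<^bsub>P\<^esub> ?L c)) (\<rho> q)"
    unfolding right_slice_split[OF d rq]
    by (rule linear_tensor_lift[OF alg_module C_module alg_module PC_module uL coaction_linear rq])
  also have "\<dots> = tensor_lift K (P \<boxtimes>\<^bsub>K\<^esub> C) ?\<gamma> (tensor_assoc K P C C (tensor_map K (P \<boxtimes>\<^bsub>K\<^esub> C) C \<rho> id (\<rho> q)))"
  proof (rule tensor_linear_eqI[OF alg_module C_module PC_module tensor_lift_linear[OF alg_module C_module PC_module ruL]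
      linear_comp[OF linear_comp[OF tr as] G] _ rq])
    fix u c assume u: "u \<in> carrier P" and c: "c \<in> carrier C"
    note inner = tensor_assoc_inner[OF alg_module C_module C_module c]
    have "tensor_lift K (P \<boxtimes>\<^bsub>K\<^esub> C) ?\<gamma> (tensor_assoc K P C C (tensor_map K (P \<boxtimes>\<^bsub>K\<^esub> C) C \<rho> id (pure K P C u c)))
      = tensor_lift K (P \<boxtimes>\<^bsub>K\<^esub> C) ?\<gamma> (tensor_lift K (P \<boxtimes>\<^bsub>K\<^esub> (C \<boxtimes>\<^bsub>K\<^esub> C)) (\<lambda>u' c'. pure K P (C \<boxtimes>\<^bsub>K\<^esub> C) u' (pure K C C c' c)) (\<rho> u))"
      by (simp add: tensor_map_pure[OF alg_module C_module PC_module C_module coaction_linear linear_id] u c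
         tensor_assoc_pure[OF alg_module C_module C_module] coaction_closed)
    also have "\<dots> = tensor_lift K (P \<boxtimes>\<^bsub>K\<^esub> C) (\<lambda>u' c'. tensor_lift K (P \<boxtimes>\<^bsub>K\<^esub> C) ?\<gamma> (pure K P (C \<boxtimes>\<^bsub>K\<^esub> C) u' (pure K C C c' c))) (\<rho> u)"
      by (rule linear_tensor_lift[OF alg_module C_module tensor_module[OF alg_module CC] PC_module inner G coaction_closed[OF u]])
    also have "\<dots> = tensor_lift K (P \<boxtimes>\<^bsub>K\<^esub> C) (\<lambda>u' c'. act u' (can (?L c) (l c'))) (\<rho> u)"
    proof (rule tensor_lift_cong[OF alg_module C_module PC_module bilinear_comp[OF inner linear_ident linear_ident G] _ _ coaction_closed[OF u]])
      show "bilinear K P C (P \<boxtimes>\<^bsub>K\<^esub> C) (\<lambda>u' c'. act u' (can (?L c) (l c')))"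
        by (rule bilinear_comp[OF left_act_bilinear[OF C_module] linear_ident linear_comp[OF l_linear can_linear[OF linear_closed[OF L c]]] linear_ident])
    next
      fix u' c' assume "u' \<in> carrier P" "c' \<in> carrier C"
      then show "tensor_lift K (P \<boxtimes>\<^bsub>K\<^esub> C) ?\<gamma> (pure K P (C \<boxtimes>\<^bsub>K\<^esub> C) u' (pure K C C c' c)) = act u' (can (?L c) (l c'))"
        by (simp add: tensor_lift_pure[OF alg_module CC PC_module \<gamma>] pure_closed[OF C_module C_module] c
          tensor_map_pure[OF C_module C_module C_module alg_module linear_id L] psi_pure linear_closed[OF L])
    qed
    also have "\<dots> = \<rho> (u \<otimes>\<^bsub>P\<^esub> ?L c)"
      by (rule coaction_mult_lift[OF u linear_closed[OF L c], symmetric])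
    finally show "tensor_lift K (P \<boxtimes>\<^bsub>K\<^esub> C) (\<lambda>u c. \<rho> (u \<otimes>\<^bsub>P\<^esub> ?L c)) (pure K P C u c) =
       tensor_lift K (P \<boxtimes>\<^bsub>K\<^esub> C) ?\<gamma> (tensor_assoc K P C C (tensor_map K (P \<boxtimes>\<^bsub>K\<^esub> C) C \<rho> id (pure K P C u c)))"
      using tensor_lift_pure[OF alg_module C_module PC_module ruL u c] by simp
  qed
  also have "\<dots> = tensor_lift K (P \<boxtimes>\<^bsub>K\<^esub> C) (\<lambda>u c. ?\<gamma> (id u) (\<Delta> c)) (\<rho> q)"
    unfolding coaction_coassoc[OF q]
    by (rule tensor_lift_tensor_map[OF alg_module C_module alg_module CC PC_module \<gamma> linear_id comult_linear rq])
  also have "\<dots> = tensor_lift K (P \<boxtimes>\<^bsub>K\<^esub> C) (\<lambda>u c. pure K P C (u \<otimes>\<^bsub>P\<^esub> ?L c) e) (\<rho> q)"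
    by (rule tensor_lift_cong[OF alg_module C_module PC_module bilinear_comp[OF \<gamma> linear_id comult_linear linear_ident]
       bilinear_comp[OF uL linear_ident linear_ident bilinear_left[OF pure_bilinear[OF alg_module C_module] e_closed]] _ rq])
      (simp add: right_slice_l_coaction[OF d] left_act_pure[OF C_module] linear_closed[OF L] e_closed)
  also have "\<dots> = pure K P C ?b e"
    unfolding right_slice_split[OF d rq]
    by (rule linear_tensor_lift[symmetric, OF alg_module C_module alg_module PC_module uL
        bilinear_left[OF pure_bilinear[OF alg_module C_module] e_closed] rq])
  finally show "\<rho> ?b = pure K P C ?b e" .
qed

text \<open>The canonical map undoes \<open>split\<close>, and multiplication is the canonical map followed by
  \<open>id \<otimes> \<epsilon>\<close>.\<close>

lemma mult_split:
  assumes q: "q \<in> carrier P"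
  shows "tensor_lift K P (mult P) (split (\<rho> q)) = q"
  using right_slice_can[OF linear_closed[OF split_linear coaction_closed[OF q]]]
  by (simp add: can_split coaction_closed q coaction_counit)

end

section \<open>Colinear maps into a comodule algebra\<close>

context comodule_algebra
begin

context
  fixes V :: "('k, 'v) module" and \<phi>
  assumes V: "module K V" and \<phi>: "\<phi> \<in> linear_maps K V (V \<boxtimes>\<^bsub>K\<^esub> C)"
begin

lemma colinearD:
  assumes "f \<in> colinear_maps K C V \<phi> P \<rho>"
  shows "f \<in> linear_maps K V P" "w \<in> carrier V \<Longrightarrow> \<rho> (f w) = tensor_map K P C f id (\<phi> w)"
  using assms by (auto simp: colinear_maps_def)

lemma colinearI:
  assumes "f \<in> linear_maps K V P" "\<And>w. w \<in> carrier V \<Longrightarrow> \<rho> (f w) = tensor_map K P C f id (\<phi> w)"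
  shows "f \<in> colinear_maps K C V \<phi> P \<rho>"
  using assms by (auto simp: colinear_maps_def)

lemma colinear_cong:
  assumes f: "f \<in> colinear_maps K C V \<phi> P \<rho>" and eq: "\<And>w. w \<in> carrier V \<Longrightarrow> g w = f w"
  shows "g \<in> colinear_maps K C V \<phi> P \<rho>"
  by (rule colinearI[OF linear_cong[OF V colinearD(1)[OF f] eq]])
    (simp_all add: eq colinearD(2)[OF f] tensor_map_cong[OF V C_module alg_module colinearD(1)[OF f] eq linear_closed[OF \<phi>]])

lemma colinear_add:
  assumes f: "f \<in> colinear_maps K C V \<phi> P \<rho>" and g: "g \<in> colinear_maps K C V \<phi> P \<rho>"
  shows "(\<lambda>w. f w \<oplus>\<^bsub>P\<^esub> g w) \<in> colinear_maps K C V \<phi> P \<rho>"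
proof (rule colinearI)
  note fl = colinearD(1)[OF f] and gl = colinearD(1)[OF g]
  show fgl: "(\<lambda>w. f w \<oplus>\<^bsub>P\<^esub> g w) \<in> linear_maps K V P"
    by (rule linear_plus[OF alg_module fl gl])
  fix w assume w: "w \<in> carrier V"
  note tm = tensor_map_linear[OF V C_module alg_module C_module _ linear_id]
    and tp = tensor_map_pure[OF V C_module alg_module C_module _ linear_id]
  have "tensor_map K P C (\<lambda>w. f w \<oplus>\<^bsub>P\<^esub> g w) id (\<phi> w) =
      tensor_map K P C f id (\<phi> w) \<oplus>\<^bsub>P \<boxtimes>\<^bsub>K\<^esub> C\<^esub> tensor_map K P C g id (\<phi> w)"
    by (rule tensor_linear_eqI[OF V C_module PC_module tm[OF fgl] linear_plus[OF PC_module tm[OF fl] tm[OF gl]] _ linear_closed[OF \<phi> w]])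
      (simp add: tp[OF fgl] tp[OF fl] tp[OF gl] linear_closed[OF fl] linear_closed[OF gl]
        linear_add[OF bilinear_left[OF pure_bilinear[OF alg_module C_module]]])
  then show "\<rho> (f w \<oplus>\<^bsub>P\<^esub> g w) = tensor_map K P C (\<lambda>w. f w \<oplus>\<^bsub>P\<^esub> g w) id (\<phi> w)"
    by (simp add: linear_add[OF coaction_linear] linear_closed[OF fl] linear_closed[OF gl] w colinearD(2)[OF f] colinearD(2)[OF g])
qed

lemma colinear_smult:
  assumes b: "b \<in> B" and f: "f \<in> colinear_maps K C V \<phi> P \<rho>"
  shows "(\<lambda>w. b \<otimes>\<^bsub>P\<^esub> f w) \<in> colinear_maps K C V \<phi> P \<rho>"
proof (rule colinearI)
  note fl = colinearD(1)[OF f] and bP = coinvariantsD(1)[OF b]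
  show bl: "(\<lambda>w. b \<otimes>\<^bsub>P\<^esub> f w) \<in> linear_maps K V P"
    by (rule linear_comp[OF fl left_mult_linear[OF bP]])
  fix w assume w: "w \<in> carrier V"
  note tm = tensor_map_linear[OF V C_module alg_module C_module _ linear_id]
    and tp = tensor_map_pure[OF V C_module alg_module C_module _ linear_id]
  have "tensor_map K P C (\<lambda>w. b \<otimes>\<^bsub>P\<^esub> f w) id (\<phi> w) = act b (tensor_map K P C f id (\<phi> w))"
    by (rule tensor_linear_eqI[OF V C_module PC_module tm[OF bl] linear_comp[OF tm[OF fl] left_act_linear[OF C_module bP]] _ linear_closed[OF \<phi> w]])
      (simp add: tp[OF bl] tp[OF fl] linear_closed[OF fl] bP left_act_pure[OF C_module])
  then show "\<rho> (b \<otimes>\<^bsub>P\<^esub> f w) = tensor_map K P C (\<lambda>w. b \<otimes>\<^bsub>P\<^esub> f w) id (\<phi> w)"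
    using coinvariantsD(2)[OF b linear_closed[OF fl w]] by (simp add: colinearD(2)[OF f w])
qed

lemma colinear_zero: "(\<lambda>w. \<zero>\<^bsub>P\<^esub>) \<in> colinear_maps K C V \<phi> P \<rho>"
proof (rule colinearI)
  interpret PC: module K "P \<boxtimes>\<^bsub>K\<^esub> C" by (rule PC_module)
  show zl: "(\<lambda>w. \<zero>\<^bsub>P\<^esub>) \<in> linear_maps K V P"
    by (rule linear_mapsI) auto
  have zl': "(\<lambda>w. \<zero>\<^bsub>P \<boxtimes>\<^bsub>K\<^esub> C\<^esub>) \<in> linear_maps K (V \<boxtimes>\<^bsub>K\<^esub> C) (P \<boxtimes>\<^bsub>K\<^esub> C)"
    by (rule linear_mapsI) auto
  fix w assume w: "w \<in> carrier V"
  have "tensor_map K P C (\<lambda>w. \<zero>\<^bsub>P\<^esub>) id (\<phi> w) = \<zero>\<^bsub>P \<boxtimes>\<^bsub>K\<^esub> C\<^esub>"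
    by (rule tensor_linear_eqI[OF V C_module PC_module tensor_map_linear[OF V C_module alg_module C_module zl linear_id] zl' _ linear_closed[OF \<phi> w]])
      (simp add: tensor_map_pure[OF V C_module alg_module C_module zl linear_id]
        linear_zero[OF bilinear_left[OF pure_bilinear[OF alg_module C_module]] P.abelian_group_axioms PC.abelian_group_axioms])
  then show "\<rho> \<zero>\<^bsub>P\<^esub> = tensor_map K P C (\<lambda>w. \<zero>\<^bsub>P\<^esub>) id (\<phi> w)"
    by (simp add: linear_zero[OF coaction_linear P.abelian_group_axioms PC.abelian_group_axioms])
qed

lemma colinear_combination:
  assumes "finite A" "\<And>i. i \<in> A \<Longrightarrow> x i \<in> B" "\<And>i. i \<in> A \<Longrightarrow> f i \<in> colinear_maps K C V \<phi> P \<rho>"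
  shows "(\<lambda>w. \<Oplus>\<^bsub>P\<^esub>i\<in>A. x i \<otimes>\<^bsub>P\<^esub> f i w) \<in> colinear_maps K C V \<phi> P \<rho>"
  using assms
proof (induction A rule: finite_induct)
  case empty
  then show ?case using colinear_zero by simp
next
  case (insert j A)
  have c: "x i \<otimes>\<^bsub>P\<^esub> f i w \<in> carrier P" if "i \<in> insert j A" "w \<in> carrier V" for i w
    using coinvariantsD(1)[OF insert.prems(1)[OF that(1)]] linear_closed[OF colinearD(1)[OF insert.prems(2)[OF that(1)]] that(2)]
    by simp
  have "(\<lambda>w. x j \<otimes>\<^bsub>P\<^esub> f j w \<oplus>\<^bsub>P\<^esub> (\<Oplus>\<^bsub>P\<^esub>i\<in>A. x i \<otimes>\<^bsub>P\<^esub> f i w)) \<in> colinear_maps K C V \<phi> P \<rho>"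
    by (rule colinear_add[OF colinear_smult insert.IH]) (use insert.prems in auto)
  then show ?case
    by (rule colinear_cong) (use insert.hyps c in \<open>auto intro!: P.finsum_insert\<close>)
qed

end

end

section \<open>Reproducing colinear maps\<close>

locale corepresentation_setup = strongly_connected_extension K P C \<Delta> \<epsilon> \<rho> e l
  for K :: "('k, 'x) ring_scheme" (structure) and P :: "('k, 'p) module" (structure)
    and C :: "('k, 'c) module" and \<Delta> \<epsilon> \<rho> e l +
  fixes V :: "('k, 'v) module" and \<phi> :: "'v \<Rightarrow> ('v \<times> 'c \<Rightarrow> 'k) set"
    and I :: "'i set" and p :: "'i \<Rightarrow> 'p" and d :: "'i \<Rightarrow> 'p \<Rightarrow> 'k"
    and N :: "'j set" and v :: "'j \<Rightarrow> 'v" and vd :: "'j \<Rightarrow> 'v \<Rightarrow> 'k" and \<sigma> :: "'p \<Rightarrow> 'p"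
  assumes corep: "right_comodule K C \<Delta> \<epsilon> V \<phi>"
    and basis_P: "basis K P I p" and dual_P: "dual_family K P I p d"
    and finite_N: "finite N" and basis_V: "basis K V N v" and dual_V: "dual_family K V N v vd"
    and sigma: "\<sigma> \<in> linear_maps (coinvariant_ring K C P \<rho>) (regular_module P (carrier P)) (regular_module P B)"
    and sigma_one: "\<sigma> \<one>\<^bsub>P\<^esub> = \<one>\<^bsub>P\<^esub>"
begin

lemma V_module: "module K V" and phi_linear: "\<phi> \<in> linear_maps K V (V \<boxtimes>\<^bsub>K\<^esub> C)"
  and phi_coassoc: "w \<in> carrier V \<Longrightarrow>
    tensor_assoc K V C C (tensor_map K (V \<boxtimes>\<^bsub>K\<^esub> C) C \<phi> id (\<phi> w)) = tensor_map K V (C \<boxtimes>\<^bsub>K\<^esub> C) id \<Delta> (\<phi> w)"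
  using corep by (simp_all add: right_comodule_def)

definition r :: "'i \<Rightarrow> 'c \<Rightarrow> 'p" where "r \<mu> c = left_slice K P (d \<mu>) (l c)"

text \<open>The matrix coefficients of \<open>V\<close> are the values \<open>\<chi> i (v j)\<close>.  Keeping \<open>\<chi> i\<close> as a map on \<open>V\<close> makes it
  colinear from \<open>V\<close> to \<open>C\<close>, with no reference to the second index.\<close>

definition \<chi> :: "'j \<Rightarrow> 'v \<Rightarrow> 'c" where "\<chi> i w = left_slice K C (vd i) (\<phi> w)"

definition M :: "'i set" where "M = {\<mu> \<in> I. \<exists>i\<in>N. \<exists>j\<in>N. r \<mu> (\<chi> i (v j)) \<noteq> \<zero>\<^bsub>P\<^esub>}"

abbreviation "H \<equiv> colinear_maps K C V \<phi> P \<rho>"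

lemma r_colinear: "\<mu> \<in> I \<Longrightarrow> r \<mu> \<in> colinear_maps K C C \<Delta> P \<rho>"
  unfolding r_def[abs_def]
  by (rule left_slice_colinear[OF alg_module alg_module C_module C_module dual_functional[OF dual_P] l_linear
      comult_linear coaction_linear l_right_colinear])

lemma chi_colinear: "i \<in> N \<Longrightarrow> \<chi> i \<in> colinear_maps K C V \<phi> C \<Delta>"
  unfolding \<chi>_def[abs_def]
  by (rule left_slice_colinear[OF V_module C_module C_module V_module dual_functional[OF dual_V] phi_linear
      phi_linear comult_linear phi_coassoc[symmetric]])

lemma r_chi_colinear: "\<lbrakk>\<mu> \<in> I; i \<in> N\<rbrakk> \<Longrightarrow> (\<lambda>w. r \<mu> (\<chi> i w)) \<in> H"
  by (rule colinear_comp[OF V_module C_module alg_module C_module chi_colinear r_colinear phi_linear])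

lemma r_linear: "\<mu> \<in> I \<Longrightarrow> r \<mu> \<in> linear_maps K C P"
  and chi_linear: "i \<in> N \<Longrightarrow> \<chi> i \<in> linear_maps K V C"
  using r_colinear chi_colinear by (auto simp: colinear_maps_def)

lemmas r_closed = linear_closed[OF r_linear] and chi_closed = linear_closed[OF chi_linear]
lemmas v_closed = basis_closed[OF basis_V] and p_closed = basis_closed[OF basis_P]

lemma M_subset: "M \<subseteq> I"
  by (auto simp: M_def)

lemma finite_M: "finite M"
proof -
  have "M = (\<Union>i\<in>N. \<Union>j\<in>N. {\<mu> \<in> I. r \<mu> (\<chi> i (v j)) \<noteq> \<zero>\<^bsub>P\<^esub>})" by (auto simp: M_def)
  moreover have "finite {\<mu> \<in> I. r \<mu> c \<noteq> \<zero>\<^bsub>P\<^esub>}" if "c \<in> carrier C" for c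
    unfolding r_def by (rule left_slices_finite[OF alg_module alg_module basis_P dual_P l_closed[OF that]])
  ultimately show ?thesis using finite_N chi_closed v_closed by auto
qed

text \<open>The set \<open>M\<close> tests the vectors of the basis only; by linearity it serves all of \<open>V\<close>.\<close>

lemma M_support:
  assumes \<mu>: "\<mu> \<in> I" and i: "i \<in> N" and w: "w \<in> carrier V" and nz: "r \<mu> (\<chi> i w) \<noteq> \<zero>\<^bsub>P\<^esub>"
  shows "\<mu> \<in> M"
proof (rule ccontr)
  assume "\<mu> \<notin> M"
  then have z: "r \<mu> (\<chi> i (v j)) = \<zero>\<^bsub>P\<^esub>" if "j \<in> N" for j using \<mu> i that by (auto simp: M_def)
  interpret V: module K V by (rule V_module)
  note lin = linear_comp[OF chi_linear[OF i] r_linear[OF \<mu>]]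
  have vc: "vd j w \<in> carrier K" if "j \<in> N" for j
    using linear_closed[OF dual_functional[OF dual_V that] w] by simp
  have "w = (\<Oplus>\<^bsub>V\<^esub>j\<in>N. vd j w \<odot>\<^bsub>V\<^esub> v j)"
    by (rule basis_expansion[symmetric, OF V_module basis_V dual_V w finite_N subset_refl])
  then have "r \<mu> (\<chi> i w) = r \<mu> (\<chi> i (\<Oplus>\<^bsub>V\<^esub>j\<in>N. vd j w \<odot>\<^bsub>V\<^esub> v j))" by simp
  also have "\<dots> = (\<Oplus>\<^bsub>P\<^esub>j\<in>N. r \<mu> (\<chi> i (vd j w \<odot>\<^bsub>V\<^esub> v j)))"
    by (rule linear_finsum[OF lin V.abelian_group_axioms P.abelian_group_axioms finite_N]) (use vc v_closed in auto)
  also have "\<dots> = (\<Oplus>\<^bsub>P\<^esub>j\<in>N. \<zero>\<^bsub>P\<^esub>)"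
    by (rule P.finsum_cong') (use vc v_closed z in \<open>auto simp: linear_smult[OF lin]\<close>)
  finally show False using nz by simp
qed

lemma sigma_B: "x \<in> carrier P \<Longrightarrow> \<sigma> x \<in> B"
  and sigma_add: "\<lbrakk>x \<in> carrier P; y \<in> carrier P\<rbrakk> \<Longrightarrow> \<sigma> (x \<oplus>\<^bsub>P\<^esub> y) = \<sigma> x \<oplus>\<^bsub>P\<^esub> \<sigma> y"
  and sigma_mult: "\<lbrakk>b \<in> B; x \<in> carrier P\<rbrakk> \<Longrightarrow> \<sigma> (b \<otimes>\<^bsub>P\<^esub> x) = b \<otimes>\<^bsub>P\<^esub> \<sigma> x"
  using linear_closed[OF sigma] linear_add[OF sigma] linear_smult[OF sigma] by simp_all

lemma sigma_fixes: "b \<in> B \<Longrightarrow> \<sigma> b = b"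
  using sigma_mult[of b "\<one>\<^bsub>P\<^esub>"] sigma_one coinvariantsD(1) by simp

lemma sigma_linear: "\<sigma> \<in> linear_maps K P P"
proof (rule linear_mapsI)
  fix a x assume a: "a \<in> carrier K" and x: "x \<in> carrier P"
  show "\<sigma> (a \<odot>\<^bsub>P\<^esub> x) = a \<odot>\<^bsub>P\<^esub> \<sigma> x"
    using sigma_mult[OF scalars_coinvariant[OF a] x] a x coinvariantsD(1)[OF sigma_B[OF x]]
    by (simp add: smult_mult_left)
qed (use sigma_B coinvariantsD(1) sigma_add in auto)

lemmas sigma_closed = linear_closed[OF sigma_linear]

abbreviation "\<beta> \<equiv> tensor_lift K P (\<lambda>x y. \<sigma> x \<otimes>\<^bsub>P\<^esub> y)"

lemma beta_inner: "bilinear K P P P (\<lambda>x y. \<sigma> x \<otimes>\<^bsub>P\<^esub> y)"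
  by (rule bilinear_comp[OF mult_bilinear sigma_linear linear_ident linear_ident])

lemmas beta_linear = tensor_lift_linear[OF alg_module alg_module alg_module beta_inner]
lemmas beta_pure = tensor_lift_pure[OF alg_module alg_module alg_module beta_inner]

text \<open>The tensor \<open>q\<^sub>0 l(q\<^sub>1)\<close> lies in \<open>B \<otimes> P\<close>, and \<open>\<sigma>\<close> is the identity on \<open>B\<close>; so applying \<open>\<sigma>\<close> to
  the first factor before multiplying does not change the product, which is \<open>q\<close>.\<close>

lemma beta_split:
  assumes q: "q \<in> carrier P"
  shows "\<beta> (split (\<rho> q)) = q"
proof -
  interpret PP: module K "P \<boxtimes>\<^bsub>K\<^esub> P" by (rule PP_module)
  let ?t = "split (\<rho> q)"
  note t = linear_closed[OF split_linear coaction_closed[OF q]]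
  note mult_lin = tensor_lift_linear[OF alg_module alg_module alg_module mult_bilinear]
  obtain A where A: "finite A" "A \<subseteq> I"
    and t_eq: "?t = (\<Oplus>\<^bsub>P \<boxtimes>\<^bsub>K\<^esub> P\<^esub>i\<in>A. pure K P P (right_slice K P (d i) ?t) (p i))"
    by (rule right_slices_expand[OF alg_module alg_module basis_P dual_P t])
  let ?b = "\<lambda>i. right_slice K P (d i) ?t"
  have b: "?b i \<in> B" "?b i \<in> carrier P" "p i \<in> carrier P" if "i \<in> A" for i
    using right_slice_split_coinvariant[OF dual_functional[OF dual_P] q] coinvariantsD(1) p_closed A(2) that by auto
  have pc: "(\<lambda>i. pure K P P (?b i) (p i)) \<in> A \<rightarrow> carrier (P \<boxtimes>\<^bsub>K\<^esub> P)"
    using b by (auto intro!: pure_closed[OF alg_module alg_module])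
  have "\<beta> ?t = (\<Oplus>\<^bsub>P\<^esub>i\<in>A. \<beta> (pure K P P (?b i) (p i)))"
    by (subst t_eq) (rule linear_finsum[OF beta_linear PP.abelian_group_axioms P.abelian_group_axioms A(1) pc])
  also have "\<dots> = (\<Oplus>\<^bsub>P\<^esub>i\<in>A. tensor_lift K P (mult P) (pure K P P (?b i) (p i)))"
    using b pc linear_closed[OF mult_lin]
    by (intro P.finsum_cong')
      (auto simp: beta_pure sigma_fixes tensor_lift_pure[OF alg_module alg_module alg_module mult_bilinear])
  also have "\<dots> = tensor_lift K P (mult P) (\<Oplus>\<^bsub>P \<boxtimes>\<^bsub>K\<^esub> P\<^esub>i\<in>A. pure K P P (?b i) (p i))"
    by (rule linear_finsum[symmetric, OF mult_lin PP.abelian_group_axioms P.abelian_group_axioms A(1) pc])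
  also have "\<dots> = q"
    using mult_split[OF q] t_eq by simp
  finally show ?thesis .
qed

text \<open>Take \<open>q = f(w)\<close> in the previous lemma.  As \<open>f\<close> is colinear, \<open>q\<^sub>0 \<otimes> q\<^sub>1\<close> is the sum of the
  \<open>f(v\<^sub>i) \<otimes> \<chi>\<^sub>i(w)\<close>, and \<open>l(\<chi>\<^sub>i(w))\<close> is the sum of the \<open>p\<^sub>\<mu> \<otimes> r\<^sub>\<mu>(\<chi>\<^sub>i(w))\<close> over \<open>\<mu> \<in> M\<close>.\<close>

lemma colinear_reproducing:
  assumes f: "f \<in> H" and w: "w \<in> carrier V"
  shows "(\<Oplus>\<^bsub>P\<^esub>z\<in>M \<times> N. \<sigma> (f (v (snd z)) \<otimes>\<^bsub>P\<^esub> p (fst z)) \<otimes>\<^bsub>P\<^esub> r (fst z) (\<chi> (snd z) w)) = f w"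
proof -
  interpret PP: module K "P \<boxtimes>\<^bsub>K\<^esub> P" by (rule PP_module)
  interpret VC: module K "V \<boxtimes>\<^bsub>K\<^esub> C" by (rule tensor_module[OF V_module C_module])
  note fl = colinearD(1)[OF V_module phi_linear f]
  note tm = tensor_map_linear[OF V_module C_module alg_module C_module fl linear_id]
  note cl = linear_closed[OF fl] v_closed chi_closed[OF _ w] l_closed
  have inner: "\<beta> (left_act K P P u (l (\<chi> i w))) = (\<Oplus>\<^bsub>P\<^esub>\<mu>\<in>M. \<sigma> (u \<otimes>\<^bsub>P\<^esub> p \<mu>) \<otimes>\<^bsub>P\<^esub> r \<mu> (\<chi> i w))"
    if u: "u \<in> carrier P" and i: "i \<in> N" for u i
  proof -
    note lin = linear_comp[OF left_act_linear[OF alg_module u] beta_linear]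
    have MI: "\<mu> \<in> I" if "\<mu> \<in> M" for \<mu> using that M_subset by blast
    have c: "p \<mu> \<in> carrier P" "r \<mu> (\<chi> i w) \<in> carrier P" if "\<mu> \<in> M" for \<mu>
      using that MI p_closed r_closed cl(3) i by auto
    have pc: "(\<lambda>\<mu>. pure K P P (p \<mu>) (r \<mu> (\<chi> i w))) \<in> M \<rightarrow> carrier (P \<boxtimes>\<^bsub>K\<^esub> P)"
      using c by (auto intro!: pure_closed[OF alg_module alg_module])
    have "l (\<chi> i w) = (\<Oplus>\<^bsub>P \<boxtimes>\<^bsub>K\<^esub> P\<^esub>\<mu>\<in>M. pure K P P (p \<mu>) (r \<mu> (\<chi> i w)))"
      unfolding r_def
      by (rule left_slices_expand[symmetric, OF alg_module alg_module basis_P dual_P l_closed[OF cl(3)[OF i]] finite_M M_subset])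
        (use M_support[OF _ i w] in \<open>auto simp: r_def\<close>)
    then have "\<beta> (left_act K P P u (l (\<chi> i w))) = \<beta> (left_act K P P u (\<Oplus>\<^bsub>P \<boxtimes>\<^bsub>K\<^esub> P\<^esub>\<mu>\<in>M. pure K P P (p \<mu>) (r \<mu> (\<chi> i w))))"
      by simp
    also have "\<dots> = (\<Oplus>\<^bsub>P\<^esub>\<mu>\<in>M. \<beta> (left_act K P P u (pure K P P (p \<mu>) (r \<mu> (\<chi> i w)))))"
      by (rule linear_finsum[OF lin PP.abelian_group_axioms P.abelian_group_axioms finite_M pc])
    also have "\<dots> = (\<Oplus>\<^bsub>P\<^esub>\<mu>\<in>M. \<sigma> (u \<otimes>\<^bsub>P\<^esub> p \<mu>) \<otimes>\<^bsub>P\<^esub> r \<mu> (\<chi> i w))"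
      by (rule P.finsum_cong') (auto simp: left_act_pure[OF alg_module] u c beta_pure sigma_closed)
    finally show ?thesis .
  qed
  have "\<phi> w = (\<Oplus>\<^bsub>V \<boxtimes>\<^bsub>K\<^esub> C\<^esub>i\<in>N. pure K V C (v i) (\<chi> i w))"
    unfolding \<chi>_def
    by (rule left_slices_expand[symmetric, OF V_module C_module basis_V dual_V linear_closed[OF phi_linear w] finite_N subset_refl])
  then have "f w = \<beta> (split (tensor_map K P C f id (\<Oplus>\<^bsub>V \<boxtimes>\<^bsub>K\<^esub> C\<^esub>i\<in>N. pure K V C (v i) (\<chi> i w))))"
    using beta_split[OF cl(1)[OF w]] colinearD(2)[OF V_module phi_linear f w] by simp
  also have "\<dots> = (\<Oplus>\<^bsub>P\<^esub>i\<in>N. \<beta> (split (tensor_map K P C f id (pure K V C (v i) (\<chi> i w)))))"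
    by (rule linear_finsum[OF linear_comp[OF linear_comp[OF tm split_linear] beta_linear] VC.abelian_group_axioms P.abelian_group_axioms finite_N])
      (auto intro!: pure_closed[OF V_module C_module] cl)
  also have "\<dots> = (\<Oplus>\<^bsub>P\<^esub>i\<in>N. \<Oplus>\<^bsub>P\<^esub>\<mu>\<in>M. \<sigma> (f (v i) \<otimes>\<^bsub>P\<^esub> p \<mu>) \<otimes>\<^bsub>P\<^esub> r \<mu> (\<chi> i w))"
    using M_subset
    by (intro P.finsum_cong')
      (auto simp: tensor_map_pure[OF V_module C_module alg_module C_module fl linear_id] cl split_pure inner p_closed subsetD
        intro!: P.finsum_closed P.m_closed sigma_closed r_closed)
  also have "\<dots> = (\<Oplus>\<^bsub>P\<^esub>z\<in>M \<times> N. \<sigma> (f (v (snd z)) \<otimes>\<^bsub>P\<^esub> p (fst z)) \<otimes>\<^bsub>P\<^esub> r (fst z) (\<chi> (snd z) w))"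
    by (rule P.finsum_Times[OF finite_M finite_N])
      (use M_subset in \<open>auto intro!: P.m_closed sigma_closed r_closed cl p_closed\<close>)
  finally show ?thesis by simp
qed

section \<open>Rows and colinear maps\<close>

abbreviation "Hom \<equiv> H \<inter> extensional (carrier V)"
abbreviation "BR \<equiv> coinvariant_ring K C P \<rho>"

definition coeff :: "('v \<Rightarrow> 'p) \<Rightarrow> 'i \<times> 'j \<Rightarrow> 'p" where
  "coeff f = (\<lambda>z\<in>M \<times> N. \<sigma> (f (v (snd z)) \<otimes>\<^bsub>P\<^esub> p (fst z)))"

definition combine :: "('i \<times> 'j \<Rightarrow> 'p) \<Rightarrow> 'v \<Rightarrow> 'p" where
  "combine x = (\<lambda>w\<in>carrier V. \<Oplus>\<^bsub>P\<^esub>z\<in>M \<times> N. x z \<otimes>\<^bsub>P\<^esub> r (fst z) (\<chi> (snd z) w))"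

definition idem :: "'i \<times> 'j \<Rightarrow> 'i \<times> 'j \<Rightarrow> 'p" where
  "idem z z' = \<sigma> (r (fst z) (\<chi> (snd z) (v (snd z'))) \<otimes>\<^bsub>P\<^esub> p (fst z'))"

lemma finite_MN: "finite (M \<times> N)"
  using finite_M finite_N by simp

lemma MN_closed:
  assumes "z \<in> M \<times> N"
  shows "fst z \<in> I" "snd z \<in> N" "p (fst z) \<in> carrier P" "v (snd z) \<in> carrier V"
    "w \<in> carrier V \<Longrightarrow> r (fst z) (\<chi> (snd z) w) \<in> carrier P"
  using assms M_subset p_closed v_closed r_closed chi_closed by auto

lemma BR_ring: "ring BR"
  by (rule P.subring_is_ring[OF coinvariants_subring])

lemma Hom_value: "\<lbrakk>f \<in> H; w \<in> carrier V\<rbrakk> \<Longrightarrow> f w \<in> carrier P"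
  by (rule linear_closed[OF colinearD(1)[OF V_module phi_linear]])

lemma idem_closed: "\<lbrakk>z \<in> M \<times> N; z' \<in> M \<times> N\<rbrakk> \<Longrightarrow> idem z z' \<in> B"
  unfolding idem_def by (intro sigma_B P.m_closed MN_closed)

lemma coeff_closed:
  assumes f: "f \<in> H" shows "coeff f \<in> (M \<times> N) \<rightarrow>\<^sub>E B"
proof -
  have "\<sigma> (f (v (snd z)) \<otimes>\<^bsub>P\<^esub> p (fst z)) \<in> B" if "z \<in> M \<times> N" for z
    by (intro sigma_B P.m_closed MN_closed[OF that] Hom_value[OF f])
  then show ?thesis by (auto simp: coeff_def)
qed

lemma combine_closed:
  assumes x: "x \<in> (M \<times> N) \<rightarrow>\<^sub>E B" shows "combine x \<in> Hom"
proof
  have "(\<lambda>w. \<Oplus>\<^bsub>P\<^esub>z\<in>M \<times> N. x z \<otimes>\<^bsub>P\<^esub> r (fst z) (\<chi> (snd z) w)) \<in> H"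
    by (rule colinear_combination[OF V_module phi_linear finite_MN])
      (use x in \<open>auto intro!: r_chi_colinear M_subset[THEN subsetD]\<close>)
  then show "combine x \<in> H"
    by (rule colinear_cong[OF V_module phi_linear]) (simp add: combine_def)
  show "combine x \<in> extensional (carrier V)" by (simp add: combine_def)
qed

lemma combine_coeff:
  assumes f: "f \<in> Hom" shows "combine (coeff f) = f"
proof (rule extensionalityI[of _ "carrier V"])
  show "combine (coeff f) \<in> extensional (carrier V)" by (simp add: combine_def)
  show "f \<in> extensional (carrier V)" using f by simp
  fix w assume w: "w \<in> carrier V"
  have "(\<Oplus>\<^bsub>P\<^esub>z\<in>M \<times> N. coeff f z \<otimes>\<^bsub>P\<^esub> r (fst z) (\<chi> (snd z) w)) =
      (\<Oplus>\<^bsub>P\<^esub>z\<in>M \<times> N. \<sigma> (f (v (snd z)) \<otimes>\<^bsub>P\<^esub> p (fst z)) \<otimes>\<^bsub>P\<^esub> r (fst z) (\<chi> (snd z) w))"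
  proof (rule P.finsum_cong')
    have "\<sigma> (f (v (snd z)) \<otimes>\<^bsub>P\<^esub> p (fst z)) \<otimes>\<^bsub>P\<^esub> r (fst z) (\<chi> (snd z) w) \<in> carrier P" if "z \<in> M \<times> N" for z
      using f by (intro P.m_closed sigma_closed Hom_value MN_closed[OF that] w) blast
    then show "(\<lambda>z. \<sigma> (f (v (snd z)) \<otimes>\<^bsub>P\<^esub> p (fst z)) \<otimes>\<^bsub>P\<^esub> r (fst z) (\<chi> (snd z) w)) \<in> M \<times> N \<rightarrow> carrier P"
      by blast
  qed (simp_all add: coeff_def)
  then show "combine (coeff f) w = f w"
    using colinear_reproducing[OF _ w] f w by (simp add: combine_def)
qed

text \<open>Left \<open>B\<close>-linearity of \<open>\<sigma>\<close> moves the entries of \<open>x\<close> out of \<open>\<sigma>\<close>.  Together with \<open>combine_coeff\<close> this carries the whole theorem: a composite \<open>coeff \<circ> combine\<close> with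
  \<open>combine \<circ> coeff = id\<close> is idempotent, and its image is isomorphic to the space of colinear maps.\<close>

lemma coeff_combine:
  assumes x: "x \<in> (M \<times> N) \<rightarrow>\<^sub>E B"
  shows "coeff (combine x) = row_times BR (M \<times> N) x idem"
proof -
  have xB: "x z \<in> B" if "z \<in> M \<times> N" for z using x that by auto
  note xP = coinvariantsD(1)[OF xB]
  have "coeff (combine x) z' = (\<Oplus>\<^bsub>BR\<^esub>z\<in>M \<times> N. x z \<otimes>\<^bsub>P\<^esub> idem z z')" if z': "z' \<in> M \<times> N" for z'
  proof -
    note c = MN_closed(3,4)[OF z'] and c' = MN_closed(5)[OF _ MN_closed(4)[OF z']]
    have lin: "(\<lambda>y. \<sigma> (y \<otimes>\<^bsub>P\<^esub> p (fst z'))) \<in> linear_maps K P P"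
      by (rule linear_comp[OF right_mult_linear[OF c(1)] sigma_linear])
    have "coeff (combine x) z' =
        \<sigma> ((\<Oplus>\<^bsub>P\<^esub>z\<in>M \<times> N. x z \<otimes>\<^bsub>P\<^esub> r (fst z) (\<chi> (snd z) (v (snd z')))) \<otimes>\<^bsub>P\<^esub> p (fst z'))"
      using z' c(2) by (simp add: coeff_def combine_def)
    also have "\<dots> = (\<Oplus>\<^bsub>P\<^esub>z\<in>M \<times> N. \<sigma> (x z \<otimes>\<^bsub>P\<^esub> r (fst z) (\<chi> (snd z) (v (snd z'))) \<otimes>\<^bsub>P\<^esub> p (fst z')))"
      by (rule linear_finsum[OF lin P.abelian_group_axioms P.abelian_group_axioms finite_MN]) (use xP c' in simp)
    also have "\<dots> = (\<Oplus>\<^bsub>P\<^esub>z\<in>M \<times> N. x z \<otimes>\<^bsub>P\<^esub> idem z z')"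
    proof (rule P.finsum_cong')
      show "(\<lambda>z. x z \<otimes>\<^bsub>P\<^esub> idem z z') \<in> M \<times> N \<rightarrow> carrier P"
        using xP coinvariantsD(1)[OF idem_closed[OF _ z']] by simp
      fix z assume z: "z \<in> M \<times> N"
      show "\<sigma> (x z \<otimes>\<^bsub>P\<^esub> r (fst z) (\<chi> (snd z) (v (snd z'))) \<otimes>\<^bsub>P\<^esub> p (fst z')) = x z \<otimes>\<^bsub>P\<^esub> idem z z'"
        unfolding idem_def using xB[OF z] xP[OF z] c'[OF z] c(1) by (simp add: P.m_assoc sigma_mult)
    qed simp
    also have "\<dots> = (\<Oplus>\<^bsub>BR\<^esub>z\<in>M \<times> N. x z \<otimes>\<^bsub>P\<^esub> idem z z')"
      by (rule P.finsum_subring[symmetric, OF coinvariants_subring finite_MN])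
        (use xB idem_closed[OF _ z'] subringE(6)[OF coinvariants_subring] in simp)
    finally show ?thesis .
  qed
  then show ?thesis
    by (intro extensionalityI[of _ "M \<times> N"]) (auto simp: coeff_def row_times_def)
qed

text \<open>Each row of \<open>idem\<close> lies in the image of \<open>coeff\<close>, on which right multiplication by \<open>idem\<close> is the
  identity; that is idempotency.\<close>

lemma coeff_generator:
  assumes "z \<in> M \<times> N" "z' \<in> M \<times> N"
  shows "coeff (\<lambda>w\<in>carrier V. r (fst z) (\<chi> (snd z) w)) z' = idem z z'"
  using assms MN_closed(4)[OF assms(2)] by (simp add: coeff_def idem_def)

lemma generator_Hom:
  assumes "z \<in> M \<times> N" shows "(\<lambda>w\<in>carrier V. r (fst z) (\<chi> (snd z) w)) \<in> Hom"
  using colinear_cong[OF V_module phi_linear r_chi_colinear[OF MN_closed(1,2)[OF assms]]] by simp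

lemma row_times_coeff:
  assumes f: "f \<in> Hom" shows "row_times BR (M \<times> N) (coeff f) idem = coeff f"
proof -
  have "f \<in> H" using f by blast
  from coeff_combine[OF coeff_closed[OF this]] combine_coeff[OF f] show ?thesis by simp
qed

lemma idem_idempotent:
  assumes z: "z \<in> M \<times> N" and z': "z' \<in> M \<times> N"
  shows "(\<Oplus>\<^bsub>BR\<^esub>y\<in>M \<times> N. idem z y \<otimes>\<^bsub>BR\<^esub> idem y z') = idem z z'"
proof -
  interpret BR: ring BR by (rule BR_ring)
  let ?f = "\<lambda>w\<in>carrier V. r (fst z) (\<chi> (snd z) w)"
  have "(\<Oplus>\<^bsub>BR\<^esub>y\<in>M \<times> N. idem z y \<otimes>\<^bsub>BR\<^esub> idem y z') = (\<Oplus>\<^bsub>BR\<^esub>y\<in>M \<times> N. coeff ?f y \<otimes>\<^bsub>BR\<^esub> idem y z')"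
    by (rule BR.finsum_cong') (use z z' coeff_generator idem_closed subringE(6)[OF coinvariants_subring] in auto)
  also have "\<dots> = row_times BR (M \<times> N) (coeff ?f) idem z'"
    using z' by (simp add: row_times_def)
  also have "\<dots> = idem z z'"
    using row_times_coeff[OF generator_Hom[OF z]] coeff_generator[OF z z'] by simp
  finally show ?thesis .
qed

lemma row_image_eq: "row_image BR (M \<times> N) idem = (row_module P (M \<times> N))\<lparr>carrier := coeff ` Hom\<rparr>"
proof -
  have "{row_times BR (M \<times> N) x idem |x. x \<in> carrier (row_module BR (M \<times> N))} = coeff ` Hom"
  proof (intro equalityI subsetI)
    fix y assume "y \<in> {row_times BR (M \<times> N) x idem |x. x \<in> carrier (row_module BR (M \<times> N))}"
    then obtain x where "x \<in> (M \<times> N) \<rightarrow>\<^sub>E B" "y = row_times BR (M \<times> N) x idem" by auto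
    then show "y \<in> coeff ` Hom" using coeff_combine combine_closed by (metis imageI)
  next
    fix y assume "y \<in> coeff ` Hom"
    then obtain f where f: "f \<in> Hom" "y = coeff f" by blast
    then have "y = row_times BR (M \<times> N) (coeff f) idem" "coeff f \<in> carrier (row_module BR (M \<times> N))"
      using row_times_coeff coeff_closed by auto
    then show "y \<in> {row_times BR (M \<times> N) x idem |x. x \<in> carrier (row_module BR (M \<times> N))}" by blast
  qed
  then show ?thesis by (simp add: row_image_def row_module_def)
qed

lemma colinear_module_eq: "colinear_module K C V \<phi> P \<rho> = (row_module P (carrier V))\<lparr>carrier := Hom\<rparr>"
  by (simp add: colinear_module_def row_module_def)

lemma Hom_add: "\<lbrakk>f \<in> Hom; g \<in> Hom\<rbrakk> \<Longrightarrow> (\<lambda>w\<in>carrier V. f w \<oplus>\<^bsub>P\<^esub> g w) \<in> Hom"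
  by (auto intro: colinear_cong[OF V_module phi_linear colinear_add[OF V_module phi_linear]])

lemma Hom_smult: "\<lbrakk>b \<in> B; f \<in> Hom\<rbrakk> \<Longrightarrow> (\<lambda>w\<in>carrier V. b \<otimes>\<^bsub>P\<^esub> f w) \<in> Hom"
  by (auto intro: colinear_cong[OF V_module phi_linear colinear_smult[OF V_module phi_linear]])

lemma Hom_zero: "(\<lambda>w\<in>carrier V. \<zero>\<^bsub>P\<^esub>) \<in> Hom"
  using colinear_cong[OF V_module phi_linear colinear_zero[OF V_module phi_linear]] by simp

lemma coeff_add:
  assumes "f \<in> Hom" "g \<in> Hom"
  shows "coeff (\<lambda>w\<in>carrier V. f w \<oplus>\<^bsub>P\<^esub> g w) = (\<lambda>z\<in>M \<times> N. coeff f z \<oplus>\<^bsub>P\<^esub> coeff g z)"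
  unfolding coeff_def
  using assms by (intro restrict_ext) (simp add: MN_closed Hom_value P.l_distr sigma_add)

lemma coeff_smult:
  assumes "b \<in> B" "f \<in> Hom"
  shows "coeff (\<lambda>w\<in>carrier V. b \<otimes>\<^bsub>P\<^esub> f w) = (\<lambda>z\<in>M \<times> N. b \<otimes>\<^bsub>P\<^esub> coeff f z)"
  unfolding coeff_def
  using assms coinvariantsD(1) by (intro restrict_ext) (simp add: MN_closed Hom_value P.m_assoc sigma_mult)

lemma coeff_zero: "coeff (\<lambda>w\<in>carrier V. \<zero>\<^bsub>P\<^esub>) = (\<lambda>z\<in>M \<times> N. \<zero>\<^bsub>P\<^esub>)"
  unfolding coeff_def
  using sigma_fixes subringE(2)[OF coinvariants_subring] by (intro restrict_ext) (simp add: MN_closed)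

lemma row_image_isomorphic:
  "left_module_isomorphic BR (row_image BR (M \<times> N) idem) (colinear_module K C V \<phi> P \<rho>)"
  unfolding left_module_isomorphic_def row_image_eq colinear_module_eq
proof (intro conjI bexI)
  show "left_module BR ((row_module P (carrier V))\<lparr>carrier := Hom\<rparr>)"
    by (rule P.function_module[OF coinvariants_subring])
      (use Hom_zero Hom_add Hom_smult Hom_value in \<open>auto simp: PiE_def\<close>)
  show "left_module BR ((row_module P (M \<times> N))\<lparr>carrier := coeff ` Hom\<rparr>)"
  proof (rule P.function_module[OF coinvariants_subring])
    show "coeff ` Hom \<subseteq> (M \<times> N) \<rightarrow>\<^sub>E carrier P"
      using coeff_closed coinvariantsD(1) by (fastforce simp: PiE_def Pi_def)
    show "(\<lambda>z\<in>M \<times> N. \<zero>\<^bsub>P\<^esub>) \<in> coeff ` Hom"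
      using imageI[OF Hom_zero, of coeff] unfolding coeff_zero .
    show "(\<lambda>z\<in>M \<times> N. x z \<oplus>\<^bsub>P\<^esub> y z) \<in> coeff ` Hom" if x: "x \<in> coeff ` Hom" and y: "y \<in> coeff ` Hom" for x y
    proof -
      obtain f where f: "f \<in> Hom" "x = coeff f" using x by (rule imageE)
      obtain g where g: "g \<in> Hom" "y = coeff g" using y by (rule imageE)
      show ?thesis
        using imageI[OF Hom_add[OF f(1) g(1)], of coeff] unfolding coeff_add[OF f(1) g(1)] f(2) g(2) .
    qed
    show "(\<lambda>z\<in>M \<times> N. b \<otimes>\<^bsub>P\<^esub> x z) \<in> coeff ` Hom" if b: "b \<in> B" and x: "x \<in> coeff ` Hom" for b x
    proof -
      obtain f where f: "f \<in> Hom" "x = coeff f" using x by (rule imageE)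
      show ?thesis
        using imageI[OF Hom_smult[OF b f(1)], of coeff] unfolding coeff_smult[OF b f(1)] f(2) .
    qed
  qed
  show "combine \<in> linear_maps BR ((row_module P (M \<times> N))\<lparr>carrier := coeff ` Hom\<rparr>) ((row_module P (carrier V))\<lparr>carrier := Hom\<rparr>)"
  proof (rule linear_mapsI)
    fix x assume "x \<in> carrier ((row_module P (M \<times> N))\<lparr>carrier := coeff ` Hom\<rparr>)"
    then obtain f where f: "f \<in> Hom" "x = coeff f" by auto
    then show "combine x \<in> carrier ((row_module P (carrier V))\<lparr>carrier := Hom\<rparr>)"
      using combine_coeff[OF f(1)] by simp
    fix y assume "y \<in> carrier ((row_module P (M \<times> N))\<lparr>carrier := coeff ` Hom\<rparr>)"
    then obtain g where g: "g \<in> Hom" "y = coeff g" by auto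
    show "combine (x \<oplus>\<^bsub>(row_module P (M \<times> N))\<lparr>carrier := coeff ` Hom\<rparr>\<^esub> y) =
        combine x \<oplus>\<^bsub>(row_module P (carrier V))\<lparr>carrier := Hom\<rparr>\<^esub> combine y"
      using combine_coeff[OF Hom_add[OF f(1) g(1)]] coeff_add[OF f(1) g(1)]
      by (simp add: f(2) g(2) combine_coeff[OF f(1)] combine_coeff[OF g(1)])
  next
    fix b x assume b: "b \<in> carrier BR" and "x \<in> carrier ((row_module P (M \<times> N))\<lparr>carrier := coeff ` Hom\<rparr>)"
    then obtain f where f: "f \<in> Hom" "x = coeff f" by auto
    from b have b: "b \<in> B" by simp
    show "combine (b \<odot>\<^bsub>(row_module P (M \<times> N))\<lparr>carrier := coeff ` Hom\<rparr>\<^esub> x) =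
        b \<odot>\<^bsub>(row_module P (carrier V))\<lparr>carrier := Hom\<rparr>\<^esub> combine x"
      using combine_coeff[OF Hom_smult[OF b f(1)]] coeff_smult[OF b f(1)]
      by (simp add: f(2) combine_coeff[OF f(1)])
  qed
  show "bij_betw combine (carrier ((row_module P (M \<times> N))\<lparr>carrier := coeff ` Hom\<rparr>)) (carrier ((row_module P (carrier V))\<lparr>carrier := Hom\<rparr>))"
    by (rule bij_betw_byWitness[where f' = coeff]) (auto simp: combine_coeff[OF IntI])
qed

end

section \<open>The module of colinear maps\<close>

theorem theorem3p1:
  fixes K :: "'k ring"
    and C :: "('k, 'c) module" and \<Delta> :: "'c \<Rightarrow> ('c \<times> 'c \<Rightarrow> 'k) set" and \<epsilon> :: "'c \<Rightarrow> 'k"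
    and P :: "('k, 'p) module" and \<Delta>\<^sub>P :: "'p \<Rightarrow> ('p \<times> 'c \<Rightarrow> 'k) set" and e :: 'c
    and l :: "'c \<Rightarrow> ('p \<times> 'p \<Rightarrow> 'k) set"
    and V :: "('k, 'v) module" and \<phi> :: "'v \<Rightarrow> ('v \<times> 'c \<Rightarrow> 'k) set"
    and I :: "'i set" and p :: "'i \<Rightarrow> 'p" and d :: "'i \<Rightarrow> 'p \<Rightarrow> 'k" and r :: "'i \<Rightarrow> 'c \<Rightarrow> 'p"
    and n :: nat and v :: "nat \<Rightarrow> 'v" and ec :: "nat \<Rightarrow> nat \<Rightarrow> 'c"
    and B :: "('k, 'p) module" and \<sigma> :: "'p \<Rightarrow> 'p"
    and E :: "'i \<times> nat \<Rightarrow> 'i \<times> nat \<Rightarrow> 'p"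
    and M :: "'i set" and J :: "('i \<times> nat) set"
  assumes field: "field K"
    and principal: "principal_extension K C \<Delta> \<epsilon> P \<Delta>\<^sub>P e"
    and B: "B = coinvariant_ring K C P \<Delta>\<^sub>P"
    and connection: "strong_connection K C \<Delta> P \<Delta>\<^sub>P e l"
    and corep: "right_comodule K C \<Delta> \<epsilon> V \<phi>"
    and basis_P: "basis K P I p"
    and dual_P: "dual_family K P I p d"
    and r: "r = (\<lambda>\<mu> c. tensor_lift K P (\<lambda>x y. d \<mu> x \<odot>\<^bsub>P\<^esub> y) (l c))"
    and basis_V: "basis K V {1..n} v"
    and ec: "\<forall>i\<in>{1..n}. \<forall>j\<in>{1..n}. ec i j \<in> carrier C"
    and ec_phi: "\<forall>j\<in>{1..n}. \<phi> (v j) = (\<Oplus>\<^bsub>V \<boxtimes>\<^bsub>K\<^esub> C\<^esub>i\<in>{1..n}. pure K V C (v i) (ec i j))"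
    and sigma: "\<sigma> \<in> linear_maps B (regular_module P (carrier P)) (regular_module P (carrier B))"
    and sigma_one: "\<sigma> \<one>\<^bsub>P\<^esub> = \<one>\<^bsub>P\<^esub>"
    and E: "E = (\<lambda>(\<mu>, i) (\<nu>, j). \<sigma> (r \<mu> (ec i j) \<otimes>\<^bsub>P\<^esub> p \<nu>))"
    and M: "M = {\<mu> \<in> I. \<exists>i\<in>{1..n}. \<exists>j\<in>{1..n}. r \<mu> (ec i j) \<noteq> \<zero>\<^bsub>P\<^esub>}"
    and J: "J = M \<times> {1..n}"
  shows "finite M \<and>
    (\<forall>x\<in>J. \<forall>y\<in>J. E x y \<in> carrier B) \<and>
    (\<forall>x\<in>J. \<forall>y\<in>J. (\<Oplus>\<^bsub>B\<^esub>z\<in>J. E x z \<otimes>\<^bsub>B\<^esub> E z y) = E x y) \<and>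
    left_module_isomorphic B (row_image B J E) (colinear_module K C V \<phi> P \<Delta>\<^sub>P)"
proof -
  have ext: "c_extension K C \<Delta> \<epsilon> P \<Delta>\<^sub>P" using principal by (simp add: principal_extension_def)
  have V: "module K V" and C: "module K C"
    using corep ext by (simp_all add: right_comodule_def c_extension_def coalgebra_def)
  obtain vd where vd: "dual_family K V {1..n} v vd"
    by (rule finite_basis_dual[OF V basis_V]) simp
  interpret S: corepresentation_setup K P C \<Delta> \<epsilon> \<Delta>\<^sub>P e l V \<phi> I p d "{1..n}" v vd \<sigma>
    using ext principal connection corep basis_P dual_P basis_V vd sigma sigma_one
    by (intro corepresentation_setup.intro strongly_connected_extension.intro comodule_algebra.intro
        algebra_over_ring.intro comodule_algebra_axioms.intro strongly_connected_extension_axioms.intro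
        corepresentation_setup_axioms.intro)
      (simp_all add: c_extension_def B)
  interpret VC: module K "V \<boxtimes>\<^bsub>K\<^esub> C" by (rule tensor_module[OF V C])
  interpret C: module K C by (rule C)
  interpret BR: ring B unfolding B by (rule S.BR_ring)
  \<comment> \<open>The coefficient maps give back the prescribed matrix coefficients, so that the matrices agree on
    \<open>J\<close>.\<close>
  have chi: "S.\<chi> i (v j) = ec i j" if i: "i \<in> {1..n}" and j: "j \<in> {1..n}" for i j
  proof -
    note di = dual_functional[OF vd i]
    have "S.\<chi> i (v j) = (\<Oplus>\<^bsub>C\<^esub>k\<in>{1..n}. left_slice K C (vd i) (pure K V C (v k) (ec k j)))"
      unfolding S.\<chi>_def bspec[OF ec_phi j]
      by (rule linear_finsum[OF left_slice_linear[OF V C di] VC.abelian_group_axioms C.abelian_group_axioms])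
        (use ec j in \<open>auto intro!: pure_closed[OF V C] S.v_closed\<close>)
    also have "\<dots> = (\<Oplus>\<^bsub>C\<^esub>k\<in>{1..n}. if i = k then ec k j else \<zero>\<^bsub>C\<^esub>)"
    proof (rule C.finsum_cong')
      fix k assume k: "k \<in> {1..n}"
      have "vd i (v k) = (if i = k then \<one>\<^bsub>K\<^esub> else \<zero>\<^bsub>K\<^esub>)"
        using vd i k by (simp add: dual_family_def)
      then show "left_slice K C (vd i) (pure K V C (v k) (ec k j)) = (if i = k then ec k j else \<zero>\<^bsub>C\<^esub>)"
        using ec j k by (simp add: left_slice_pure[OF V C di] S.v_closed)
    qed (use ec j in auto)
    also have "\<dots> = ec i j"
      by (rule C.add.finprod_singleton[OF i]) (use ec j in auto)
    finally show ?thesis .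
  qed
  have rS: "r = S.r" unfolding r by (simp add: fun_eq_iff S.r_def left_slice_def)
  have MS: "M = S.M" unfolding M S.M_def by (auto simp: rS chi)
  have ES: "E x y = S.idem x y" if "x \<in> J" "y \<in> J" for x y
    using that by (auto simp: E J S.idem_def rS chi)
  have JS: "J = S.M \<times> {1..n}" by (simp add: J MS)
  have closed: "S.idem x y \<in> carrier B" if "x \<in> J" "y \<in> J" for x y
    using S.idem_closed that by (simp add: B JS)
  have rows: "row_image B J E = row_image B J S.idem"
  proof -
    have "row_times B J x E = row_times B J x S.idem" if "x \<in> carrier (row_module B J)" for x
      unfolding row_times_def
    proof (rule restrict_ext)
      fix j assume j: "j \<in> J"
      show "(\<Oplus>\<^bsub>B\<^esub>i\<in>J. x i \<otimes>\<^bsub>B\<^esub> E i j) = (\<Oplus>\<^bsub>B\<^esub>i\<in>J. x i \<otimes>\<^bsub>B\<^esub> S.idem i j)"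
      proof (rule BR.finsum_cong')
        show "(\<lambda>i. x i \<otimes>\<^bsub>B\<^esub> S.idem i j) \<in> J \<rightarrow> carrier B"
          using that by (intro Pi_I BR.m_closed closed j) (auto simp: PiE_mem)
      qed (simp_all add: ES j)
    qed
    then have "{row_times B J x E |x. x \<in> carrier (row_module B J)} = {row_times B J x S.idem |x. x \<in> carrier (row_module B J)}"
      by (metis (no_types, lifting))
    then show ?thesis by (simp add: row_image_def)
  qed
  show ?thesis
  proof (intro conjI ballI)
    show "finite M" using S.finite_M MS by simp
    show "E x y \<in> carrier B" if "x \<in> J" "y \<in> J" for x y using ES closed that by simp
    show "(\<Oplus>\<^bsub>B\<^esub>z\<in>J. E x z \<otimes>\<^bsub>B\<^esub> E z y) = E x y" if xy: "x \<in> J" "y \<in> J" for x y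
    proof -
      have "(\<Oplus>\<^bsub>B\<^esub>z\<in>J. E x z \<otimes>\<^bsub>B\<^esub> E z y) = (\<Oplus>\<^bsub>B\<^esub>z\<in>J. S.idem x z \<otimes>\<^bsub>B\<^esub> S.idem z y)"
        by (rule BR.finsum_cong') (use xy closed ES in auto)
      then show ?thesis using S.idem_idempotent xy ES by (simp add: JS B)
    qed
    show "left_module_isomorphic B (row_image B J E) (colinear_module K C V \<phi> P \<Delta>\<^sub>P)"
      unfolding rows using S.row_image_isomorphic by (simp add: JS B)
  qed
qed

end
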